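(* Let $0\le\delta<\rho\le1$ and $m>0$. Let $A=\mathrm{Op}(\sigma_A)$ with $\sigma_A\in S^{2m}_{\rho,\delta}(\mathbb{Z}^n\times\mathbb{T}^n)$ be elliptic (of order $2m$) and such that $\sigma_A(k,x)\ge0$ for all $x\in\mathbb{T}^n$ and for all but finitely many $k\in\mathbb{Z}^n$. Then there exist $C_0,C_1>0$ such that for all $f\in\ell^2_m(\mathbb{Z}^n)$ we have $$\mathrm{Re}\,(Af,f)_{\ell^2(\mathbb{Z}^n)}\ge C_0\|f\|_{\ell^2_m(\mathbb{Z}^n)}^2-C_1\|f\|_{\ell^2(\mathbb{Z}^n)}^2.$$
   Context: $\mathbb{T}^n=\mathbb{R}^n/\mathbb{Z}^n$ with normalised Lebesgue measure. For rapidly decreasing $f$ on $\mathbb{Z}^n$, $\widehat f(x)=\sum_{k\in\mathbb{Z}^n}e^{-2\pi i k\cdot x}f(k)$ and $\mathrm{Op}(\sigma)f(k)=\int_{\mathbb{T}^n}e^{2\pi i k\cdot x}\sigma(k,x)\widehat f(x)\,dx$. For $s\in\mathbb{R}$, $\ell^2_s(\mathbb{Z}^n)$ is the space of $f:\mathbb{Z}^n\to\mathbb{C}$ with $\|f\|_{\ell^2_s(\mathbb{Z}^n)}=\big(\sum_{k}(1+|k|)^{2s}|f(k)|^2\big)^{1/2}<\infty$. An operator with symbol in $S^{2m}_{\rho,\delta}$ is extended to $\ell^2_m(\mathbb{Z}^n)\to\ell^2_{-m}(\mathbb{Z}^n)$, and $(g,f)_{\ell^2(\mathbb{Z}^n)}=\sum_k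 g(k)\overline{f(k)}$, which converges absolutely for $g\in\ell^2_{-m}$, $f\in\ell^2_m$. $\Delta^\alpha=\Delta_1^{\alpha_1}\cdots\Delta_n^{\alpha_n}$ with $\Delta_j\tau(k)=\tau(k+v_j)-\tau(k)$, $v_j$ the $j$-th standard unit vector; $D_x^{(\alpha)}=D_{x_1}^{(\alpha_1)}\cdots D_{x_n}^{(\alpha_n)}$ with $D_{x_j}^{(0)}=I$, $D_{x_j}^{(\ell)}=\prod_{r=0}^{\ell-1}\big(\frac{1}{2\pi i}\frac{\partial}{\partial x_j}-r\big)$ for $\ell\ge1$. $S^\mu_{\rho,\delta}(\mathbb{Z}^n\times\mathbb{T}^n)$ consists of $\sigma:\mathbb{Z}^n\times\mathbb{T}^n\to\mathbb{C}$ with $\sigma(k,\cdot)\in C^\infty(\mathbb{T}^n)$ for all $k$ and, for all multi-indices $\alpha,\beta$, $|D_x^{(\beta)}\Delta_k^\alpha\sigma(k,x)|\le C_{\alpha,\beta}(1+|k|)^{\mu-\rho|\alpha|+\delta|\beta|}$ for all $(k,x)$. A symbol $\sigma\in S^\mu_{\rho,\delta}$ (and $\mathrm{Op}(\sigma)$) is elliptic of order $\mu$ if there are $C,M>0$ with $|\sigma(k,x)|\ge C(1+|k|)^\mu$ for all $x\in\mathbb{T}^n$ and all $|k|\ge M$. *)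

theory Defs
  imports "HOL-Analysis.Analysis"
begin

text \<open>
  The lattice \<open>\<int>\<^sup>n\<close> is the type \<open>int ^ 'n\<close>. Functions on the torus are functions on
  \<open>real ^ 'n\<close> that have period 1 in every coordinate, and the normalised Lebesgue measure of
  the torus is Lebesgue measure on the unit cube. Multi-indices are elements of \<open>nat ^ 'n\<close>.
\<close>

definition lvec :: "int ^ 'n \<Rightarrow> real ^ 'n"
  where "lvec k = (\<chi> j. real_of_int (k $ j))"

definition bracket :: "int ^ 'n \<Rightarrow> real"
  where "bracket k = 1 + norm (lvec k)"

definition mlen :: "nat ^ 'n \<Rightarrow> nat"
  where "mlen \<alpha> = (\<Sum>j\<in>UNIV. \<alpha> $ j)"

text \<open>
  An enumeration of the coordinates, used to write the iterated operators as compositions. The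
  operators composed below commute (the differential ones on smooth functions), so the choice
  of enumeration is immaterial.
\<close>

definition coords :: "'n::finite list"
  where "coords = (SOME js. set js = UNIV \<and> distinct js)"

lemma coords: "set (coords :: 'n::finite list) = UNIV" "distinct (coords :: 'n list)"
proof -
  have "\<exists>js :: 'n list. set js = UNIV \<and> distinct js"
    using finite_distinct_list[of "UNIV :: 'n set"] by auto
  then have "set (coords :: 'n list) = UNIV \<and> distinct (coords :: 'n list)"
    unfolding coords_def by (rule someI_ex)
  then show "set (coords :: 'n list) = UNIV" "distinct (coords :: 'n list)" by auto
qed

definition diff_op :: "'n \<Rightarrow> (int ^ 'n \<Rightarrow> complex) \<Rightarrow> int ^ 'n \<Rightarrow> complex"
  where "diff_op j \<tau> k = \<tau> (k + axis j 1) - \<tau> k"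

definition mdiff_op :: "nat ^ 'n \<Rightarrow> (int ^ 'n \<Rightarrow> complex) \<Rightarrow> int ^ 'n \<Rightarrow> complex"
  where "mdiff_op \<alpha> = foldr (\<lambda>j. diff_op j ^^ (\<alpha> $ j)) coords"

definition pderiv_op :: "'n \<Rightarrow> (real ^ 'n \<Rightarrow> complex) \<Rightarrow> real ^ 'n \<Rightarrow> complex"
  where "pderiv_op j g x = vector_derivative (\<lambda>t. g (x + t *\<^sub>R axis j 1)) (at 0)"

definition smooth_torus :: "(real ^ 'n \<Rightarrow> complex) \<Rightarrow> bool"
  where "smooth_torus g \<longleftrightarrow>
    (\<forall>x j. g (x + axis j 1) = g x) \<and>
    (\<forall>js. foldr pderiv_op js g differentiable_on UNIV)"

fun D_op :: "'n \<Rightarrow> nat \<Rightarrow> (real ^ 'n \<Rightarrow> complex) \<Rightarrow> real ^ 'n \<Rightarrow> complex"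
  where
    "D_op j 0 g = g"
  | "D_op j (Suc l) g =
      (\<lambda>x. 1 / (2 * of_real pi * \<i>) * pderiv_op j (D_op j l g) x - of_nat l * D_op j l g x)"

definition mD_op :: "nat ^ 'n \<Rightarrow> (real ^ 'n \<Rightarrow> complex) \<Rightarrow> real ^ 'n \<Rightarrow> complex"
  where "mD_op \<beta> = foldr (\<lambda>j. D_op j (\<beta> $ j)) coords"

definition symbol_class ::
    "real \<Rightarrow> real \<Rightarrow> real \<Rightarrow> (int ^ 'n \<Rightarrow> real ^ 'n \<Rightarrow> complex) set"
  where "symbol_class \<mu> \<rho> \<delta> = {\<sigma>.
    (\<forall>k. smooth_torus (\<sigma> k)) \<and>
    (\<forall>\<alpha> \<beta>. \<exists>C. \<forall>k x.
      cmod (mD_op \<beta> (\<lambda>y. mdiff_op \<alpha> (\<lambda>l. \<sigma> l y) k) x)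
        \<le> C * bracket k powr (\<mu> - \<rho> * real (mlen \<alpha>) + \<delta> * real (mlen \<beta>)))}"

definition elliptic :: "real \<Rightarrow> (int ^ 'n \<Rightarrow> real ^ 'n \<Rightarrow> complex) \<Rightarrow> bool"
  where "elliptic \<mu> \<sigma> \<longleftrightarrow>
    (\<exists>C>0. \<exists>M>0. \<forall>k x. norm (lvec k) \<ge> M \<longrightarrow> cmod (\<sigma> k x) \<ge> C * bracket k powr \<mu>)"

definition rapidly_decreasing :: "(int ^ 'n \<Rightarrow> complex) \<Rightarrow> bool"
  where "rapidly_decreasing f \<longleftrightarrow>
    (\<forall>N::nat. \<exists>C. \<forall>k. cmod (f k) \<le> C * bracket k powr (- real N))"

definition fourier :: "(int ^ 'n \<Rightarrow> complex) \<Rightarrow> real ^ 'n \<Rightarrow> complex"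
  where "fourier f x = (\<Sum>\<^sub>\<infinity>k. exp (- (2 * of_real pi * \<i> * of_real (lvec k \<bullet> x))) * f k)"

definition Op ::
    "(int ^ 'n \<Rightarrow> real ^ 'n \<Rightarrow> complex) \<Rightarrow> (int ^ 'n \<Rightarrow> complex) \<Rightarrow> int ^ 'n \<Rightarrow> complex"
  where "Op \<sigma> f k =
    (LINT x:cbox 0 1|lborel. exp (2 * of_real pi * \<i> * of_real (lvec k \<bullet> x)) * \<sigma> k x * fourier f x)"

definition l2 :: "real \<Rightarrow> (int ^ 'n \<Rightarrow> complex) set"
  where "l2 s = {f. (\<lambda>k. bracket k powr (2 * s) * (cmod (f k))\<^sup>2) summable_on UNIV}"

definition l2norm :: "real \<Rightarrow> (int ^ 'n \<Rightarrow> complex) \<Rightarrow> real"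
  where "l2norm s f = sqrt (\<Sum>\<^sub>\<infinity>k. bracket k powr (2 * s) * (cmod (f k))\<^sup>2)"

definition l2inner :: "(int ^ 'n \<Rightarrow> complex) \<Rightarrow> (int ^ 'n \<Rightarrow> complex) \<Rightarrow> complex"
  where "l2inner g f = (\<Sum>\<^sub>\<infinity>k. g k * cnj (f k))"

definition bounded_linear_l2 ::
    "real \<Rightarrow> real \<Rightarrow> ((int ^ 'n \<Rightarrow> complex) \<Rightarrow> int ^ 'n \<Rightarrow> complex) \<Rightarrow> bool"
  where "bounded_linear_l2 s t A \<longleftrightarrow>
    (\<forall>f\<in>l2 s. A f \<in> l2 t) \<and>
    (\<forall>f\<in>l2 s. \<forall>g\<in>l2 s. A (\<lambda>k. f k + g k) = (\<lambda>k. A f k + A g k)) \<and>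
    (\<forall>c. \<forall>f\<in>l2 s. A (\<lambda>k. c * f k) = (\<lambda>k. c * A f k)) \<and>
    (\<exists>C. \<forall>f\<in>l2 s. l2norm t (A f) \<le> C * l2norm s f)"

text \<open>
  The extension of \<open>Op \<sigma>\<close> from rapidly decreasing functions to a bounded linear operator from
  \<open>l2 m\<close> to \<open>l2 (- m)\<close>. It is unique because rapidly decreasing functions are dense in \<open>l2 m\<close>;
  its value outside \<open>l2 m\<close> is set to zero by convention. That the extension exists for a
  symbol of order \<open>2 * m\<close> is a theorem about the symbol class, not part of this definition.
\<close>

definition Op_ext ::
    "real \<Rightarrow> (int ^ 'n \<Rightarrow> real ^ 'n \<Rightarrow> complex) \<Rightarrow> (int ^ 'n \<Rightarrow> complex) \<Rightarrow> int ^ 'n \<Rightarrow> complex"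
  where "Op_ext m \<sigma> = (THE A.
    bounded_linear_l2 m (- m) A \<and>
    (\<forall>f. rapidly_decreasing f \<longrightarrow> A f = Op \<sigma> f) \<and>
    (\<forall>f. f \<notin> l2 m \<longrightarrow> A f = (\<lambda>_. 0)))"

end

theory Submission
  imports Defs
begin

text \<open>
  The operator has the matrix \<open>A k l\<close>, the Fourier coefficient of \<open>\<sigma> k\<close> at \<open>l - k\<close>. Freezing the
  symbol at a lattice point \<open>c\<close> gives a Toeplitz matrix, whose quadratic form is the integral of
  \<open>\<sigma> c\<close> against a nonnegative density on the torus; its norm is at most the supremum of \<open>\<bar>\<sigma> c\<bar>\<close>,
  and it is bounded below by the infimum of \<open>Re (\<sigma> c)\<close>. Choose \<open>\<tau>\<close> strictly between \<open>\<delta>\<close> and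
  \<open>\<rho>\<close>. At distance about \<open>L = 2\<^sup>p\<close> from the origin one works on cubes of side about
  \<open>L\<^sup>\<tau>\<close>. Since \<open>\<tau> < \<rho>\<close>, freezing the symbol on such a cube changes the operator by a small
  fraction of \<open>L\<close> to the power \<open>2 * m\<close>. Since \<open>\<tau> > \<delta>\<close>, entries linking points further apart decay faster than
  any power, and averaging over all translates of a window of that size amounts to convolving
  the symbol in \<open>x\<close> with an approximate identity, again with a relatively small error. A slowly varying
  dyadic partition of unity in the row index sums these estimates to the inequality for finitely
  supported sequences, and a density argument extends it.
\<close>

section \<open>Characters and integrals on the torus\<close>

text \<open>Two errors pull the side of the cubes in opposite directions. Telescoping across a cube
  costs L^\<tau> for each difference, which decays like L^(-\<rho>); smoothing at scale L^(-\<tau>)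
  in x meets a derivative of relative size L^\<delta>. With \<tau> the midpoint of \<delta> and
  \<rho>, both leave the factor L^(-\<kappa>), where \<kappa> = (\<rho> - \<delta>) / 2. It falls
  below any prescribed constant once L is large, and the finitely many rows at smaller L are charged
  to the unweighted norm. No composition, adjoint or square root of symbols occurs: positivity
  enters only as a lower bound for a frozen symbol. The obstacle to plain localisation is that the
  form does not split over cubes, since entries linking neighbouring cubes are not small. Forms cut
  down by a window do not have this defect once they are summed over all positions: they add up
  exactly to one form whose entries carry the autocorrelation of the window as a factor. The near
  and far estimates also show that the operator is bounded between the weighted spaces, hence that
  the extension in the statement exists.\<close>

definition ch :: "int ^ 'n \<Rightarrow> real ^ 'n \<Rightarrow> complex"
  where "ch k x = exp (2 * of_real pi * \<i> * of_real (lvec k \<bullet> x))"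

lemma lvec_simps [simp]:
  "lvec 0 = 0" "lvec (k + l) = lvec k + lvec l" "lvec (- k) = - lvec k" "lvec (k - l) = lvec k - lvec l"
  "lvec (axis j 1) = axis j 1" "lvec k $ i = real_of_int (k $ i)"
  by (auto simp: lvec_def vec_eq_iff axis_def)

lemma ch_0 [simp]: "ch 0 x = 1" "ch k 0 = 1"
  by (simp_all add: ch_def)

lemma ch_add: "ch (k + l) x = ch k x * ch l x"
  by (simp add: ch_def inner_add_left ring_distribs exp_add)

lemma ch_add_right: "ch k (x + y) = ch k x * ch k y"
  by (simp add: ch_def inner_add_right ring_distribs exp_add)

lemma ch_eq_cis: "ch k x = cis (2 * pi * (lvec k \<bullet> x))"
  by (simp add: ch_def cis_conv_exp mult_ac)

lemma ch_minus: "ch (- k) x = cnj (ch k x)"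
  by (simp add: ch_eq_cis cis_cnj)

lemma ch_minus_right: "ch k (- x) = cnj (ch k x)"
  by (simp add: ch_eq_cis cis_cnj)

lemma ch_diff: "ch (k - l) x = ch k x * cnj (ch l x)"
  using ch_add[of k "- l" x] by (simp add: ch_minus)

lemma ch_diff_right: "ch k (x - y) = ch k x * cnj (ch k y)"
  using ch_add_right[of k x "- y"] by (simp add: ch_minus_right)

lemma cmod_ch [simp]: "cmod (ch k x) = 1"
  by (simp add: ch_eq_cis)

lemma ch_mult_cnj [simp]: "ch k x * cnj (ch k x) = 1"
  by (simp add: complex_norm_square[symmetric])

lemma continuous_on_ch [continuous_intros]:
  "continuous_on S f \<Longrightarrow> continuous_on S (\<lambda>x. ch k (f x))"
  unfolding ch_def by (intro continuous_intros)

lemma ch_periodic [simp]: "ch k (x + axis j 1) = ch k x"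
proof -
  have "ch k (axis j 1) = 1"
    by (simp add: ch_eq_cis inner_axis)
  then show ?thesis by (simp add: ch_add_right)
qed

definition tcont :: "(real ^ 'n \<Rightarrow> complex) \<Rightarrow> bool"
  where "tcont g \<longleftrightarrow> continuous_on UNIV g \<and> (\<forall>x j. g (x + axis j 1) = g x)"

lemma tcont_cont: "tcont g \<Longrightarrow> continuous_on S g"
  unfolding tcont_def using continuous_on_subset by blast

lemma tcont_ch [intro!]: "tcont (ch k)"
  unfolding tcont_def by (auto intro!: continuous_intros)

lemma tcont_const [intro!]: "tcont (\<lambda>_. c)"
  unfolding tcont_def by (auto intro!: continuous_intros)

lemma tcont_mult [intro!]: "tcont f \<Longrightarrow> tcont g \<Longrightarrow> tcont (\<lambda>x. f x * g x)"
  unfolding tcont_def by (auto intro!: continuous_intros)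

lemma tcont_add [intro!]: "tcont f \<Longrightarrow> tcont g \<Longrightarrow> tcont (\<lambda>x. f x + g x)"
  unfolding tcont_def by (auto intro!: continuous_intros)

lemma tcont_diff [intro!]: "tcont f \<Longrightarrow> tcont g \<Longrightarrow> tcont (\<lambda>x. f x - g x)"
  unfolding tcont_def by (auto intro!: continuous_intros)

lemma tcont_sum [intro!]: "(\<And>i. i \<in> I \<Longrightarrow> tcont (f i)) \<Longrightarrow> tcont (\<lambda>x. \<Sum>i\<in>I. f i x)"
  unfolding tcont_def by (auto intro!: continuous_intros)

abbreviation torus_int :: "(real ^ 'n \<Rightarrow> complex) \<Rightarrow> complex"
  where "torus_int g \<equiv> integral (cbox 0 1) g"

lemma tcont_integrable: "tcont g \<Longrightarrow> g integrable_on cbox a b"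
  using tcont_cont by (blast intro: integrable_continuous)

text \<open>The part of the shifted cube beyond the face at 1 is carried back by one period onto the
  slab missing at 0.\<close>

lemma integral_shift_torus:
  fixes u :: "real ^ 'n \<Rightarrow> complex"
  assumes "tcont u" "0 \<le> t" "t \<le> 1"
  shows "torus_int (\<lambda>x. u (x + t *\<^sub>R axis j 1)) = torus_int u"
proof -
  let ?e = "axis j 1 :: real ^ 'n"
  have e: "?e \<in> Basis" by (simp add: axis_in_Basis_iff)
  have int: "u integrable_on cbox a b" for a b
    using assms(1) by (rule tcont_integrable)
  have sh: "integral (cbox a b) (\<lambda>x. u (x + c)) = integral (cbox (a + c) (b + c)) u" for a b c
  proof (rule integral_unique)
    show "((\<lambda>x. u (x + c)) has_integral integral (cbox (a + c) (b + c)) u) (cbox a b)"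
      using has_integral_shift_cbox_iff[of u c "integral (cbox (a + c) (b + c)) u" a b]
        integrable_integral[OF int[of "a + c" "b + c"]]
      by (simp add: o_def add.commute)
  qed
  \<comment> \<open>Upper corner of the slab between 0 and t in the direction j.\<close>
  define b where "b = (\<chi> i. if i = j then t else (1::real))"
  have A: "torus_int (\<lambda>x. u (x + t *\<^sub>R ?e)) = integral (cbox (t *\<^sub>R ?e) (1 + t *\<^sub>R ?e)) u"
    using sh[of 0 1 "t *\<^sub>R ?e"] by simp
  have B: "\<dots> = integral (cbox (t *\<^sub>R ?e) (1 + t *\<^sub>R ?e) \<inter> {x. x \<bullet> ?e \<le> 1}) u
      + integral (cbox (t *\<^sub>R ?e) (1 + t *\<^sub>R ?e) \<inter> {x. x \<bullet> ?e \<ge> 1}) u"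
    by (rule integral_split[OF int e])
  have C: "torus_int u = integral (cbox 0 1 \<inter> {x. x \<bullet> ?e \<le> t}) u
      + integral (cbox 0 1 \<inter> {x. x \<bullet> ?e \<ge> t}) u"
    by (rule integral_split[OF int e])
  have i: "(x \<in> cbox l h) = (l $ j \<le> x $ j \<and> x $ j \<le> h $ j \<and> (\<forall>i. i \<noteq> j \<longrightarrow> l $ i \<le> x $ i \<and> x $ i \<le> h $ i))"
    for x l h :: "real ^ 'n"
    unfolding mem_box_cart by metis
  have S1: "cbox (t *\<^sub>R ?e) (1 + t *\<^sub>R ?e) \<inter> {x. x \<bullet> ?e \<le> 1} = cbox 0 1 \<inter> {x. x \<bullet> ?e \<ge> t}"
    using assms unfolding set_eq_iff Int_iff i by (auto simp: inner_axis) (auto simp: axis_def)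
  have S2: "cbox (t *\<^sub>R ?e) (1 + t *\<^sub>R ?e) \<inter> {x. x \<bullet> ?e \<ge> 1} = cbox (0 + ?e) (b + ?e)"
    using assms unfolding set_eq_iff Int_iff i by (auto simp: inner_axis b_def) (auto simp: axis_def)
  have S3: "cbox 0 1 \<inter> {x. x \<bullet> ?e \<le> t} = cbox 0 b"
    using assms unfolding set_eq_iff Int_iff i by (auto simp: inner_axis b_def)
  have "integral (cbox (0 + ?e) (b + ?e)) u = integral (cbox 0 b) u"
    using sh[of 0 b ?e] assms(1) by (simp add: tcont_def)
  then show ?thesis using A B C S1 S2 S3 by simp
qed

section \<open>Integrals of characters and of derivatives\<close>

lemma content_cube [simp]: "Henstock_Kurzweil_Integration.content (cbox 0 (1 :: real ^ 'n)) = 1"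
proof -
  have "(0 :: real ^ 'n) \<in> cbox 0 1" by (simp add: mem_box_cart)
  then show ?thesis by (subst content_cbox_cart) auto
qed

text \<open>If some coordinate of k is nonzero, a shift by half a period in that direction reverses
  the sign of \<open>ch k\<close> and preserves its integral.\<close>

lemma torus_int_ch: "torus_int (ch k) = (if k = 0 then 1 else 0)"
proof (cases "k = 0")
  case True
  then have "ch k = (\<lambda>_. 1)" by auto
  then show ?thesis using True by simp
next
  case False
  then obtain j where j: "k $ j \<noteq> 0" by (auto simp: vec_eq_iff)
  define t where "t = 1 / (2 * \<bar>real_of_int (k $ j)\<bar>)"
  have t: "0 \<le> t" "t \<le> 1"
    using j by (auto simp: t_def field_simps)
  have "2 * pi * (lvec k \<bullet> (t *\<^sub>R axis j 1)) = pi \<or> 2 * pi * (lvec k \<bullet> (t *\<^sub>R axis j 1)) = - pi"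
    using j by (auto simp: inner_axis t_def abs_if)
  then have m: "ch k (t *\<^sub>R axis j 1) = -1"
    unfolding ch_eq_cis by (elim disjE; simp only:) (simp_all add: complex_eq_iff)
  have "torus_int (ch k) = torus_int (\<lambda>x. ch k (x + t *\<^sub>R axis j 1))"
    using integral_shift_torus[OF tcont_ch t, of k j] by simp
  also have "\<dots> = - torus_int (ch k)"
    by (simp add: ch_add_right m)
  finally show ?thesis using False by simp
qed

text \<open>Integration by parts in disguise: the integral of the translates of \<open>u\<close> is
  constant in the shift, and its derivative at 0 is the integral of \<open>u'\<close>. That
  derivative is one-sided because \<open>integral_shift_torus\<close> covers shifts in
  [0, 1].\<close>

lemma torus_int_pderiv_0:
  fixes u :: "real ^ 'n \<Rightarrow> complex"
  assumes u: "tcont u" and u': "tcont u'"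
    and d: "\<And>x. ((\<lambda>t. u (x + t *\<^sub>R axis j 1)) has_vector_derivative u' x) (at 0)"
  shows "torus_int u' = 0"
proof -
  let ?e = "axis j 1 :: real ^ 'n"
  have d': "((\<lambda>t. u (x + t *\<^sub>R ?e)) has_vector_derivative u' (x + s *\<^sub>R ?e)) (at s within S)" for x s S
  proof -
    have "((\<lambda>r. r - s) has_vector_derivative 1) (at s within S)"
      by (auto intro!: derivative_eq_intros)
    moreover have "((\<lambda>t. u ((x + s *\<^sub>R ?e) + t *\<^sub>R ?e)) has_vector_derivative u' (x + s *\<^sub>R ?e))
        (at (s - s) within (\<lambda>r. r - s) ` S)"
      using d[of "x + s *\<^sub>R ?e"] has_vector_derivative_at_within by simp
    ultimately have "((\<lambda>t. u ((x + s *\<^sub>R ?e) + t *\<^sub>R ?e)) \<circ> (\<lambda>r. r - s) has_vector_derivative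
        1 *\<^sub>R u' (x + s *\<^sub>R ?e)) (at s within S)"
      by (rule vector_diff_chain_within)
    then show ?thesis by (simp add: o_def algebra_simps)
  qed
  have "((\<lambda>t. torus_int (\<lambda>x. u (x + t *\<^sub>R ?e))) has_vector_derivative
      torus_int (\<lambda>x. u' (x + 0 *\<^sub>R ?e))) (at 0 within {0..1})"
  proof (rule leibniz_rule_vector_derivative[where fx = "\<lambda>t x. u' (x + t *\<^sub>R ?e)"])
    show "continuous_on ({0..1} \<times> cbox 0 1) (\<lambda>(t, x). u' (x + t *\<^sub>R ?e))"
      unfolding split_beta
      by (rule continuous_on_compose2[OF tcont_cont[OF u', of UNIV]]) (auto intro!: continuous_intros)
    show "(\<lambda>x. u (x + t *\<^sub>R ?e)) integrable_on cbox 0 1" for t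
      by (rule integrable_continuous, rule continuous_on_compose2[OF tcont_cont[OF u, of UNIV]])
        (auto intro!: continuous_intros)
  qed (use d' in auto)
  moreover have "((\<lambda>t. torus_int (\<lambda>x. u (x + t *\<^sub>R ?e))) has_vector_derivative 0) (at 0 within {0..1})"
    by (rule has_vector_derivative_transform[where f = "\<lambda>_. torus_int u"])
      (auto simp: integral_shift_torus[OF u])
  ultimately show ?thesis
    using vector_derivative_unique_within_closed_interval[of 0 1 0] by auto
qed

section \<open>Toeplitz operators\<close>

text \<open>With this sign, expanding the Fourier series in \<open>Op\<close> gives the entry
  \<open>ft (\<sigma> k) (l - k)\<close> in row k and column l.\<close>

definition ft :: "(real ^ 'n \<Rightarrow> complex) \<Rightarrow> int ^ 'n \<Rightarrow> complex"
  where "ft h \<xi> = torus_int (\<lambda>x. ch (- \<xi>) x * h x)"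

text \<open>Only the columns are restricted to \<open>K\<close>. The row stays free, so that
  \<open>toep (h k) K g k\<close>, with a symbol varying from row to row, is covered as
  well.\<close>

definition toep :: "(real ^ 'n \<Rightarrow> complex) \<Rightarrow> (int ^ 'n) set \<Rightarrow> (int ^ 'n \<Rightarrow> complex) \<Rightarrow> int ^ 'n \<Rightarrow> complex"
  where "toep h K g k = (\<Sum>l\<in>K. ft h (l - k) * g l)"

section \<open>Linearity of the coefficients, Parseval and Bessel\<close>

lemma tcont_cnj [intro!]: "tcont f \<Longrightarrow> tcont (\<lambda>x. cnj (f x))"
  unfolding tcont_def by (auto intro!: continuous_intros)

lemma torus_int_add: "tcont f \<Longrightarrow> tcont g \<Longrightarrow> torus_int (\<lambda>x. f x + g x) = torus_int f + torus_int g"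
  by (intro Henstock_Kurzweil_Integration.integral_add tcont_integrable)

lemma torus_int_diff: "tcont f \<Longrightarrow> tcont g \<Longrightarrow> torus_int (\<lambda>x. f x - g x) = torus_int f - torus_int g"
  by (intro Henstock_Kurzweil_Integration.integral_diff tcont_integrable)

lemma torus_int_cmul: "torus_int (\<lambda>x. c * f x) = c * torus_int f"
  by simp

lemma torus_int_sum: "finite I \<Longrightarrow> (\<And>i. i \<in> I \<Longrightarrow> tcont (f i)) \<Longrightarrow>
    torus_int (\<lambda>x. \<Sum>i\<in>I. f i x) = (\<Sum>i\<in>I. torus_int (f i))"
  by (intro Henstock_Kurzweil_Integration.integral_sum tcont_integrable) auto

lemma Re_tint: "tcont f \<Longrightarrow> Re (torus_int f) = integral (cbox 0 1) (\<lambda>x. Re (f x))"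
  using integral_linear[OF tcont_integrable bounded_linear_Re, of f 0 1] by (simp add: o_def)

lemma cmod_tint_le:
  assumes "tcont f" "\<And>x. cmod (f x) \<le> B"
  shows "cmod (torus_int f) \<le> B"
  using has_integral_bound[OF _ integrable_integral[OF tcont_integrable[OF assms(1)]], of B 0 1] assms(2)
  by (auto intro: order_trans[OF norm_ge_zero assms(2)])

lemma ft_add: "tcont f \<Longrightarrow> tcont g \<Longrightarrow> ft (\<lambda>x. f x + g x) \<xi> = ft f \<xi> + ft g \<xi>"
  unfolding ft_def ring_distribs by (rule torus_int_add) auto

lemma ft_diff: "tcont f \<Longrightarrow> tcont g \<Longrightarrow> ft (\<lambda>x. f x - g x) \<xi> = ft f \<xi> - ft g \<xi>"
  unfolding ft_def right_diff_distrib by (rule torus_int_diff) auto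

lemma ft_sum: "finite I \<Longrightarrow> (\<And>i. i \<in> I \<Longrightarrow> tcont (f i)) \<Longrightarrow>
    ft (\<lambda>x. \<Sum>i\<in>I. f i x) \<xi> = (\<Sum>i\<in>I. ft (f i) \<xi>)"
  unfolding ft_def sum_distrib_left by (rule torus_int_sum) auto

lemma ft_cmul: "ft (\<lambda>x. c * f x) \<xi> = c * ft f \<xi>"
  unfolding ft_def by (simp add: mult.left_commute[of _ c])

lemma ft_ch: "ft (ch k) \<xi> = (if k = \<xi> then 1 else 0)"
proof -
  have "(\<lambda>x. ch (- \<xi>) x * ch k x) = ch (k - \<xi>)"
    by (auto simp: ch_diff ch_minus)
  then show ?thesis by (simp add: ft_def torus_int_ch)
qed

lemma cmod_ft_le:
  assumes "tcont f" "\<And>x. cmod (f x) \<le> B"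
  shows "cmod (ft f \<xi>) \<le> B"
  unfolding ft_def using assms by (intro cmod_tint_le) (auto simp: norm_mult)

lemma torus_int_trig_mult:
  assumes "finite K"
  shows "torus_int (\<lambda>x. (\<Sum>k\<in>K. a k * ch k x) * cnj (\<Sum>k\<in>K. b k * ch k x)) = (\<Sum>k\<in>K. a k * cnj (b k))"
proof -
  have "torus_int (\<lambda>x. (\<Sum>k\<in>K. a k * ch k x) * cnj (\<Sum>k\<in>K. b k * ch k x))
      = torus_int (\<lambda>x. \<Sum>k\<in>K. \<Sum>l\<in>K. a k * cnj (b l) * ch (k - l) x)"
    by (simp add: sum_product ch_diff mult_ac)
  also have "\<dots> = (\<Sum>k\<in>K. \<Sum>l\<in>K. torus_int (\<lambda>x. a k * cnj (b l) * ch (k - l) x))"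
    using assms by (subst torus_int_sum, simp, fast) (intro sum.cong refl, subst torus_int_sum, auto)
  also have "\<dots> = (\<Sum>k\<in>K. \<Sum>l\<in>K. if k = l then a k * cnj (b l) else 0)"
    by (intro sum.cong refl) (simp add: torus_int_ch)
  finally show ?thesis using assms by simp
qed

lemma integral_norm_trig:
  assumes "finite K"
  shows "integral (cbox 0 1) (\<lambda>x. (cmod (\<Sum>k\<in>K. a k * ch k x))\<^sup>2) = (\<Sum>k\<in>K. (cmod (a k))\<^sup>2)"
proof -
  let ?V = "\<lambda>x. \<Sum>k\<in>K. a k * ch k x"
  have V: "tcont ?V" by auto
  have "integral (cbox 0 1) (\<lambda>x. (cmod (?V x))\<^sup>2) = integral (cbox 0 1) (\<lambda>x. Re (?V x * cnj (?V x)))"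
    by (simp only: complex_norm_square[symmetric] Re_complex_of_real)
  also have "\<dots> = Re (torus_int (\<lambda>x. ?V x * cnj (?V x)))"
    using V by (subst Re_tint) auto
  also have "\<dots> = Re (\<Sum>k\<in>K. a k * cnj (a k))"
    using assms by (simp only: torus_int_trig_mult)
  also have "\<dots> = (\<Sum>k\<in>K. (cmod (a k))\<^sup>2)"
    by (simp only: complex_norm_square[symmetric] Re_complex_of_real Re_sum)
  finally show ?thesis .
qed

lemma integral_norm_trig_cnj:
  assumes "finite K"
  shows "integral (cbox 0 1) (\<lambda>x. (cmod (\<Sum>k\<in>K. a k * cnj (ch k x)))\<^sup>2) = (\<Sum>k\<in>K. (cmod (a k))\<^sup>2)"
proof -
  have "cmod (\<Sum>k\<in>K. a k * cnj (ch k x)) = cmod (\<Sum>k\<in>K. cnj (a k) * ch k x)" for x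
    by (subst complex_mod_cnj[symmetric]) simp
  then show ?thesis using integral_norm_trig[OF assms, of "\<lambda>k. cnj (a k)"] by simp
qed

lemma cmod_integrable: "tcont u \<Longrightarrow> (\<lambda>x. (cmod (u x))\<^sup>2) integrable_on cbox a b"
  by (intro integrable_continuous continuous_intros tcont_cont)

text \<open>Expand the nonnegative integral of the squared modulus of u - V, where V is a partial
  Fourier sum of u; the cross term and the norm of V are both given by the left-hand side.\<close>

lemma bessel:
  assumes u: "tcont u" and J: "finite J"
  shows "(\<Sum>k\<in>J. (cmod (torus_int (\<lambda>x. ch k x * u x)))\<^sup>2) \<le> integral (cbox 0 1) (\<lambda>x. (cmod (u x))\<^sup>2)"
proof -
  define a where "a k = torus_int (\<lambda>x. ch k x * u x)" for k
  define V where "V x = (\<Sum>k\<in>J. a k * cnj (ch k x))" for x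
  have V: "tcont V" unfolding V_def by auto
  have c: "torus_int (\<lambda>x. u x * cnj (V x)) = of_real (\<Sum>k\<in>J. (cmod (a k))\<^sup>2)"
  proof -
    have "torus_int (\<lambda>x. u x * cnj (V x)) = torus_int (\<lambda>x. \<Sum>k\<in>J. cnj (a k) * (ch k x * u x))"
      by (simp add: V_def sum_distrib_left mult_ac)
    also have "\<dots> = (\<Sum>k\<in>J. cnj (a k) * a k)"
      using J u by (subst torus_int_sum) (auto simp: a_def)
    finally show ?thesis by (simp only: of_real_sum complex_norm_square mult.commute)
  qed
  have pt: "(cmod (u x - V x))\<^sup>2 = (cmod (u x))\<^sup>2 + (cmod (V x))\<^sup>2 - 2 * Re (u x * cnj (V x))" for x
    unfolding cmod_power2 by (simp add: power2_eq_square algebra_simps)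
  have "0 \<le> integral (cbox 0 1) (\<lambda>x. (cmod (u x - V x))\<^sup>2)"
    by (intro integral_nonneg cmod_integrable) (use u V in auto)
  also have "\<dots> = integral (cbox 0 1) (\<lambda>x. (cmod (u x))\<^sup>2) + integral (cbox 0 1) (\<lambda>x. (cmod (V x))\<^sup>2)
      - 2 * integral (cbox 0 1) (\<lambda>x. Re (u x * cnj (V x)))"
    unfolding pt
    by (subst Henstock_Kurzweil_Integration.integral_diff Henstock_Kurzweil_Integration.integral_add;
        (intro integrable_add cmod_integrable integrable_on_mult_right integrable_continuous continuous_intros tcont_cont u V | simp))+
  also have "integral (cbox 0 1) (\<lambda>x. Re (u x * cnj (V x))) = (\<Sum>k\<in>J. (cmod (a k))\<^sup>2)"
    by (subst Re_tint[symmetric]) (use u V c in auto)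
  also have "integral (cbox 0 1) (\<lambda>x. (cmod (V x))\<^sup>2) = (\<Sum>k\<in>J. (cmod (a k))\<^sup>2)"
    unfolding V_def by (rule integral_norm_trig_cnj[OF J])
  finally show ?thesis by (simp add: a_def)
qed

text \<open>On the torus the matrix acts as multiplication by \<open>h\<close>. This turns bounds on
  the values of \<open>h\<close> into bounds for the matrix, with no loss in the size of
  \<open>K\<close>.\<close>

lemma toep_eq:
  assumes "tcont h" "finite K"
  shows "toep h K g k = torus_int (\<lambda>x. ch k x * (h x * (\<Sum>l\<in>K. g l * cnj (ch l x))))"
proof -
  have "torus_int (\<lambda>x. ch k x * (h x * (\<Sum>l\<in>K. g l * cnj (ch l x))))
      = torus_int (\<lambda>x. \<Sum>l\<in>K. g l * (ch (- (l - k)) x * h x))"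
    by (simp add: sum_distrib_left ch_diff mult_ac)
  also have "\<dots> = (\<Sum>l\<in>K. g l * ft h (l - k))"
    unfolding ft_def using assms by (subst torus_int_sum) auto
  finally show ?thesis by (simp add: toep_def mult_ac)
qed

text \<open>Bessel over the rows, Parseval over the columns.\<close>

lemma toep_norm:
  assumes h: "tcont h" "\<And>x. cmod (h x) \<le> H" and J: "finite J" and K: "finite K"
  shows "(\<Sum>k\<in>J. (cmod (toep h K g k))\<^sup>2) \<le> H\<^sup>2 * (\<Sum>l\<in>K. (cmod (g l))\<^sup>2)"
proof -
  define G where "G x = (\<Sum>l\<in>K. g l * cnj (ch l x))" for x
  have G: "tcont G" unfolding G_def by auto
  have "(\<Sum>k\<in>J. (cmod (toep h K g k))\<^sup>2) \<le> integral (cbox 0 1) (\<lambda>x. (cmod (h x * G x))\<^sup>2)"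
    unfolding toep_eq[OF h(1) K] G_def[symmetric] using J h G by (intro bessel) auto
  also have "\<dots> \<le> integral (cbox 0 1) (\<lambda>x. H\<^sup>2 * (cmod (G x))\<^sup>2)"
    using h G by (intro integral_le cmod_integrable integrable_on_mult_right)
      (auto simp: norm_mult power_mult_distrib intro!: mult_right_mono power_mono)
  also have "\<dots> = H\<^sup>2 * (\<Sum>l\<in>K. (cmod (g l))\<^sup>2)"
    unfolding G_def using integral_norm_trig_cnj[OF K, of g] by simp
  finally show ?thesis .
qed

lemma toep_L2:
  assumes h: "tcont h" "\<And>x. cmod (h x) \<le> H" and J: "finite J" and K: "finite K"
  shows "L2_set (\<lambda>k. cmod (toep h K g k)) J \<le> H * L2_set (\<lambda>l. cmod (g l)) K"
proof -
  have H: "H \<ge> 0" using h(2)[of undefined] norm_ge_zero order_trans by blast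
  have "L2_set (\<lambda>k. cmod (toep h K g k)) J \<le> sqrt (H\<^sup>2 * (\<Sum>l\<in>K. (cmod (g l))\<^sup>2))"
    unfolding L2_set_def by (rule real_sqrt_le_mono[OF toep_norm[OF assms]])
  also have "\<dots> = H * L2_set (\<lambda>l. cmod (g l)) K"
    using H by (simp add: L2_set_def real_sqrt_mult)
  finally show ?thesis .
qed

lemma toep_lower:
  assumes h: "tcont h" "\<And>x. c \<le> Re (h x)" and K: "finite K"
  shows "c * (\<Sum>l\<in>K. (cmod (g l))\<^sup>2) \<le> Re (\<Sum>k\<in>K. toep h K g k * cnj (g k))"
proof -
  define G where "G x = (\<Sum>l\<in>K. g l * cnj (ch l x))" for x
  have G: "tcont G" unfolding G_def by auto
  have "(\<Sum>k\<in>K. toep h K g k * cnj (g k)) = (\<Sum>k\<in>K. torus_int (\<lambda>x. cnj (g k) * (ch k x * (h x * G x))))"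
    unfolding toep_eq[OF h(1) K] G_def by (simp add: mult.commute)
  also have "\<dots> = torus_int (\<lambda>x. h x * G x * cnj (G x))"
  proof -
    have "(\<Sum>k\<in>K. cnj (g k) * (ch k x * (h x * G x))) = h x * G x * cnj (G x)" for x
      by (subst (2) G_def) (simp add: sum_distrib_left mult_ac)
    then show ?thesis
      using K h G by (subst torus_int_sum[symmetric]) auto
  qed
  finally have "Re (\<Sum>k\<in>K. toep h K g k * cnj (g k)) = integral (cbox 0 1) (\<lambda>x. Re (h x * G x * cnj (G x)))"
    using h G by (simp add: Re_tint tcont_mult tcont_cnj)
  also have "\<dots> \<ge> integral (cbox 0 1) (\<lambda>x. c * (cmod (G x))\<^sup>2)"
  proof (rule integral_le)
    show "(\<lambda>x. Re (h x * G x * cnj (G x))) integrable_on cbox 0 1"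
      by (intro integrable_continuous continuous_intros tcont_cont h G)
    show "(\<lambda>x. c * (cmod (G x))\<^sup>2) integrable_on cbox 0 1"
      by (intro integrable_on_mult_right cmod_integrable G)
    show "c * (cmod (G x))\<^sup>2 \<le> Re (h x * G x * cnj (G x))" for x
    proof -
      have "h x * G x * cnj (G x) = h x * of_real ((cmod (G x))\<^sup>2)"
        by (simp only: complex_norm_square mult.assoc)
      then have "Re (h x * G x * cnj (G x)) = Re (h x) * (cmod (G x))\<^sup>2"
        by (metis Re_complex_of_real Im_complex_of_real times_complex.sel(1) mult_zero_right diff_zero)
      then show ?thesis using h(2)[of x] by (simp add: mult_right_mono del: times_complex.sel)
    qed
  qed
  also have "integral (cbox 0 1) (\<lambda>x. c * (cmod (G x))\<^sup>2) = c * (\<Sum>l\<in>K. (cmod (g l))\<^sup>2)"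
    unfolding G_def using integral_norm_trig_cnj[OF K, of g] by simp
  finally show ?thesis by simp
qed

section \<open>Operators with variable symbol on a cube\<close>

text \<open>Displacements in the coordinates of \<open>js\<close> alone: an induction on
  \<open>js\<close> then reaches a point of a cube from its corner one coordinate at a time.\<close>

definition offset :: "'n list \<Rightarrow> ('n \<Rightarrow> nat) \<Rightarrow> int ^ 'n"
  where "offset js o' = (\<chi> j. if j \<in> set js then int (o' j) else 0)"

lemma offset_snoc: "j \<notin> set js \<Longrightarrow> offset (js @ [j]) o' = offset js o' + of_nat (o' j) * axis j 1"
  by (auto simp: offset_def vec_eq_iff axis_def of_nat_index)

lemma telescope_axis:
  fixes F :: "int ^ 'n \<Rightarrow> complex"
  shows "F (c + of_nat a * axis j 1) = F c + (\<Sum>i<a. diff_op j F (c + of_nat i * axis j 1))"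
  by (induction a) (simp_all add: diff_op_def algebra_simps)

text \<open>
  Telescoping one coordinate at a time dominates the operator with variable symbol by operators with
  frozen symbols. The number of differences of order \<open>\<alpha>\<close> in a cube of side \<open>B\<close> is at most
  \<open>B ^ mlen \<alpha>\<close>, which the hypothesis compensates; bounding the matrix entries one by one would lose
  a power of \<open>B\<close>.
\<close>

lemma maximal_aux:
  fixes h :: "int ^ 'n \<Rightarrow> real ^ 'n \<Rightarrow> complex" and B :: nat
  assumes "distinct js" "finite J" "finite K" "B > 0" "0 \<le> H" "\<And>k. tcont (h k)"
    and "\<And>p. (\<And>j. j \<in> set js \<Longrightarrow> p j < B) \<Longrightarrow> c + offset js p \<in> C"
    and "\<And>\<alpha> c' x. (\<And>j. \<alpha> $ j \<le> 1) \<Longrightarrow> c' \<in> C \<Longrightarrow> (\<And>j. j \<notin> set js \<Longrightarrow> \<alpha> $ j = 0)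
        \<Longrightarrow> (\<alpha> = 0 \<Longrightarrow> c' = c)
        \<Longrightarrow> cmod (foldr (\<lambda>j. diff_op j ^^ (\<alpha> $ j)) js (\<lambda>l. h l x) c') \<le> H / B ^ (\<Sum>j\<in>set js. \<alpha> $ j)"
    and "\<And>k j. j \<in> set js \<Longrightarrow> p k j < B"
  shows "L2_set (\<lambda>k. cmod (toep (h (c + offset js (p k))) K g k)) J
    \<le> 2 ^ length js * H * L2_set (\<lambda>l. cmod (g l)) K"
  using assms
proof (induction js arbitrary: h c H rule: rev_induct)
  case Nil
  have "offset [] p = 0" for p :: "'n \<Rightarrow> nat" by (simp add: offset_def vec_eq_iff)
  moreover have "cmod (h c x) \<le> H" for x
    using Nil(7)[of undefined] Nil(8)[of 0 c x] calculation by simp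
  ultimately show ?case
    using toep_L2[OF Nil(6) _ Nil(2,3), of c H g] by simp
next
  case (snoc j js)
  have j: "j \<notin> set js" and dis: "distinct js" using snoc.prems(1) by auto
  define e where "e = (axis j 1 :: int ^ 'n)"
  define D where "D l x = h (l + e) x - h l x" for l x
  let ?g = "L2_set (\<lambda>l. cmod (g l)) K"
  have perD: "tcont (D l)" for l
    unfolding D_def using snoc.prems(6) by auto
  have off0: "offset js q = offset (js @ [j]) (q(j := 0))" for q
    using j by (auto simp: offset_def vec_eq_iff)
  have offi: "c + of_nat i * e + offset js q = c + offset (js @ [j]) (q(j := i))" for q i
    using j by (auto simp: offset_def vec_eq_iff e_def axis_def of_nat_index)
  have fold_cong: "foldr (\<lambda>j. diff_op j ^^ (\<alpha> $ j)) js F = foldr (\<lambda>j. diff_op j ^^ (\<beta> $ j)) js F"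
    if "\<And>i. i \<in> set js \<Longrightarrow> \<alpha> $ i = \<beta> $ i" for \<alpha> \<beta> :: "nat ^ 'n" and F
    by (rule foldr_cong) (use that in auto)
  have A: "L2_set (\<lambda>k. cmod (toep (h (c + offset js (p k))) K g k)) J \<le> 2 ^ length js * H * ?g"
  proof (rule snoc.IH[OF dis snoc.prems(2-6)])
    show "c + offset js q \<in> C" if "\<And>j. j \<in> set js \<Longrightarrow> q j < B" for q
      unfolding off0 by (rule snoc.prems(7)) (use that snoc.prems(4) in auto)
    show "p k j < B" if "j \<in> set js" for k j
      using that snoc.prems(9) by auto
  next
    fix \<alpha> :: "nat ^ 'n" and c' x
    assume a: "\<And>j. \<alpha> $ j \<le> 1" "c' \<in> C" "\<And>j. j \<notin> set js \<Longrightarrow> \<alpha> $ j = 0" "\<alpha> = 0 \<Longrightarrow> c' = c"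
    show "cmod (foldr (\<lambda>j. diff_op j ^^ (\<alpha> $ j)) js (\<lambda>l. h l x) c') \<le> H / B ^ (\<Sum>j\<in>set js. \<alpha> $ j)"
      using snoc.prems(8)[of \<alpha> c' x] a j by (auto simp: id_def)
  qed
  \<comment> \<open>A slice at height i along j: the extra difference lowers the bound from
    \<open>H\<close> to \<open>H / B\<close>, and the B slices together restore
    \<open>H\<close>.\<close>
  have Bi: "L2_set (\<lambda>k. cmod (toep (D (c + of_nat i * e + offset js (p k))) K g k)) J
      \<le> 2 ^ length js * (H / B) * ?g" if i: "i < B" for i
  proof (rule snoc.IH[OF dis snoc.prems(2-4) _ perD])
    show "0 \<le> H / B" using snoc.prems(5) by simp
    show "c + of_nat i * e + offset js q \<in> C" if "\<And>j. j \<in> set js \<Longrightarrow> q j < B" for q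
      unfolding offi by (rule snoc.prems(7)) (use that i in auto)
    show "p k j < B" if "j \<in> set js" for k j
      using that snoc.prems(9) by auto
  next
    fix \<alpha> :: "nat ^ 'n" and c' x
    assume a: "\<And>j. \<alpha> $ j \<le> 1" "c' \<in> C" "\<And>j. j \<notin> set js \<Longrightarrow> \<alpha> $ j = 0"
    define \<beta> where "\<beta> = (\<chi> i. if i = j then 1 else \<alpha> $ i)"
    have b: "\<beta> $ j = 1" "\<And>i. i \<in> set js \<Longrightarrow> \<beta> $ i = \<alpha> $ i"
      using j by (auto simp: \<beta>_def)
    have "cmod (foldr (\<lambda>j. diff_op j ^^ (\<beta> $ j)) (js @ [j]) (\<lambda>l. h l x) c')
        \<le> H / B ^ (\<Sum>j\<in>set (js @ [j]). \<beta> $ j)"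
      by (rule snoc.prems(8)) (use a b(1) in \<open>auto simp: \<beta>_def\<close>)
    moreover have "foldr (\<lambda>j. diff_op j ^^ (\<beta> $ j)) (js @ [j]) (\<lambda>l. h l x)
        = foldr (\<lambda>j. diff_op j ^^ (\<alpha> $ j)) js (\<lambda>l. D l x)"
      using fold_cong[of \<beta> \<alpha>] b by (simp add: D_def e_def diff_op_def[abs_def])
    moreover have "(\<Sum>j\<in>set (js @ [j]). \<beta> $ j) = Suc (\<Sum>j\<in>set js. \<alpha> $ j)"
      using j b by (simp cong: sum.cong)
    ultimately show "cmod (foldr (\<lambda>j. diff_op j ^^ (\<alpha> $ j)) js (\<lambda>l. D l x) c')
        \<le> H / B / B ^ (\<Sum>j\<in>set js. \<alpha> $ j)" by simp
  qed
  have split: "toep (h (c + offset (js @ [j]) (p k))) K g k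
      = toep (h (c + offset js (p k))) K g k
        + (\<Sum>i<p k j. toep (D (c + of_nat i * e + offset js (p k))) K g k)" for k
  proof -
    have "h (c + offset (js @ [j]) (p k)) x
        = h (c + offset js (p k)) x + (\<Sum>i<p k j. D (c + of_nat i * e + offset js (p k)) x)" for x
      using telescope_axis[of "\<lambda>l. h l x" "c + offset js (p k)" "p k j" j]
      by (simp add: offset_snoc[OF j] D_def e_def diff_op_def add_ac)
    then have "h (c + offset (js @ [j]) (p k))
        = (\<lambda>x. h (c + offset js (p k)) x + (\<Sum>i<p k j. D (c + of_nat i * e + offset js (p k)) x))"
      by auto
    then have "ft (h (c + offset (js @ [j]) (p k))) \<xi> = ft (h (c + offset js (p k))) \<xi>
        + (\<Sum>i<p k j. ft (D (c + of_nat i * e + offset js (p k))) \<xi>)" for \<xi>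
      using snoc.prems(6) perD by (simp add: ft_add ft_sum tcont_sum)
    then show ?thesis
      unfolding toep_def by (simp add: ring_distribs sum.distrib sum_distrib_right sum.swap[of _ "{..<p k j}"])
  qed
  let ?T = "\<lambda>i k. cmod (toep (D (c + of_nat i * e + offset js (p k))) K g k)"
  have "L2_set (\<lambda>k. cmod (toep (h (c + offset (js @ [j]) (p k))) K g k)) J
      \<le> L2_set (\<lambda>k. cmod (toep (h (c + offset js (p k))) K g k) + (\<Sum>i<B. ?T i k)) J"
  proof (rule L2_set_mono)
    fix k
    have "cmod (\<Sum>i<p k j. toep (D (c + of_nat i * e + offset js (p k))) K g k) \<le> (\<Sum>i<p k j. ?T i k)"
      by (rule norm_sum)
    \<comment> \<open>Row k uses \<open>p k j\<close> slices; allowing all B of them makes the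
      number independent of the row, so that the triangle inequality for \<open>L2_set\<close>
      applies slice by slice.\<close>
    also have "\<dots> \<le> (\<Sum>i<B. ?T i k)"
      using snoc.prems(9)[of j k] by (intro sum_mono2) auto
    finally show "cmod (toep (h (c + offset (js @ [j]) (p k))) K g k)
        \<le> cmod (toep (h (c + offset js (p k))) K g k) + (\<Sum>i<B. ?T i k)"
      unfolding split by (rule norm_triangle_le[OF add_left_mono])
  qed simp
  also have "\<dots> \<le> L2_set (\<lambda>k. cmod (toep (h (c + offset js (p k))) K g k)) J
      + L2_set (\<lambda>k. \<Sum>i<B. ?T i k) J"
    by (rule L2_set_triangle_ineq)
  also have "L2_set (\<lambda>k. \<Sum>i<b. ?T i k) J \<le> (\<Sum>i<b. L2_set (?T i) J)" for b
  proof (induction b)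
    case (Suc b)
    have "L2_set (\<lambda>k. (\<Sum>i<b. ?T i k) + ?T b k) J \<le> L2_set (\<lambda>k. \<Sum>i<b. ?T i k) J + L2_set (?T b) J"
      by (rule L2_set_triangle_ineq)
    then show ?case using Suc by simp
  qed (simp add: L2_set_def)
  also have "(\<Sum>i<B. L2_set (?T i) J) \<le> (\<Sum>i<B. 2 ^ length js * (H / B) * ?g)"
    by (intro sum_mono) (use Bi in auto)
  also have "\<dots> = 2 ^ length js * H * ?g"
    using snoc.prems(4) by simp
  \<comment> \<open>The term without a difference in j and the slices obey the same bound, hence one
    factor 2 per coordinate.\<close>
  finally show ?case using A by simp
qed

definition qcube :: "int ^ 'n \<Rightarrow> nat \<Rightarrow> (int ^ 'n) set"
  where "qcube c B = {k. \<forall>j. 0 \<le> k $ j - c $ j \<and> k $ j - c $ j < int B}"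

text \<open>At order zero the bound is demanded only at the corner c. A symbol minus its value at c
  satisfies this trivially, so \<open>H\<close> can then be as small as the differences of positive
  order allow.\<close>

lemma maximal:
  fixes h :: "int ^ 'n \<Rightarrow> real ^ 'n \<Rightarrow> complex"
  assumes "J \<subseteq> qcube c B" "finite J" "finite K" "B > 0" "0 \<le> H" and tcont: "\<And>k. tcont (h k)"
    and bd: "\<And>\<alpha> c' x. (\<And>j. \<alpha> $ j \<le> 1) \<Longrightarrow> c' \<in> qcube c B \<Longrightarrow> (\<alpha> = 0 \<Longrightarrow> c' = c)
        \<Longrightarrow> cmod (mdiff_op \<alpha> (\<lambda>l. h l x) c') \<le> H / B ^ mlen \<alpha>"
  shows "L2_set (\<lambda>k. cmod (toep (h k) K g k)) J
    \<le> 2 ^ CARD('n) * H * L2_set (\<lambda>l. cmod (g l)) K"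
proof -
  \<comment> \<open>The value 0 outside the cube keeps \<open>p k j < B\<close> for every k, as
    \<open>maximal_aux\<close> demands.\<close>
  define p where "p k j = (if k \<in> qcube c B then nat (k $ j - c $ j) else 0)" for k :: "int ^ 'n" and j
  have len: "length (coords :: 'n list) = CARD('n)"
    using coords distinct_card by metis
  have C: "c + offset coords q \<in> qcube c B" if "\<And>j. j \<in> set (coords :: 'n list) \<Longrightarrow> q j < B" for q
    using that coords by (auto simp: qcube_def offset_def)
  have "L2_set (\<lambda>k. cmod (toep (h (c + offset coords (p k))) K g k)) J
      \<le> 2 ^ length (coords :: 'n list) * H * L2_set (\<lambda>l. cmod (g l)) K"
  proof (rule maximal_aux[OF coords(2) assms(2-6) C])
    show "p k j < B" for k j
      using assms(4) by (auto simp: p_def qcube_def nat_less_iff)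
    show "cmod (foldr (\<lambda>j. diff_op j ^^ (\<alpha> $ j)) coords (\<lambda>l. h l x) c') \<le> H / B ^ (\<Sum>j\<in>set coords. \<alpha> $ j)"
      if "\<And>j. \<alpha> $ j \<le> 1" "c' \<in> qcube c B" "\<alpha> = 0 \<Longrightarrow> c' = c" for \<alpha> :: "nat ^ 'n" and c' x
      using bd[of \<alpha> c' x] that by (simp add: mdiff_op_def mlen_def coords)
  qed
  moreover have "L2_set (\<lambda>k. cmod (toep (h (c + offset coords (p k))) K g k)) J
      = L2_set (\<lambda>k. cmod (toep (h k) K g k)) J"
  proof (rule L2_set_cong[OF refl])
    fix k assume "k \<in> J"
    then have "c + offset coords (p k) = k"
      using assms(1) by (auto simp: p_def offset_def coords qcube_def vec_eq_iff)
    then show "cmod (toep (h (c + offset coords (p k))) K g k) = cmod (toep (h k) K g k)" by simp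
  qed
  ultimately show ?thesis by (simp add: len)
qed

section \<open>Smooth functions on the torus\<close>

text \<open>Transports a relation such as \<open>G = T F\<close>, with \<open>T\<close> linear in the torus variable, to differences.\<close>

lemma mdiff_rel:
  fixes F G :: "int ^ 'n \<Rightarrow> _ \<Rightarrow> complex"
  assumes R: "R F G"
    and step: "\<And>F G j. R F G \<Longrightarrow> R (\<lambda>k x. diff_op j (\<lambda>l. F l x) k) (\<lambda>k x. diff_op j (\<lambda>l. G l x) k)"
  shows "R (\<lambda>k x. mdiff_op \<alpha> (\<lambda>l. F l x) k) (\<lambda>k x. mdiff_op \<alpha> (\<lambda>l. G l x) k)"
proof -
  have P: "R (\<lambda>k x. (diff_op j ^^ a) (\<lambda>l. F l x) k) (\<lambda>k x. (diff_op j ^^ a) (\<lambda>l. G l x) k)"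
    if "R F G" for F G and j :: 'n and a
  proof (induction a)
    case 0
    then show ?case using that by simp
  next
    case (Suc a)
    from step[OF this, where j = j] show ?case by simp
  qed
  have "R (\<lambda>k x. foldr (\<lambda>j. diff_op j ^^ (\<alpha> $ j)) js (\<lambda>l. F l x) k)
      (\<lambda>k x. foldr (\<lambda>j. diff_op j ^^ (\<alpha> $ j)) js (\<lambda>l. G l x) k)" for js
  proof (induction js)
    case Nil
    then show ?case using R by simp
  next
    case (Cons j js)
    from P[OF this, where j = j and a = "\<alpha> $ j"] show ?case by simp
  qed
  then show ?thesis by (simp add: mdiff_op_def)
qed

lemma mdiff_op_0 [simp]: "mdiff_op 0 F = F"
proof -
  have "foldr (\<lambda>j. diff_op j ^^ ((0 :: nat ^ 'n) $ j)) js F = F" for js and F :: "int ^ 'n \<Rightarrow> complex"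
    by (induction js) auto
  then show ?thesis by (simp add: mdiff_op_def fun_eq_iff)
qed

text \<open>Lets \<open>window_lower\<close> subtract the symbol frozen at the corner: differences
  of positive order are blind to it.\<close>

lemma mdiff_op_diff_const:
  fixes F :: "int ^ 'n \<Rightarrow> complex"
  assumes "\<alpha> \<noteq> 0"
  shows "mdiff_op \<alpha> (\<lambda>l. F l - d) = mdiff_op \<alpha> F"
proof -
  have 1: "diff_op j (\<lambda>l. G l - d) = diff_op j G" for j :: 'n and G
    by (auto simp: diff_op_def)
  have 2: "(diff_op j ^^ a) (\<lambda>l. G l - d) = (diff_op j ^^ a) G" if "a > 0" for j :: 'n and a G
    using that by (cases a) (simp_all add: funpow_Suc_right 1 del: funpow.simps)
  have "foldr (\<lambda>j. diff_op j ^^ (\<alpha> $ j)) js (\<lambda>l. F l - d) =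
    (if \<forall>j\<in>set js. \<alpha> $ j = 0 then (\<lambda>l. F l - d) else foldr (\<lambda>j. diff_op j ^^ (\<alpha> $ j)) js F)
    \<and> ((\<forall>j\<in>set js. \<alpha> $ j = 0) \<longrightarrow> foldr (\<lambda>j. diff_op j ^^ (\<alpha> $ j)) js F = F)" for js
    by (induction js) (auto simp: 2)
  from this[of coords] show ?thesis using assms by (auto simp: mdiff_op_def vec_eq_iff coords)
qed

section \<open>Closure properties and Fourier coefficients of smooth functions\<close>

lemma smooth_torus_differentiable:
  assumes "smooth_torus g" shows "foldr pderiv_op js g differentiable_on UNIV"
  using assms by (simp add: smooth_torus_def)

lemma smooth_torus_per: "smooth_torus g \<Longrightarrow> tcont g"
  using smooth_torus_differentiable[of g "[]"] differentiable_imp_continuous_on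
  by (auto simp: smooth_torus_def tcont_def)

lemma smooth_torus_pderiv_op: "smooth_torus g \<Longrightarrow> smooth_torus (pderiv_op j g)"
  unfolding smooth_torus_def
proof (intro conjI allI)
  assume g: "(\<forall>x j. g (x + axis j 1) = g x) \<and> (\<forall>js. foldr pderiv_op js g differentiable_on UNIV)"
  fix x i js
  have "g (x + axis i 1 + t *\<^sub>R axis j 1) = g (x + t *\<^sub>R axis j 1)" for t
    using g[THEN conjunct1, rule_format, of "x + t *\<^sub>R axis j 1" i] by (simp add: add_ac)
  then show "pderiv_op j g (x + axis i 1) = pderiv_op j g x"
    by (simp add: pderiv_op_def)
  show "foldr pderiv_op js (pderiv_op j g) differentiable_on UNIV"
    using g[THEN conjunct2, rule_format, of "js @ [j]"] by simp
qed

lemma pderiv_op_vector_derivative: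
  assumes "F differentiable_on UNIV"
  shows "((\<lambda>t. F (x + t *\<^sub>R axis j 1)) has_vector_derivative pderiv_op j F x) (at 0)"
proof -
  have "(\<lambda>t. F (x + t *\<^sub>R axis j 1)) differentiable (at (0 :: real))"
    using assms
    by (intro differentiable_compose[of F "\<lambda>t. x + t *\<^sub>R axis j 1"])
      (auto simp: differentiable_on_def intro!: derivative_intros)
  then show ?thesis
    unfolding pderiv_op_def using vector_derivative_works by blast
qed

lemma smooth_torus_lincomb:
  assumes f: "smooth_torus f" and g: "smooth_torus g"
  shows "smooth_torus (\<lambda>x. a * f x + b * g x)"
proof -
  have *: "foldr pderiv_op js (\<lambda>x. a * f x + b * g x)
      = (\<lambda>x. a * foldr pderiv_op js f x + b * foldr pderiv_op js g x)" for js
  proof (induction js)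
    case (Cons j js)
    show ?case
      unfolding foldr_Cons o_def Cons
    proof
      fix x
      show "pderiv_op j (\<lambda>x. a * foldr pderiv_op js f x + b * foldr pderiv_op js g x) x
          = a * pderiv_op j (foldr pderiv_op js f) x + b * pderiv_op j (foldr pderiv_op js g) x"
        unfolding pderiv_op_def[of j "\<lambda>x. a * foldr pderiv_op js f x + b * foldr pderiv_op js g x"]
        by (intro vector_derivative_at has_vector_derivative_add has_vector_derivative_mult_right
            pderiv_op_vector_derivative smooth_torus_differentiable f g)
    qed
  qed simp
  have "(\<lambda>x. a * foldr pderiv_op js f x + b * foldr pderiv_op js g x) differentiable_on UNIV" for js
    by (intro derivative_intros smooth_torus_differentiable f g)
  then show ?thesis
    using f g by (simp add: smooth_torus_def *)
qed

lemma smooth_torus_diff: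
  assumes "smooth_torus f" "smooth_torus g" shows "smooth_torus (\<lambda>x. f x - g x)"
  using smooth_torus_lincomb[OF assms, of 1 "-1"] by simp

lemma smooth_torus_mdiff:
  assumes "\<And>k. smooth_torus (\<sigma> k)"
  shows "smooth_torus (\<lambda>x. mdiff_op \<alpha> (\<lambda>l. \<sigma> l x) k)"
proof -
  have "\<forall>k. smooth_torus (\<lambda>x. mdiff_op \<alpha> (\<lambda>l. \<sigma> l x) k)"
    using mdiff_rel[of "\<lambda>F G. \<forall>k. smooth_torus (F k)" \<sigma> \<sigma> \<alpha>] assms
    by (auto simp: diff_op_def intro: smooth_torus_diff)
  then show ?thesis ..
qed

text \<open>The derivative of the product of \<open>ch (- \<xi>)\<close> and g has integral zero by
  \<open>torus_int_pderiv_0\<close>.\<close>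

lemma ft_pderiv_op:
  assumes g: "smooth_torus g"
  shows "ft (pderiv_op j g) \<xi> = 2 * of_real pi * \<i> * of_int (\<xi> $ j) * ft g \<xi>"
proof -
  let ?c = "2 * of_real pi * \<i> * of_int (\<xi> $ j)"
  have pg: "tcont g" and pd: "tcont (pderiv_op j g)"
    using g smooth_torus_per smooth_torus_pderiv_op by blast+
  have "torus_int (\<lambda>x. ch (- \<xi>) x * pderiv_op j g x + (- ?c * ch (- \<xi>) x) * g x) = 0"
  proof (rule torus_int_pderiv_0[where u = "\<lambda>x. ch (- \<xi>) x * g x"])
    fix x
    have e: "(\<lambda>t. ch (- \<xi>) (x + t *\<^sub>R axis j 1)) = (\<lambda>t. ch (- \<xi>) x * exp (t *\<^sub>R (- ?c)))"
      by (auto simp: ch_add_right) (auto simp: ch_def inner_axis mult_ac scaleR_conv_of_real[where 'a = complex])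
    have "((\<lambda>t. ch (- \<xi>) (x + t *\<^sub>R axis j 1)) has_vector_derivative - ?c * ch (- \<xi>) x) (at 0)"
      unfolding e
      using has_vector_derivative_mult_right[OF exp_scaleR_has_vector_derivative_right[of "- ?c" 0 UNIV], of "ch (- \<xi>) x"]
      by (simp add: mult_ac)
    then have "((\<lambda>t. ch (- \<xi>) (x + t *\<^sub>R axis j 1) * g (x + t *\<^sub>R axis j 1)) has_vector_derivative
        ch (- \<xi>) (x + 0 *\<^sub>R axis j 1) * pderiv_op j g x + (- ?c * ch (- \<xi>) x) * g (x + 0 *\<^sub>R axis j 1)) (at 0)"
      by (rule has_vector_derivative_mult)
        (use pderiv_op_vector_derivative smooth_torus_differentiable[OF g, of "[]"] in auto)
    then show "((\<lambda>t. ch (- \<xi>) (x + t *\<^sub>R axis j 1) * g (x + t *\<^sub>R axis j 1)) has_vector_derivative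
        ch (- \<xi>) x * pderiv_op j g x + (- ?c * ch (- \<xi>) x) * g x) (at 0)"
      by simp
  qed (use pg pd in auto)
  also have "(\<lambda>x. ch (- \<xi>) x * pderiv_op j g x + (- ?c * ch (- \<xi>) x) * g x)
      = (\<lambda>x. ch (- \<xi>) x * pderiv_op j g x - ?c * (ch (- \<xi>) x * g x))"
    by (simp add: algebra_simps)
  also have "torus_int \<dots> = ft (pderiv_op j g) \<xi> - ?c * ft g \<xi>"
    unfolding ft_def using pg pd by (subst torus_int_diff) auto
  finally show ?thesis by simp
qed

text \<open>\<open>D_op\<close> is a falling factorial in the normalised derivative, and on
  coefficients that derivative is multiplication by \<open>\<xi> $ j\<close>.\<close>

lemma D_op_smooth_ft:
  assumes g: "smooth_torus g"
  shows "smooth_torus (D_op j l g)"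
    and "ft (D_op j l g) \<xi> = (\<Prod>r<l. of_int (\<xi> $ j) - of_nat r) * ft g \<xi>"
proof -
  have "smooth_torus (D_op j l g) \<and> ft (D_op j l g) \<xi> = (\<Prod>r<l. of_int (\<xi> $ j) - of_nat r) * ft g \<xi>"
  proof (induction l)
    case 0
    then show ?case using g by simp
  next
    case (Suc l)
    define G where "G = D_op j l g"
    have G: "smooth_torus G" and fG: "ft G \<xi> = (\<Prod>r<l. of_int (\<xi> $ j) - of_nat r) * ft g \<xi>"
      using Suc by (simp_all add: G_def)
    have e: "D_op j (Suc l) g = (\<lambda>x. 1 / (2 * of_real pi * \<i>) * pderiv_op j G x + (- of_nat l) * G x)"
      by (simp add: G_def)
    have "ft (D_op j (Suc l) g) \<xi> = 1 / (2 * of_real pi * \<i>) * ft (pderiv_op j G) \<xi> + (- of_nat l) * ft G \<xi>"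
      unfolding e using smooth_torus_per[OF G] smooth_torus_per[OF smooth_torus_pderiv_op[OF G]]
      by (subst ft_add) (simp_all only: ft_cmul tcont_mult tcont_const)
    also have "\<dots> = (of_int (\<xi> $ j) - of_nat l) * ft G \<xi>"
      by (simp add: ft_pderiv_op[OF G] field_simps)
    finally have "ft (D_op j (Suc l) g) \<xi> = (\<Prod>r<Suc l. of_int (\<xi> $ j) - of_nat r) * ft g \<xi>"
      by (simp only: fG prod.lessThan_Suc mult_ac)
    then show ?case
      using smooth_torus_lincomb[OF smooth_torus_pderiv_op[OF G] G] unfolding e by blast
  qed
  then show "smooth_torus (D_op j l g)"
    and "ft (D_op j l g) \<xi> = (\<Prod>r<l. of_int (\<xi> $ j) - of_nat r) * ft g \<xi>" by auto
qed

definition single_index :: "'n \<Rightarrow> nat \<Rightarrow> nat ^ 'n"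
  where "single_index j l = (\<chi> i. if i = j then l else 0)"

lemma mlen_sidx [simp]: "mlen (single_index j l) = l"
  by (simp add: mlen_def single_index_def)

lemma mlen_0 [simp]: "mlen 0 = 0"
  by (simp add: mlen_def)

lemma mD_op_sidx: "mD_op (single_index j l) = D_op j l"
proof -
  have D0: "D_op i 0 = id" for i by (auto simp: fun_eq_iff)
  have "foldr (\<lambda>i. D_op i (single_index j l $ i)) js = (if j \<in> set js then D_op j l else id)" if "distinct js" for js
    using that by (induction js) (auto simp: single_index_def D0 simp del: D_op.simps)
  from this[OF coords(2)] show ?thesis by (simp add: mD_op_def coords)
qed

text \<open>The hypothesis on \<open>\<xi> $ j\<close> keeps this coordinate away from the zeros 0,
  ..., N - 1 of the falling factorial: each factor is at least half of its modulus.\<close>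

lemma ft_decay:
  assumes g: "smooth_torus g" and D: "\<And>x. cmod (D_op j N g x) \<le> D" and \<xi>: "2 * int N \<le> \<bar>\<xi> $ j\<bar>"
  shows "cmod (ft g \<xi>) * (real_of_int \<bar>\<xi> $ j\<bar> / 2) ^ N \<le> D"
proof -
  have "(real_of_int \<bar>\<xi> $ j\<bar> / 2) ^ N = (\<Prod>r<N. real_of_int \<bar>\<xi> $ j\<bar> / 2)" by simp
  also have "\<dots> \<le> (\<Prod>r<N. cmod (of_int (\<xi> $ j) - of_nat r))"
  proof (intro prod_mono conjI)
    fix r assume "r \<in> {..<N}"
    then have r: "2 * int r \<le> \<bar>\<xi> $ j\<bar>" using \<xi> by simp
    have "cmod (of_int (\<xi> $ j) - of_nat r) = \<bar>real_of_int (\<xi> $ j) - real r\<bar>"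
      by (metis norm_of_real of_real_diff of_real_of_int_eq of_real_of_nat_eq)
    then show "real_of_int \<bar>\<xi> $ j\<bar> / 2 \<le> cmod (of_int (\<xi> $ j) - of_nat r)"
      using r by linarith
  qed simp
  also have "\<dots> = cmod (\<Prod>r<N. of_int (\<xi> $ j) - of_nat r)" by (simp add: prod_norm)
  finally have "cmod (ft g \<xi>) * (real_of_int \<bar>\<xi> $ j\<bar> / 2) ^ N
      \<le> cmod (\<Prod>r<N. of_int (\<xi> $ j) - of_nat r) * cmod (ft g \<xi>)"
    by (subst mult.commute) (rule mult_right_mono, auto)
  also have "\<dots> = cmod (ft (D_op j N g) \<xi>)"
    by (simp add: D_op_smooth_ft[OF g] norm_mult)
  also have "\<dots> \<le> D"
    using D smooth_torus_per[OF D_op_smooth_ft(1)[OF g]] by (rule cmod_ft_le[rotated])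
  finally show ?thesis .
qed

lemma tcont_lvec: "tcont g \<Longrightarrow> g (x + lvec z) = g x"
proof -
  assume g: "tcont g"
  have n: "g (x + real n *\<^sub>R axis j 1) = g x" for x j n
  proof (induction n)
    case (Suc n)
    have "g (x + real n *\<^sub>R axis j 1 + axis j 1) = g (x + real n *\<^sub>R axis j 1)"
      using g by (simp add: tcont_def)
    then show ?case using Suc by (simp add: algebra_simps)
  qed simp
  have i: "g (x + real_of_int m *\<^sub>R axis j 1) = g x" for x j m
  proof (cases "m \<ge> 0")
    case True
    then show ?thesis using n[of x "nat m" j] by simp
  next
    case False
    then show ?thesis using n[of "x + real_of_int m *\<^sub>R axis j 1" "nat (- m)" j] by simp
  qed
  have "g (x + (\<Sum>j\<in>S. real_of_int (z $ j) *\<^sub>R axis j 1)) = g x" if "finite S" for S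
    using that
  proof (induction S)
    case (insert j S)
    then show ?case
      using i[of "x + (\<Sum>j\<in>S. real_of_int (z $ j) *\<^sub>R axis j 1)" "z $ j" j] by (simp add: add_ac)
  qed simp
  moreover have "lvec z = (\<Sum>j\<in>UNIV. real_of_int (z $ j) *\<^sub>R axis j 1)"
    using basis_expansion[of "lvec z"] by (simp add: scalar_mult_eq_scaleR)
  ultimately show "g (x + lvec z) = g x" by simp
qed

section \<open>Lipschitz estimates and the chordal distance\<close>

lemma lipschitz_pderiv:
  assumes g: "g differentiable_on UNIV" and D: "\<And>j x. cmod (pderiv_op j g x) \<le> D"
  shows "cmod (g x - g y) \<le> D * (\<Sum>j\<in>UNIV. \<bar>x $ j - y $ j\<bar>)"
proof -
  define v where "v = x - y"
  define g' where "g' z = frechet_derivative g (at z)" for z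
  have g': "(g has_derivative g' z) (at z)" for z
    using g by (simp add: g'_def differentiable_on_def frechet_derivative_works[symmetric])
  have ax: "g' z (axis j 1) = pderiv_op j g z" for z j
  proof -
    have "((\<lambda>t. g (z + t *\<^sub>R axis j 1)) has_derivative (\<lambda>t. g' z (t *\<^sub>R axis j 1))) (at (0 :: real))"
      by (rule has_derivative_compose[where g = g and f = "\<lambda>t. z + t *\<^sub>R axis j 1" and g' = "g' z"])
        (use g' in \<open>auto intro!: derivative_eq_intros\<close>)
    then have "((\<lambda>t. g (z + t *\<^sub>R axis j 1)) has_vector_derivative g' z (axis j 1)) (at (0 :: real))"
      unfolding has_vector_derivative_def
      using linear_cmul[OF has_derivative_linear[OF g']] by simp
    then show ?thesis unfolding pderiv_op_def by (simp add: vector_derivative_at)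
  qed
  have gv: "cmod (g' z v) \<le> D * (\<Sum>j\<in>UNIV. \<bar>v $ j\<bar>)" for z
  proof -
    have "v = (\<Sum>j\<in>UNIV. (v $ j) *\<^sub>R axis j 1)"
      using basis_expansion[of v] by (simp add: scalar_mult_eq_scaleR)
    then have "g' z v = (\<Sum>j\<in>UNIV. (v $ j) *\<^sub>R pderiv_op j g z)"
      using linear_sum[OF has_derivative_linear[OF g'[of z]], of "\<lambda>j. (v $ j) *\<^sub>R axis j 1" UNIV]
      by (simp add: linear_cmul[OF has_derivative_linear[OF g']] ax)
    also have "cmod \<dots> \<le> (\<Sum>j\<in>UNIV. \<bar>v $ j\<bar> * D)"
      by (rule order_trans[OF norm_sum]) (auto intro!: sum_mono mult_left_mono D)
    finally show ?thesis by (simp add: sum_distrib_left mult.commute)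
  qed
  \<comment> \<open>Mean value inequality on the segment from y to x = y + v.\<close>
  have "\<exists>t\<in>{0<..<1}. norm (g (y + 1 *\<^sub>R v) - g (y + 0 *\<^sub>R v)) \<le> norm (g' (y + t *\<^sub>R v) ((1 - 0) *\<^sub>R v))"
  proof (rule mvt_general[where f' = "\<lambda>t h. g' (y + t *\<^sub>R v) (h *\<^sub>R v)"])
    have d: "((\<lambda>t. g (y + t *\<^sub>R v)) has_derivative (\<lambda>h. g' (y + t *\<^sub>R v) (h *\<^sub>R v))) (at t)" for t
      by (rule has_derivative_compose[where g = g and f = "\<lambda>t. y + t *\<^sub>R v" and g' = "g' (y + t *\<^sub>R v)"])
        (use g' in \<open>auto intro!: derivative_eq_intros\<close>)
    then show "((\<lambda>t. g (y + t *\<^sub>R v)) has_derivative (\<lambda>h. g' (y + t *\<^sub>R v) (h *\<^sub>R v))) (at t)" for t .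
    show "continuous_on {0..1} (\<lambda>t. g (y + t *\<^sub>R v))"
      using d has_derivative_continuous continuous_at_imp_continuous_on by blast
  qed simp
  then show ?thesis using gv by (fastforce simp: v_def intro: order_trans)
qed

text \<open>The chord has length 2 sin (pi \<bar>r\<bar>), so sin x \<ge> x / 2 on [0, pi / 2]
  suffices. Below pi / 3 the derivative of sin is at least 1 / 2; above it, sin x is at least sqrt 3
  / 2, which exceeds pi / 4.\<close>

lemma cmod_1_minus_cis_ge:
  assumes "\<bar>r\<bar> \<le> 1/2"
  shows "\<bar>r\<bar> \<le> cmod (1 - cis (2 * pi * r))"
proof -
  define x where "x = pi * \<bar>r\<bar>"
  have x: "0 \<le> x" "x \<le> pi / 2"
    using assms mult_left_mono[of "\<bar>r\<bar>" "1/2" pi] by (auto simp: x_def)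
  have s: "x / 2 \<le> sin x"
  proof (cases "x \<le> pi / 3")
    case True
    show ?thesis
    proof (cases "x = 0")
      case False
      then have "0 < x" using x by simp
      from MVT2[OF this, of sin cos] obtain z where z: "0 < z" "z < x" "sin x - sin 0 = (x - 0) * cos z"
        by (auto intro: DERIV_sin)
      have "cos (pi / 3) \<le> cos z"
        using z True by (intro cos_monotone_0_pi_le) auto
      then have "x * (1 / 2) \<le> x * cos z"
        using x by (intro mult_left_mono) (auto simp: cos_60)
      then show ?thesis using z by simp
    qed simp
  next
    case False
    then have "sin (pi / 3) \<le> sin x"
      using x by (intro sin_monotone_2pi_le) auto
    moreover have "8/5 \<le> sqrt 3"
      by (rule real_le_rsqrt) (simp add: power2_eq_square)
    moreover have "pi \<le> 3.2" using pi_approx by simp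
    ultimately show ?thesis using x by (simp add: sin_60)
  qed
  have "(cmod (1 - cis (2 * pi * r)))\<^sup>2 = (1 - cos (2 * (pi * r)))\<^sup>2 + (sin (2 * (pi * r)))\<^sup>2"
    by (simp add: cmod_power2 mult.assoc)
  also have "\<dots> = 2 * (1 - cos (2 * (pi * r)))"
    using sin_cos_squared_add[of "2 * (pi * r)"] by (simp add: power2_diff)
  also have "\<dots> = (2 * sin (pi * r))\<^sup>2"
    by (simp add: cos_double_sin power2_eq_square)
  also have "\<dots> = (2 * sin x)\<^sup>2"
    by (cases "r \<ge> 0") (simp_all add: x_def)
  also have "\<dots> \<ge> x\<^sup>2"
    using s x by (intro power_mono) auto
  finally have "x \<le> cmod (1 - cis (2 * pi * r))"
    by (rule power2_le_imp_le) simp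
  moreover have "\<bar>r\<bar> \<le> x"
    using mult_right_mono[of 1 pi "\<bar>r\<bar>"] pi_gt3 by (simp add: x_def)
  ultimately show ?thesis by linarith
qed

text \<open>The chord replaces the distance on the torus because it is the modulus of a
  trigonometric polynomial: its square can be integrated exactly against the density in
  \<open>smoothing_error\<close>.\<close>

lemma smooth_torus_lipschitz:
  assumes g: "smooth_torus g" and D: "\<And>j x. cmod (pderiv_op j g x) \<le> D"
  shows "cmod (g x - g y) \<le> D * (\<Sum>j\<in>UNIV. cmod (1 - ch (axis j 1) (x - y)))"
proof -
  \<comment> \<open>The lattice point nearest to x - y; subtracting it leaves coordinates in
    [-1/2, 1/2], where the chord is comparable to the distance.\<close>
  define z where "z = (\<chi> j. round (x $ j - y $ j))"
  have D0: "D \<ge> 0" using D[of undefined undefined] norm_ge_zero order_trans by blast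
  have "cmod (g x - g y) = cmod (g x - g (y + lvec z))"
    using tcont_lvec[OF smooth_torus_per[OF g]] by simp
  also have "\<dots> \<le> D * (\<Sum>j\<in>UNIV. \<bar>x $ j - (y + lvec z) $ j\<bar>)"
    using smooth_torus_differentiable[OF g, of "[]"] D by (intro lipschitz_pderiv) auto
  also have "\<dots> \<le> D * (\<Sum>j\<in>UNIV. cmod (1 - ch (axis j 1) (x - y)))"
  proof (intro mult_left_mono sum_mono D0)
    fix j
    define r where "r = x $ j - y $ j - of_int (z $ j)"
    have "\<bar>r\<bar> \<le> 1/2"
      using of_int_round_abs_le[of "x $ j - y $ j"] by (simp add: r_def z_def abs_minus_commute)
    then have "\<bar>r\<bar> \<le> cmod (1 - cis (2 * pi * r))" by (rule cmod_1_minus_cis_ge)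
    also have "cis (2 * pi * r) = cis (2 * pi * r) * cis (2 * pi * of_int (z $ j))"
      by (subst cis_multiple_2pi) simp_all
    also have "\<dots> = cis (2 * pi * (x $ j - y $ j))"
      by (simp add: r_def cis_mult algebra_simps)
    finally show "\<bar>x $ j - (y + lvec z) $ j\<bar> \<le> cmod (1 - ch (axis j 1) (x - y))"
      by (simp add: r_def ch_eq_cis inner_axis' diff_diff_eq)
  qed
  finally show ?thesis .
qed

section \<open>Smoothing a symbol by a window\<close>

lemma bij_betw_vec_nth_box:
  "bij_betw vec_nth {k :: 'a ^ 'n. \<forall>j. k $ j \<in> S j} (PiE UNIV S)"
  unfolding bij_betw_def
proof
  show "inj_on vec_nth {k :: 'a ^ 'n. \<forall>j. k $ j \<in> S j}"
    by (auto simp: inj_on_def vec_eq_iff fun_eq_iff)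
  show "vec_nth ` {k :: 'a ^ 'n. \<forall>j. k $ j \<in> S j} = PiE UNIV S"
  proof (intro equalityI subsetI)
    fix p assume "p \<in> PiE UNIV S"
    then show "p \<in> vec_nth ` {k :: 'a ^ 'n. \<forall>j. k $ j \<in> S j}"
      by (intro image_eqI[of _ _ "vec_lambda p"]) (auto simp: PiE_iff fun_eq_iff)
  qed auto
qed

lemma sum_vec_box:
  fixes f :: "'n::finite \<Rightarrow> 'a \<Rightarrow> 'c :: comm_semiring_1"
  assumes "\<And>j. finite (S j)"
  shows "(\<Sum>k\<in>{k :: 'a ^ 'n. \<forall>j. k $ j \<in> S j}. \<Prod>j\<in>UNIV. f j (k $ j)) = (\<Prod>j\<in>UNIV. \<Sum>i\<in>S j. f j i)"
  using prod_sum_PiE[of UNIV S f] assms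
    sum.reindex_bij_betw[OF bij_betw_vec_nth_box[of S], of "\<lambda>p. \<Prod>j\<in>UNIV. f j (p j)"]
  by simp

lemma finite_vec_box:
  assumes "\<And>j. finite (S j)"
  shows "finite {k :: 'a ^ 'n. \<forall>j. k $ j \<in> S j}"
  using bij_betw_finite[OF bij_betw_vec_nth_box[of S]] assms by (simp add: finite_PiE)

lemma card_vec_box:
  assumes "\<And>j. finite (S j)"
  shows "card {k :: 'a ^ 'n. \<forall>j. k $ j \<in> S j} = (\<Prod>j\<in>UNIV. card (S j))"
  using sum_vec_box[of S "\<lambda>_ _. 1 :: nat"] assms by simp

lemma qcube_alt: "qcube c B = {k. \<forall>j. k $ j \<in> {c $ j ..< c $ j + int B}}"
  by (auto simp: qcube_def algebra_simps)

lemma finite_qcube [simp]: "finite (qcube c B)"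
  unfolding qcube_alt by (rule finite_vec_box) auto

lemma card_qcube: "card (qcube (c :: int ^ 'n) B) = B ^ CARD('n)"
  unfolding qcube_alt by (subst card_vec_box) auto

text \<open>A Euclidean cone of height and radius R with apex (R, ..., R). The displacement puts its
  support into \<open>qcube 0 (2 * R)\<close>, a half-open cube of the shape used in
  \<open>maximal\<close>.\<close>

definition window :: "nat \<Rightarrow> int ^ 'n \<Rightarrow> real"
  where "window R t = max 0 (real R - norm (lvec t - (\<chi> i. real R)))"

text \<open>The mass depends on the dimension, which R does not reveal; hence the type
  argument.\<close>

definition window_mass :: "'n::finite itself \<Rightarrow> nat \<Rightarrow> real"
  where "window_mass _ R = (\<Sum>t\<in>qcube (0 :: int ^ 'n) (2 * R). (window R t)\<^sup>2)"

text \<open>Up to the factor \<open>1 / R\<^sup>2\<close>, this bounds the quotient of the square sums of a coordinate difference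
  of the window and of the window itself.\<close>

definition window_const :: "'n::finite itself \<Rightarrow> real"
  where "window_const _ = 4 * (8 * real CARD('n)) ^ CARD('n)"

lemma window_nonneg [simp]: "0 \<le> window R t"
  by (simp add: window_def)

lemma window_eq_0:
  assumes "t \<notin> qcube 0 (2 * R)" shows "window R t = 0"
proof -
  obtain j where j: "t $ j < 0 \<or> t $ j \<ge> int (2 * R)"
    using assms by (auto simp: qcube_def not_le not_less)
  have "real R \<le> \<bar>(lvec t - (\<chi> i. real R)) $ j\<bar>"
    using j by auto
  also have "\<dots> \<le> norm (lvec t - (\<chi> i. real R))"
    by (rule component_le_norm_cart)
  finally show ?thesis by (simp add: window_def)
qed

lemma window_lipschitz: "\<bar>window R t - window R (t - axis j 1)\<bar> \<le> 1"
proof -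
  let ?a = "lvec t - (\<chi> i. real R)" and ?b = "lvec (t - axis j 1) - (\<chi> i. real R)"
  have "\<bar>window R t - window R (t - axis j 1)\<bar> \<le> \<bar>norm ?a - norm ?b\<bar>"
    unfolding window_def by (auto simp: max_def)
  also have "\<dots> \<le> norm (?a - ?b)" by (rule norm_triangle_ineq3)
  also have "\<dots> = 1" by simp
  finally show ?thesis .
qed

text \<open>A common index set for the window and its translate by a unit vector.\<close>

definition window_nbhd :: "nat \<Rightarrow> (int ^ 'n) set"
  where "window_nbhd R = qcube (\<chi> j. -1) (2 * R + 2)"

text \<open>With n the dimension, the points of the cube of half-side r around the apex have
  distance at most n r \<le> R / 2 from it, so the window is at least R / 2 there. The cube has (2 r
  + 1)^n points, and r + 1 exceeds R / (2 n).\<close>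

lemma window_mass_lower:
  assumes R: "R \<ge> 1"
  shows "(real R / 2)\<^sup>2 * (real R / (2 * real CARD('n))) ^ CARD('n) \<le> window_mass TYPE('n::finite) R"
proof -
  define n where "n = CARD('n)"
  have n: "n \<ge> 1" unfolding n_def by (simp add: Suc_leI)
  define r where "r = R div (2 * n)"
  have rn: "real n * real r \<le> real R / 2"
  proof -
    have "2 * n * r \<le> R" by (simp add: r_def)
    then have "real (2 * n * r) \<le> real R" by (simp only: of_nat_le_iff)
    then show ?thesis by (simp add: algebra_simps)
  qed
  have rR: "real r \<le> real R / 2"
    using rn n mult_right_mono[of 1 "real n" "real r"] by simp
  define S where "S = {t :: int ^ 'n. \<forall>j. t $ j \<in> {int R - int r .. int R + int r}}"
  have fS: "finite S" unfolding S_def by (rule finite_vec_box) auto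
  have "R < (r + 1) * (2 * n)"
    using n dividend_less_div_times[of "2 * n" R] by (simp add: r_def algebra_simps)
  then have "real R < real ((r + 1) * (2 * n))" by (simp only: of_nat_less_iff)
  then have "real R / (2 * real n) \<le> real r + 1"
    using n by (simp add: field_simps)
  then have "real R / (2 * real n) \<le> 2 * real r + 1" by simp
  then have "(real R / (2 * real n)) ^ n \<le> (2 * real r + 1) ^ n"
    by (intro power_mono) auto
  also have "\<dots> = real (card S)"
    unfolding S_def n_def by (subst card_vec_box) (auto simp: nat_add_distrib nat_mult_distrib add.commute)
  finally have cS: "(real R / (2 * real n)) ^ n \<le> real (card S)" .
  have "(real R / 2)\<^sup>2 * (real R / (2 * real n)) ^ n \<le> (real R / 2)\<^sup>2 * real (card S)"
    by (intro mult_left_mono cS) auto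
  also have "\<dots> = (\<Sum>t\<in>S. (real R / 2)\<^sup>2)" by simp
  also have "\<dots> \<le> (\<Sum>t\<in>S. (window R t)\<^sup>2)"
  proof (intro sum_mono power_mono)
    fix t assume t: "t \<in> S"
    have "norm (lvec t - (\<chi> i. real R)) \<le> (\<Sum>j\<in>UNIV. \<bar>(lvec t - (\<chi> i. real R)) $ j\<bar>)"
      by (rule norm_le_l1_cart)
    also have "\<dots> \<le> (\<Sum>j\<in>(UNIV :: 'n set). real r)"
    proof (rule sum_mono)
      fix j
      have "int R - int r \<le> t $ j" "t $ j \<le> int R + int r" using t by (auto simp: S_def)
      then show "\<bar>(lvec t - (\<chi> i. real R)) $ j\<bar> \<le> real r" by (simp add: abs_le_iff)
    qed
    also have "\<dots> \<le> real R / 2" using rn by (simp add: n_def)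
    finally show "real R / 2 \<le> window R t" by (simp add: window_def)
  qed simp
  also have "\<dots> \<le> window_mass TYPE('n) R"
    unfolding window_mass_def
  proof (rule sum_mono2)
    show "S \<subseteq> qcube 0 (2 * R)"
    proof
      fix t assume t: "t \<in> S"
      have "0 \<le> t $ j \<and> t $ j < 2 * int R" for j
      proof -
        have "int R - int r \<le> t $ j" "t $ j \<le> int R + int r" using t by (auto simp: S_def)
        then show ?thesis using rR R by auto
      qed
      then show "t \<in> qcube 0 (2 * R)" by (simp add: qcube_def)
    qed
  qed auto
  finally show ?thesis by (simp add: n_def)
qed

lemma window_mass_pos: "R \<ge> 1 \<Longrightarrow> 0 < window_mass TYPE('n::finite) R"
  by (rule less_le_trans[OF _ window_mass_lower]) auto

text \<open>Each summand is at most 1 and there are at most (4 R)^n of them, while the mass is at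
  least of order R^(n + 2). Dividing by the bound of \<open>window_mass_lower\<close> produces
  \<open>window_const\<close>.\<close>

lemma window_difference_sum:
  assumes R: "R \<ge> 1"
  shows "(\<Sum>t\<in>window_nbhd R. (window R t - window R (t - axis j 1 :: int ^ 'n))\<^sup>2)
    \<le> window_const TYPE('n::finite) / (real R)\<^sup>2 * window_mass TYPE('n) R"
proof -
  let ?n = "CARD('n)"
  have "(\<Sum>t\<in>window_nbhd R. (window R t - window R (t - axis j 1 :: int ^ 'n))\<^sup>2) \<le> (\<Sum>t\<in>(window_nbhd R :: (int ^ 'n) set). 1)"
    by (intro sum_mono) (metis window_lipschitz abs_square_le_1)
  also have "\<dots> = (2 * real R + 2) ^ ?n"
    by (simp add: window_nbhd_def card_qcube add.commute)
  also have "\<dots> \<le> (4 * real R) ^ ?n"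
    using R by (intro power_mono) auto
  also have "\<dots> = window_const TYPE('n) / (real R)\<^sup>2 * ((real R / 2)\<^sup>2 * (real R / (2 * real ?n)) ^ ?n)"
    using R by (simp add: window_const_def power_divide power_mult_distrib field_simps power2_eq_square)
      (simp flip: power_mult_distrib)
  also have "\<dots> \<le> window_const TYPE('n) / (real R)\<^sup>2 * window_mass TYPE('n) R"
    by (intro mult_left_mono window_mass_lower R) (simp add: window_const_def)
  finally show ?thesis .
qed

section \<open>Autocorrelation of the window and smoothing of a function\<close>

definition window_corr :: "nat \<Rightarrow> int ^ 'n \<Rightarrow> real"
  where "window_corr R \<xi> = (\<Sum>t\<in>qcube 0 (2 * R). window R t * window R (t + \<xi>)) / window_mass TYPE('n) R"

definition smoothing_coeff :: "nat \<Rightarrow> int ^ 'n \<Rightarrow> int ^ 'n \<Rightarrow> complex"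
  where "smoothing_coeff R t s = of_real (window R t * window R s / window_mass TYPE('n) R)"

text \<open>
  The convolution with the squared modulus of the Fourier series of the normalised window. On the
  matrix side it multiplies the entries by the autocorrelation \<open>window_corr\<close>, that is, it averages over all
  translates of the window.
\<close>

definition smoothing :: "nat \<Rightarrow> (real ^ 'n \<Rightarrow> complex) \<Rightarrow> real ^ 'n \<Rightarrow> complex"
  where "smoothing R g x = (\<Sum>t\<in>qcube 0 (2 * R). \<Sum>s\<in>qcube 0 (2 * R).
    smoothing_coeff R t s * ft g (t - s) * ch (t - s) x)"

lemma tcont_smoothing [intro!]: "tcont (\<lambda>x. smoothing R g x)"
  unfolding smoothing_def by auto

lemma smoothing_diff: "tcont f \<Longrightarrow> tcont g \<Longrightarrow> smoothing R (\<lambda>x. f x - g x) x = smoothing R f x - smoothing R g x"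
  by (simp add: smoothing_def ft_diff algebra_simps sum_subtractf)

text \<open>The bridge between the smoothed symbol, which is estimated on the torus, and the
  windowed forms, which are estimated on the lattice.\<close>

lemma ft_sm:
  fixes g :: "real ^ 'n \<Rightarrow> complex"
  shows "ft (smoothing R g) \<xi> = of_real (window_corr R \<xi>) * ft g \<xi>"
proof -
  let ?Q = "qcube 0 (2 * R) :: (int ^ 'n) set"
  have "ft (smoothing R g) \<xi> = (\<Sum>t\<in>?Q. \<Sum>s\<in>?Q. smoothing_coeff R t s * ft g (t - s) * ft (ch (t - s)) \<xi>)"
    unfolding smoothing_def[abs_def]
    by (subst ft_sum, simp, fast, intro sum.cong refl, subst ft_sum, simp, fast, simp only: ft_cmul)
  also have "\<dots> = (\<Sum>t\<in>?Q. \<Sum>s\<in>?Q. if t = s + \<xi> then smoothing_coeff R t s * ft g \<xi> else 0)"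
    by (intro sum.cong refl) (auto simp: ft_ch algebra_simps)
  also have "\<dots> = (\<Sum>s\<in>?Q. if s + \<xi> \<in> ?Q then smoothing_coeff R (s + \<xi>) s * ft g \<xi> else 0)"
    by (subst sum.swap, intro sum.cong refl) (simp add: sum.delta')
  \<comment> \<open>If s + \<xi> leaves the cube, the window vanishes there, so the case distinction
    disappears.\<close>
  also have "\<dots> = (\<Sum>s\<in>?Q. smoothing_coeff R s (s + \<xi>) * ft g \<xi>)"
    by (intro sum.cong refl) (auto simp: smoothing_coeff_def window_eq_0)
  also have "\<dots> = of_real (window_corr R \<xi>) * ft g \<xi>"
    by (simp add: window_corr_def smoothing_coeff_def sum_distrib_right sum_divide_distrib)
  finally show ?thesis .
qed

text \<open>The smoothing integrates g against a density F of total mass 1. Multiplying V by 1 minus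
  a unit character takes a difference of the window coefficients, so Parseval bounds the second
  chordal moment of F by a multiple of 1 / R^2; the Lipschitz bound for g then leaves D / R.\<close>

lemma smoothing_error:
  fixes g :: "real ^ 'n \<Rightarrow> complex"
  assumes R: "R \<ge> 1" and g: "smooth_torus g" and D: "\<And>j x. cmod (pderiv_op j g x) \<le> D"
  shows "cmod (g x - smoothing R g x) \<le> real CARD('n) * (window_const TYPE('n) + 1) * D / real R"
proof -
  let ?Q = "qcube 0 (2 * R) :: (int ^ 'n) set"
  define z where "z = window_mass TYPE('n) R"
  have z: "z > 0" unfolding z_def by (rule window_mass_pos[OF R])
  have D0: "D \<ge> 0" using D[of undefined undefined] norm_ge_zero order_trans by blast
  have pg: "tcont g" by (rule smooth_torus_per[OF g])
  \<comment> \<open>The Fourier series of the window, recentred at x; F is its normalised squared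
    modulus.\<close>
  define V where "V y = (\<Sum>t\<in>?Q. (of_real (window R t) * ch t x) * cnj (ch t y))" for y
  define F where "F y = (cmod (V y))\<^sup>2 / z" for y
  have V: "tcont V" unfolding V_def by auto
  have F0: "F y \<ge> 0" for y using z by (simp add: F_def)
  have cF: "continuous_on S F" for S
    unfolding F_def by (intro continuous_intros tcont_cont V) (use z in auto)
  have iF: "integral (cbox 0 1) F = 1"
  proof -
    have "integral (cbox 0 1) (\<lambda>y. (cmod (V y))\<^sup>2) = z"
      unfolding V_def by (subst integral_norm_trig_cnj) (simp_all add: norm_mult z_def window_mass_def)
    then show ?thesis using z unfolding F_def by simp
  qed
  have FV: "complex_of_real (F y) = V y * cnj (V y) / of_real z" for y
    by (simp add: F_def complex_norm_square[symmetric])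
  have pF: "tcont (\<lambda>y. complex_of_real (F y))"
    unfolding FV using tcont_mult[OF V tcont_cnj[OF V], THEN tcont_mult[OF tcont_const[of "1 / complex_of_real z"]]] by simp
  have "smoothing R g x = torus_int (\<lambda>y. g y * of_real (F y))"
  proof -
    have "g y * of_real (F y) = (\<Sum>t\<in>?Q. \<Sum>s\<in>?Q. (smoothing_coeff R t s * ch (t - s) x) * (ch (- (t - s)) y * g y))" for y
    proof -
      have "V y * cnj (V y) = (\<Sum>t\<in>?Q. \<Sum>s\<in>?Q. of_real (window R t * window R s) * ch (t - s) x * ch (- (t - s)) y)"
        unfolding V_def cnj_sum sum_product
        by (intro sum.cong refl) (simp add: ch_diff ch_minus mult_ac)
      then show ?thesis
        unfolding FV by (simp add: smoothing_coeff_def z_def sum_distrib_left sum_distrib_right sum_divide_distrib mult_ac)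
    qed
    then have "torus_int (\<lambda>y. g y * of_real (F y)) = (\<Sum>t\<in>?Q. \<Sum>s\<in>?Q. (smoothing_coeff R t s * ch (t - s) x) * ft g (t - s))"
      unfolding ft_def using pg
      by (simp only:) (subst torus_int_sum, simp, fast, intro sum.cong refl, subst torus_int_sum, simp, fast, simp only: torus_int_cmul)
    then show ?thesis by (simp add: smoothing_def mult_ac)
  qed
  moreover have "g x = torus_int (\<lambda>y. g x * of_real (F y))"
  proof -
    have "torus_int (\<lambda>y. of_real (F y)) = 1"
      using iF integral_linear[OF integrable_continuous[OF cF] bounded_linear_of_real, of 0 1]
      by (simp add: o_def)
    then show ?thesis by simp
  qed
  ultimately have "g x - smoothing R g x = torus_int (\<lambda>y. (g x - g y) * of_real (F y))"
    unfolding left_diff_distrib using pF pg by (subst torus_int_diff) auto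
  also have "cmod \<dots> \<le> integral (cbox 0 1) (\<lambda>y. \<Sum>j\<in>UNIV. D * (real R * ((cmod (1 - ch (axis j 1) (x - y)))\<^sup>2 * F y) + F y / real R))"
  proof (rule integral_norm_bound_integral)
    show "(\<lambda>y. (g x - g y) * of_real (F y)) integrable_on cbox 0 1"
      using pF pg by (intro tcont_integrable) auto
    show "(\<lambda>y. \<Sum>j\<in>UNIV. D * (real R * ((cmod (1 - ch (axis j 1) (x - y)))\<^sup>2 * F y) + F y / real R)) integrable_on cbox 0 1"
      by (intro integrable_continuous continuous_intros cF) (use R in auto)
    fix y
    \<comment> \<open>Trades the first moment for the second; with the weight R both resulting terms
      are of order 1 / R.\<close>
    have am: "s \<le> real R * s\<^sup>2 + 1 / real R" if "s \<ge> 0" for s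
    proof -
      have "0 \<le> (real R * s - 1/2)\<^sup>2" by simp
      then have "real R * s \<le> (real R * s)\<^sup>2 + 1" by (simp add: power2_eq_square algebra_simps)
      then have "real R * s / real R \<le> ((real R * s)\<^sup>2 + 1) / real R"
        by (rule divide_right_mono) simp
      then show ?thesis using R by (simp add: power2_eq_square add_divide_distrib mult_ac)
    qed
    have "cmod ((g x - g y) * of_real (F y)) = cmod (g x - g y) * F y"
      using F0 by (simp add: norm_mult)
    also have "\<dots> \<le> D * (\<Sum>j\<in>UNIV. cmod (1 - ch (axis j 1) (x - y))) * F y"
      by (intro mult_right_mono smooth_torus_lipschitz g D F0)
    also have "\<dots> \<le> D * (\<Sum>j\<in>UNIV. real R * (cmod (1 - ch (axis j 1) (x - y)))\<^sup>2 + 1 / real R) * F y"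
      by (intro mult_right_mono mult_left_mono sum_mono am F0 D0) simp
    also have "\<dots> = (\<Sum>j\<in>UNIV. D * (real R * ((cmod (1 - ch (axis j 1) (x - y)))\<^sup>2 * F y) + F y / real R))"
      by (simp add: sum_distrib_left sum_distrib_right algebra_simps)
    finally show "cmod ((g x - g y) * of_real (F y)) \<le> \<dots>" .
  qed
  also have "\<dots> = (\<Sum>j\<in>UNIV. D * (real R * integral (cbox 0 1) (\<lambda>y. (cmod (1 - ch (axis j 1) (x - y)))\<^sup>2 * F y) + 1 / real R))"
  proof -
    have int: "(\<lambda>y. (cmod (1 - ch (axis j 1) (x - y)))\<^sup>2 * F y) integrable_on cbox 0 1" "F integrable_on cbox 0 1" for j
      by (intro integrable_continuous continuous_intros cF)+
    have "((\<lambda>y. \<Sum>j\<in>UNIV. D * (real R * ((cmod (1 - ch (axis j 1) (x - y)))\<^sup>2 * F y) + F y / real R)) has_integral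
      (\<Sum>j\<in>UNIV. D * (real R * integral (cbox 0 1) (\<lambda>y. (cmod (1 - ch (axis j 1) (x - y)))\<^sup>2 * F y) + integral (cbox 0 1) F / real R))) (cbox 0 1)"
      by (intro has_integral_sum has_integral_mult_right has_integral_add has_integral_divide integrable_integral int) simp
    then show ?thesis by (simp add: integral_unique iF)
  qed
  also have "\<dots> \<le> (\<Sum>j\<in>(UNIV :: 'n set). D * (real R * (window_const TYPE('n) / (real R)\<^sup>2) + 1 / real R))"
  proof (intro sum_mono mult_left_mono add_right_mono D0)
    fix j :: 'n
    let ?e = "axis j 1 :: int ^ 'n"
    have Q: "?Q \<subseteq> window_nbhd R" "(\<lambda>t. t + ?e) ` ?Q \<subseteq> window_nbhd R"
      by (auto simp: window_nbhd_def qcube_def axis_def) (smt (verit))+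
    have "(1 - ch ?e (x - y)) * V y = (\<Sum>t\<in>window_nbhd R. (of_real (window R t - window R (t - ?e)) * ch t x) * cnj (ch t y))" for y
    proof -
      have 1: "V y = (\<Sum>t\<in>window_nbhd R. (of_real (window R t) * ch t x) * cnj (ch t y))"
        unfolding V_def using Q by (intro sum.mono_neutral_left) (auto simp: window_nbhd_def window_eq_0)
      have "ch ?e (x - y) * V y = (\<Sum>t\<in>?Q. (of_real (window R t) * ch (t + ?e) x) * cnj (ch (t + ?e) y))"
        unfolding V_def sum_distrib_left
        by (intro sum.cong refl) (simp add: ch_diff_right ch_add mult_ac)
      also have "\<dots> = (\<Sum>t\<in>(\<lambda>t. t + ?e) ` ?Q. (of_real (window R (t - ?e)) * ch t x) * cnj (ch t y))"
        by (subst sum.reindex) (auto simp: inj_on_def)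
      also have "\<dots> = (\<Sum>t\<in>window_nbhd R. (of_real (window R (t - ?e)) * ch t x) * cnj (ch t y))"
        using Q
      proof (intro sum.mono_neutral_left ballI)
        fix t assume "t \<in> window_nbhd R - (\<lambda>t. t + ?e) ` ?Q"
        then have "t - ?e \<notin> ?Q" by (force simp: image_iff)
        then show "(of_real (window R (t - ?e)) * ch t x) * cnj (ch t y) = 0" by (simp add: window_eq_0)
      qed (auto simp: window_nbhd_def)
      finally show ?thesis
        unfolding left_diff_distrib by (simp add: 1 algebra_simps sum_subtractf)
    qed
    then have "(cmod (1 - ch ?e (x - y)))\<^sup>2 * F y = (cmod (\<Sum>t\<in>window_nbhd R. (of_real (window R t - window R (t - ?e)) * ch t x) * cnj (ch t y)))\<^sup>2 / z" for y
      by (metis F_def norm_mult power_mult_distrib times_divide_eq_right)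
    then have "integral (cbox 0 1) (\<lambda>y. (cmod (1 - ch ?e (x - y)))\<^sup>2 * F y)
        = (\<Sum>t\<in>window_nbhd R. (window R t - window R (t - ?e))\<^sup>2) / z"
      using integral_norm_trig_cnj[of "window_nbhd R" "\<lambda>t. of_real (window R t - window R (t - ?e)) * ch t x"]
      by (simp add: window_nbhd_def norm_mult flip: of_real_diff)
    also have "\<dots> \<le> window_const TYPE('n) / (real R)\<^sup>2"
      using window_difference_sum[OF R, of j] z by (simp add: z_def field_simps)
    finally show "integral (cbox 0 1) (\<lambda>y. (cmod (1 - ch ?e (x - y)))\<^sup>2 * F y) \<le> window_const TYPE('n) / (real R)\<^sup>2" .
  qed simp
  also have "\<dots> = real CARD('n) * (window_const TYPE('n) + 1) * D / real R"
    using R by (simp add: field_simps power2_eq_square)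
  finally show ?thesis .
qed

lemma mdiff_sm:
  assumes "\<And>k. tcont (\<sigma> k)"
  shows "mdiff_op \<alpha> (\<lambda>l. \<sigma> l x - smoothing R (\<sigma> l) x) k
    = mdiff_op \<alpha> (\<lambda>l. \<sigma> l x) k - smoothing R (\<lambda>y. mdiff_op \<alpha> (\<lambda>l. \<sigma> l y) k) x"
proof -
  have "(\<forall>k. tcont (\<lambda>x. mdiff_op \<alpha> (\<lambda>l. \<sigma> l x) k)) \<and>
    (\<forall>k x. mdiff_op \<alpha> (\<lambda>l. \<sigma> l x - smoothing R (\<sigma> l) x) k
      = mdiff_op \<alpha> (\<lambda>l. \<sigma> l x) k - smoothing R (\<lambda>y. mdiff_op \<alpha> (\<lambda>l. \<sigma> l y) k) x)"
    using mdiff_rel[of "\<lambda>F G. (\<forall>k. tcont (F k)) \<and> (\<forall>k x. G k x = F k x - smoothing R (F k) x)" \<sigma>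
        "\<lambda>k x. \<sigma> k x - smoothing R (\<sigma> k) x" \<alpha>] assms
    by (auto simp: diff_op_def smoothing_diff)
  then show ?thesis by blast
qed

section \<open>Localisation to dyadic shells\<close>

lemma bracket_ge_1: "1 \<le> bracket k"
  by (simp add: bracket_def)

lemma bracket_pos [simp]: "0 < bracket k"
  using bracket_ge_1[of k] by linarith

lemma bracket_neq_0 [simp]: "bracket k \<noteq> 0"
  using bracket_pos[of k] by linarith

lemma bracket_diff: "\<bar>bracket k - bracket l\<bar> \<le> norm (lvec (k - l))"
  using norm_triangle_ineq3[of "lvec k" "lvec l"] by (simp add: bracket_def)

lemma norm_lvec_le:
  assumes "\<And>j. \<bar>real_of_int (k $ j)\<bar> \<le> b"
  shows "norm (lvec (k :: int ^ 'n)) \<le> real CARD('n) * b"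
proof -
  have "norm (lvec k) \<le> (\<Sum>j\<in>UNIV. \<bar>lvec k $ j\<bar>)" by (rule norm_le_l1_cart)
  also have "\<dots> \<le> (\<Sum>j\<in>(UNIV :: 'n set). b)" using assms by (intro sum_mono) simp
  finally show ?thesis by simp
qed

text \<open>Tents of unit slope on the logarithmic scale: neighbouring tents add up to 1, and the
  slope becomes a Lipschitz constant of order 2^(-p) in k. The partition is inserted linearly in the
  row index, so no square roots of it occur.\<close>

definition psi :: "nat \<Rightarrow> int ^ 'n \<Rightarrow> real"
  where "psi p k = max 0 (1 - \<bar>log 2 (bracket k) - real p\<bar>)"

text \<open>One factor 2 wider on each side than the support of \<open>psi p\<close>, which leaves
  room for the cubes that meet that support.\<close>

definition shell :: "nat \<Rightarrow> (int ^ 'n) set"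
  where "shell p = {k. 2 ^ p / 4 \<le> bracket k \<and> bracket k \<le> 4 * 2 ^ p}"

lemma psi_range [simp]: "0 \<le> psi p k" "psi p k \<le> 1"
  by (simp_all add: psi_def)

lemma psi_pos_bracket:
  assumes "psi p k \<noteq> 0"
  shows "2 ^ p / 2 \<le> bracket k" "bracket k \<le> 2 * 2 ^ p"
proof -
  have "\<not> 1 - \<bar>log 2 (bracket k) - real p\<bar> \<le> 0"
    using assms max_absorb1[of "1 - \<bar>log 2 (bracket k) - real p\<bar>" 0] unfolding psi_def by blast
  then have a: "real p - 1 \<le> log 2 (bracket k)" "log 2 (bracket k) \<le> real p + 1"
    by linarith+
  have e: "2 powr log 2 (bracket k) = bracket k" by simp
  have "2 powr (real p - 1) \<le> 2 powr log 2 (bracket k)" "2 powr log 2 (bracket k) \<le> 2 powr (real p + 1)"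
    using a by (intro powr_mono; simp)+
  then have "2 powr (real p - 1) \<le> bracket k" "bracket k \<le> 2 powr (real p + 1)"
    unfolding e .
  moreover have "2 powr (real p - 1) = 2 ^ p / (2 :: real)" "2 powr (real p + 1) = 2 * (2 :: real) ^ p"
    by (simp_all add: powr_diff powr_add powr_realpow)
  ultimately show "2 ^ p / 2 \<le> bracket k" "bracket k \<le> 2 * 2 ^ p" by simp_all
qed

text \<open>Of the constant 8, a factor 4 comes from the lower bound of the bracket on the shell and
  a factor 2 from ln 2 \<ge> 1 / 2.\<close>

lemma psi_lipschitz:
  assumes "k \<in> shell p" "c \<in> shell p"
  shows "\<bar>psi p k - psi p c\<bar> \<le> 8 * norm (lvec (k - c)) / 2 ^ p"
proof -
  have *: "log 2 (bracket a) - log 2 (bracket b) \<le> 8 * norm (lvec (k - c)) / 2 ^ p"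
    if "a \<in> shell p" "b \<in> shell p" "norm (lvec (a - b)) = norm (lvec (k - c))" for a b :: "int ^ 'n"
  proof -
    have b: "2 ^ p / 4 \<le> bracket b" using that by (simp add: shell_def)
    have l2: "1 / 2 \<le> ln (2 :: real)" using ln2_ge_two_thirds by simp
    have "ln (bracket a / bracket b) \<le> bracket a / bracket b - 1"
      by (intro ln_le_minus_one divide_pos_pos) auto
    also have "\<dots> = (bracket a - bracket b) / bracket b"
      by (simp add: diff_divide_distrib)
    also have "\<dots> \<le> norm (lvec (k - c)) / bracket b"
      using bracket_diff[of a b] that by (intro divide_right_mono) (auto simp: less_imp_le)
    also have "\<dots> \<le> norm (lvec (k - c)) / (2 ^ p / 4)"
      using b by (intro divide_left_mono) auto
    finally have "ln (bracket a / bracket b) \<le> 4 * norm (lvec (k - c)) / 2 ^ p" by (simp add: mult.commute)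
    then have "ln (bracket a / bracket b) / ln 2 \<le> 4 * norm (lvec (k - c)) / 2 ^ p / ln 2"
      by (rule divide_right_mono) simp
    also have "\<dots> \<le> 4 * norm (lvec (k - c)) / 2 ^ p / (1 / 2)"
      using l2 by (intro divide_left_mono) auto
    finally show ?thesis by (simp add: log_def ln_div diff_divide_distrib)
  qed
  have "\<bar>log 2 (bracket k) - log 2 (bracket c)\<bar> \<le> 8 * norm (lvec (k - c)) / 2 ^ p"
  proof -
    have "norm (lvec (c - k)) = norm (lvec (k - c))"
      by (simp add: norm_minus_commute)
    from *[OF assms refl] *[OF assms(2,1) this] show ?thesis by linarith
  qed
  moreover have "\<bar>psi p k - psi p c\<bar> \<le> \<bar>log 2 (bracket k) - log 2 (bracket c)\<bar>"
  proof -
    have mx: "\<bar>max 0 (1 - u) - max 0 (1 - v)\<bar> \<le> \<bar>u - v\<bar>" for u v :: real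
      by (auto simp: max_def)
    have "\<bar>psi p k - psi p c\<bar> \<le> \<bar>\<bar>log 2 (bracket k) - real p\<bar> - \<bar>log 2 (bracket c) - real p\<bar>\<bar>"
      unfolding psi_def by (rule mx)
    also have "\<dots> \<le> \<bar>(log 2 (bracket k) - real p) - (log 2 (bracket c) - real p)\<bar>"
      by (rule abs_triangle_ineq3)
    finally show ?thesis by simp
  qed
  ultimately show ?thesis by linarith
qed

text \<open>The corners c for which \<open>qcube c B\<close> meets F; they make sums over all
  translates finite.\<close>

definition centers :: "(int ^ 'n) set \<Rightarrow> nat \<Rightarrow> (int ^ 'n) set"
  where "centers F B = (\<lambda>(k, t). k - t) ` (F \<times> qcube 0 B)"

lemma finite_centers [simp]: "finite F \<Longrightarrow> finite (centers F B)"
  unfolding centers_def by auto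

lemma mem_qcube_diff: "k \<in> qcube c B \<longleftrightarrow> k - c \<in> qcube 0 B"
  by (simp add: qcube_def)

text \<open>For fixed k in F the differences k - c exhaust the support of X, so the sum over
  translates is the same for every row.\<close>

lemma sum_centers:
  fixes X :: "int ^ 'n \<Rightarrow> 'b :: comm_monoid_add"
  assumes "finite F" "k \<in> F" and X: "\<And>t. t \<notin> qcube 0 B \<Longrightarrow> X t = 0"
  shows "(\<Sum>c\<in>centers F B. X (k - c)) = (\<Sum>t\<in>qcube 0 B. X t)"
proof -
  have "(\<Sum>c\<in>centers F B. X (k - c)) = (\<Sum>c\<in>(\<lambda>t. k - t) ` qcube 0 B. X (k - c))"
  proof (rule sum.mono_neutral_right)
    show "(\<lambda>t. k - t) ` qcube 0 B \<subseteq> centers F B"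
      using assms(2) by (force simp: centers_def)
    show "\<forall>c\<in>centers F B - (\<lambda>t. k - t) ` qcube 0 B. X (k - c) = 0"
    proof
      fix c assume "c \<in> centers F B - (\<lambda>t. k - t) ` qcube 0 B"
      then have "k - c \<notin> qcube 0 B" by (force simp: image_iff)
      then show "X (k - c) = 0" by (rule X)
    qed
  qed (use assms in auto)
  also have "\<dots> = (\<Sum>t\<in>qcube 0 B. X t)"
    by (subst sum.reindex) (auto simp: inj_on_def)
  finally show ?thesis .
qed

lemma sum_over_cubes:
  fixes X :: "int ^ 'n \<Rightarrow> 'b :: real_vector"
  assumes F: "finite F"
  shows "(\<Sum>c\<in>centers F B. \<Sum>k\<in>F \<inter> qcube c B. X k) = real (B ^ CARD('n)) *\<^sub>R (\<Sum>k\<in>F. X k)"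
proof -
  have "(\<Sum>c\<in>centers F B. \<Sum>k\<in>F \<inter> qcube c B. X k)
      = (\<Sum>c\<in>centers F B. \<Sum>k\<in>F. if k - c \<in> qcube 0 B then X k else 0)"
    by (simp add: sum.inter_restrict[OF F] mem_qcube_diff[symmetric])
  also have "\<dots> = (\<Sum>k\<in>F. \<Sum>c\<in>centers F B. if k - c \<in> qcube 0 B then X k else 0)"
    by (rule sum.swap)
  also have "\<dots> = (\<Sum>k\<in>F. \<Sum>t\<in>(qcube 0 B :: (int ^ 'n) set). if t \<in> qcube 0 B then X k else 0)"
  proof (rule sum.cong[OF refl])
    fix k assume "k \<in> F"
    from sum_centers[OF F this, of B "\<lambda>t. if t \<in> qcube 0 B then X k else 0"]
    show "(\<Sum>c\<in>centers F B. if k - c \<in> qcube 0 B then X k else 0)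
        = (\<Sum>t\<in>(qcube 0 B :: (int ^ 'n) set). if t \<in> qcube 0 B then X k else 0)" by simp
  qed
  also have "\<dots> = (\<Sum>k\<in>F. real (B ^ CARD('n)) *\<^sub>R X k)"
    by (intro sum.cong refl) (simp add: card_qcube sum_constant_scaleR)
  finally show ?thesis by (simp add: scaleR_sum_right)
qed

text \<open>\<open>of_nat B\<close> is the vector with all coordinates B, so this is the cube
  enlarged by its own side in every direction. A column outside it is far from every row in
  \<open>qcube c B\<close>.\<close>

definition wcube :: "int ^ 'n \<Rightarrow> nat \<Rightarrow> (int ^ 'n) set"
  where "wcube c B = qcube (c - of_nat B) (3 * B)"

lemma mem_wcube: "k \<in> wcube c B \<longleftrightarrow> (\<forall>j. - int B \<le> k $ j - c $ j \<and> k $ j - c $ j < 2 * int B)"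
proof -
  have "(0 \<le> k $ j - (c - of_nat B) $ j \<and> k $ j - (c - of_nat B) $ j < int (3 * B)) \<longleftrightarrow>
      (- int B \<le> k $ j - c $ j \<and> k $ j - c $ j < 2 * int B)" for j
    unfolding vector_minus_component of_nat_index by (auto; linarith)
  then show ?thesis unfolding wcube_def qcube_def by blast
qed

lemma qcube_subset_wcube: "qcube c B \<subseteq> wcube c B"
proof
  fix k assume "k \<in> qcube c B"
  then have *: "0 \<le> k $ j - c $ j \<and> k $ j - c $ j < int B" for j by (simp add: qcube_def)
  have "- int B \<le> k $ j - c $ j \<and> k $ j - c $ j < 2 * int B" for j
    using *[of j] by linarith
  then show "k \<in> wcube c B" by (simp add: mem_wcube)
qed

text \<open>A point belongs to \<open>wcube c B\<close> for at most
  \<open>(3 * B) ^ CARD('n)\<close> vectors c, and the terms are nonnegative.\<close>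

lemma sum_over_wcubes:
  fixes X :: "int ^ 'n \<Rightarrow> real"
  assumes F: "finite F" and X: "\<And>k. X k \<ge> 0"
  shows "(\<Sum>c\<in>centers F B. \<Sum>k\<in>F \<inter> wcube c B. X k) \<le> real ((3 * B) ^ CARD('n)) * (\<Sum>k\<in>F. X k)"
proof -
  have "(\<Sum>c\<in>centers F B. \<Sum>k\<in>F \<inter> wcube c B. X k)
      = (\<Sum>c\<in>centers F B. \<Sum>k\<in>F. if k \<in> wcube c B then X k else 0)"
    by (simp add: sum.inter_restrict[OF F])
  also have "\<dots> = (\<Sum>k\<in>F. \<Sum>c\<in>centers F B. if k \<in> wcube c B then X k else 0)"
    by (rule sum.swap)
  also have "\<dots> \<le> (\<Sum>k\<in>F. real ((3 * B) ^ CARD('n)) * X k)"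
  proof (rule sum_mono)
    fix k assume "k \<in> F"
    let ?T = "{c. k \<in> wcube c B}"
    have T: "?T \<subseteq> (\<lambda>t. k - t + of_nat B) ` qcube 0 (3 * B)"
    proof
      fix c assume "c \<in> ?T"
      then have *: "- int B \<le> k $ j - c $ j \<and> k $ j - c $ j < 2 * int B" for j
        by (simp only: mem_Collect_eq mem_wcube)
      have "0 \<le> (k - c + of_nat B) $ j - 0 $ j \<and> (k - c + of_nat B) $ j - 0 $ j < int (3 * B)" for j
        using *[of j] by (simp add: of_nat_index)
      then have "k - c + of_nat B \<in> qcube 0 (3 * B)"
        unfolding qcube_def by blast
      then show "c \<in> (\<lambda>t. k - t + of_nat B) ` qcube 0 (3 * B)"
        by (rule rev_image_eqI) simp
    qed
    have fT: "finite ?T" by (rule finite_subset[OF T finite_imageI[OF finite_qcube]])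
    have "card ?T \<le> card (qcube (0 :: int ^ 'n) (3 * B))"
      by (rule order_trans[OF card_mono[OF finite_imageI[OF finite_qcube] T] card_image_le[OF finite_qcube]])
    then have cT: "card ?T \<le> (3 * B) ^ CARD('n)" by (simp add: card_qcube)
    have "(\<Sum>c\<in>centers F B. if k \<in> wcube c B then X k else 0) = (\<Sum>c\<in>{c \<in> centers F B. k \<in> wcube c B}. X k)"
      by (rule sum.inter_filter[symmetric]) (rule finite_centers[OF F])
    also have "\<dots> \<le> (\<Sum>c\<in>?T. X k)"
      using fT X by (intro sum_mono2) auto
    also have "\<dots> = real (card ?T) * X k" by simp
    also have "\<dots> \<le> real ((3 * B) ^ CARD('n)) * X k"
      by (intro mult_right_mono of_nat_mono cT X)
    finally show "(\<Sum>c\<in>centers F B. if k \<in> wcube c B then X k else 0) \<le> real ((3 * B) ^ CARD('n)) * X k" .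
  qed
  finally show ?thesis unfolding sum_distrib_left .
qed

definition far :: "nat \<Rightarrow> int ^ 'n \<Rightarrow> int ^ 'n \<Rightarrow> bool"
  where "far B k l \<longleftrightarrow> (\<exists>j. int B \<le> \<bar>l $ j - k $ j\<bar>)"

lemma far_wcube:
  assumes k: "k \<in> qcube c B" and l: "l \<notin> wcube c B"
  shows "far B k l"
proof -
  obtain j where j: "\<not> (- int B \<le> l $ j - c $ j \<and> l $ j - c $ j < 2 * int B)"
    using l unfolding mem_wcube by blast
  moreover have "0 \<le> k $ j - c $ j" "k $ j - c $ j < int B"
    using k by (simp_all add: qcube_def)
  ultimately have "int B \<le> \<bar>l $ j - k $ j\<bar>" by linarith
  then show ?thesis by (auto simp: far_def)
qed

lemma near_wcube:
  assumes k: "k \<in> qcube c B" and l: "l \<in> wcube c B"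
  shows "\<bar>k $ j - l $ j\<bar> \<le> 2 * int B"
proof -
  have "- int B \<le> l $ j - c $ j" "l $ j - c $ j < 2 * int B"
    using l unfolding mem_wcube by blast+
  moreover have "0 \<le> k $ j - c $ j" "k $ j - c $ j < int B"
    using k by (simp_all add: qcube_def)
  ultimately show ?thesis by linarith
qed

abbreviation ssq :: "(int ^ 'n) set \<Rightarrow> (int ^ 'n \<Rightarrow> complex) \<Rightarrow> real"
  where "ssq F f \<equiv> \<Sum>k\<in>F. (cmod (f k))\<^sup>2"

lemma sum_mult_le_L2:
  "cmod (\<Sum>k\<in>J. a k * cnj (b k)) \<le> L2_set (\<lambda>k. cmod (a k)) J * L2_set (\<lambda>k. cmod (b k)) J"
proof -
  have "cmod (\<Sum>k\<in>J. a k * cnj (b k)) \<le> (\<Sum>k\<in>J. \<bar>cmod (a k)\<bar> * \<bar>cmod (b k)\<bar>)"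
    by (rule order_trans[OF norm_sum]) (simp add: norm_mult)
  also have "\<dots> \<le> L2_set (\<lambda>k. cmod (a k)) J * L2_set (\<lambda>k. cmod (b k)) J"
    by (rule L2_set_mult_ineq)
  finally show ?thesis .
qed

lemma L2_sq: "(L2_set (\<lambda>k. cmod (f k)) J)\<^sup>2 = ssq J f"
  by (simp add: L2_set_def sum_nonneg)

lemma L2_set_subset: "finite K \<Longrightarrow> J \<subseteq> K \<Longrightarrow> L2_set f J \<le> L2_set f K"
  unfolding L2_set_def by (intro real_sqrt_le_mono sum_mono2) auto

text \<open>Averaging over all translates of the cube, rather than tiling, treats these errors on the same
  footing as the window average below.\<close>

lemma near_far:
  fixes h :: "int ^ 'n \<Rightarrow> real ^ 'n \<Rightarrow> complex"
  assumes F: "finite F" and B: "B > 0" and H: "H \<ge> 0" and tcont: "\<And>k. tcont (h k)"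
    and shell: "\<And>(k :: int ^ 'n) l. psi p k \<noteq> 0 \<Longrightarrow> (\<And>j. \<bar>k $ j - l $ j\<bar> \<le> 2 * int B) \<Longrightarrow> l \<in> shell p"
    and bd: "\<And>\<alpha> k x. (\<And>j. \<alpha> $ j \<le> 1) \<Longrightarrow> k \<in> shell p
        \<Longrightarrow> cmod (mdiff_op \<alpha> (\<lambda>l. h l x) k) \<le> H / B ^ mlen \<alpha>"
  shows "cmod (\<Sum>k\<in>F. \<Sum>l\<in>F. psi p k * ft (h k) (l - k) * f l * cnj (g k))
    \<le> 6 ^ CARD('n) * H * (ssq (F \<inter> shell p) f + ssq (F \<inter> shell p) g)
      + (\<Sum>k\<in>F. \<Sum>l\<in>{l\<in>F. far B k l}. psi p k * cmod (ft (h k) (l - k)) * cmod (f l) * cmod (g k))"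
proof -
  define X where "X k l = psi p k * ft (h k) (l - k) * f l * cnj (g k)" for k l
  define Y where "Y k = (\<Sum>l\<in>{l\<in>F. far B k l}. psi p k * cmod (ft (h k) (l - k)) * cmod (f l) * cmod (g k))" for k
  define Z where "Z k = (if k \<in> shell p then (cmod (f k))\<^sup>2 + (cmod (g k))\<^sup>2 else 0)" for k
  let ?n = "CARD('n)"
  have Y0: "Y k \<ge> 0" for k unfolding Y_def by (intro sum_nonneg) auto
  have Z0: "Z k \<ge> 0" for k unfolding Z_def by auto
  \<comment> \<open>If \<open>psi p\<close> vanishes on the rows of the cube, the block is zero.
    Otherwise the enlarged cube lies in the shell, and \<open>maximal\<close> applies with its
    points as columns.\<close>
  have near: "cmod (\<Sum>k\<in>F \<inter> qcube c B. \<Sum>l\<in>F \<inter> wcube c B. X k l) \<le> 2 ^ ?n * H * (\<Sum>k\<in>F \<inter> wcube c B. Z k)" for c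
  proof (cases "\<exists>k\<in>F \<inter> qcube c B. psi p k \<noteq> 0")
    case False
    then have "(\<Sum>k\<in>F \<inter> qcube c B. \<Sum>l\<in>F \<inter> wcube c B. X k l) = 0"
      by (intro sum.neutral ballI) (auto simp: X_def)
    then show ?thesis using H Z0 by (auto intro!: mult_nonneg_nonneg sum_nonneg)
  next
    case True
    then obtain k0 where k0: "k0 \<in> qcube c B" "psi p k0 \<noteq> 0" by auto
    have sub: "wcube c B \<subseteq> shell p"
      using shell[OF k0(2)] near_wcube[OF k0(1)] by blast
    let ?Q = "F \<inter> qcube c B" and ?W = "F \<inter> wcube c B"
    have QW: "?Q \<subseteq> ?W" using qcube_subset_wcube by auto
    have fin: "finite ?Q" "finite ?W" using F by auto
    have "(\<Sum>k\<in>?Q. \<Sum>l\<in>?W. X k l) = (\<Sum>k\<in>?Q. toep (h k) ?W f k * cnj (psi p k * g k))"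
      by (intro sum.cong refl) (simp add: X_def toep_def sum_distrib_left sum_distrib_right mult_ac)
    also have "cmod \<dots> \<le> L2_set (\<lambda>k. cmod (toep (h k) ?W f k)) ?Q * L2_set (\<lambda>k. cmod (psi p k * g k)) ?Q"
      by (rule sum_mult_le_L2)
    also have "\<dots> \<le> (2 ^ ?n * H * L2_set (\<lambda>k. cmod (f k)) ?W) * L2_set (\<lambda>k. cmod (g k)) ?W"
    proof (intro mult_mono)
      show "L2_set (\<lambda>k. cmod (toep (h k) ?W f k)) ?Q \<le> 2 ^ ?n * H * L2_set (\<lambda>k. cmod (f k)) ?W"
      proof (rule maximal[OF _ fin B H tcont])
        show "cmod (mdiff_op \<alpha> (\<lambda>l. h l x) c') \<le> H / real B ^ mlen \<alpha>"
          if "\<And>j. \<alpha> $ j \<le> 1" "c' \<in> qcube c B" for \<alpha> c' x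
          by (rule bd[OF that(1)]) (use that(2) sub qcube_subset_wcube in blast)
      qed auto
      have "L2_set (\<lambda>k. cmod (psi p k * g k)) ?Q \<le> L2_set (\<lambda>k. cmod (g k)) ?Q"
        by (intro L2_set_mono) (auto simp: norm_mult mult_left_le_one_le)
      also have "\<dots> \<le> L2_set (\<lambda>k. cmod (g k)) ?W"
        by (rule L2_set_subset[OF fin(2) QW])
      finally show "L2_set (\<lambda>k. cmod (psi p k * g k)) ?Q \<le> L2_set (\<lambda>k. cmod (g k)) ?W" .
    qed (use H in auto)
    also have "\<dots> = 2 ^ ?n * H * (L2_set (\<lambda>k. cmod (f k)) ?W * L2_set (\<lambda>k. cmod (g k)) ?W)"
      by (simp add: mult_ac)
    also have "\<dots> \<le> 2 ^ ?n * H * (ssq ?W f + ssq ?W g)"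
    proof (intro mult_left_mono)
      have "a * b \<le> a\<^sup>2 + b\<^sup>2" for a b :: real
        using sum_squares_bound[of a b] sum_power2_ge_zero[of a b] by linarith
      from this[of "L2_set (\<lambda>k. cmod (f k)) ?W" "L2_set (\<lambda>k. cmod (g k)) ?W"]
      show "L2_set (\<lambda>k. cmod (f k)) ?W * L2_set (\<lambda>k. cmod (g k)) ?W \<le> ssq ?W f + ssq ?W g"
        unfolding L2_sq .
    qed (use H in auto)
    also have "ssq ?W f + ssq ?W g = (\<Sum>k\<in>?W. Z k)"
      unfolding sum.distrib[symmetric] using sub by (intro sum.cong refl) (auto simp: Z_def)
    finally show ?thesis .
  qed
  have cube: "cmod (\<Sum>k\<in>F \<inter> qcube c B. \<Sum>l\<in>F. X k l)
      \<le> 2 ^ ?n * H * (\<Sum>k\<in>F \<inter> wcube c B. Z k) + (\<Sum>k\<in>F \<inter> qcube c B. Y k)" for c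
  proof -
    have "(\<Sum>l\<in>F. X k l) = (\<Sum>l\<in>F \<inter> wcube c B. X k l) + (\<Sum>l\<in>F - wcube c B. X k l)" for k
      using F by (rule sum.Int_Diff)
    then have "cmod (\<Sum>k\<in>F \<inter> qcube c B. \<Sum>l\<in>F. X k l)
        \<le> cmod (\<Sum>k\<in>F \<inter> qcube c B. \<Sum>l\<in>F \<inter> wcube c B. X k l) + cmod (\<Sum>k\<in>F \<inter> qcube c B. \<Sum>l\<in>F - wcube c B. X k l)"
      by (simp add: sum.distrib norm_triangle_ineq)
    also have "cmod (\<Sum>k\<in>F \<inter> qcube c B. \<Sum>l\<in>F - wcube c B. X k l) \<le> (\<Sum>k\<in>F \<inter> qcube c B. Y k)"
    proof (rule sum_norm_le)
      fix k assume k: "k \<in> F \<inter> qcube c B"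
      have "cmod (\<Sum>l\<in>F - wcube c B. X k l) \<le> (\<Sum>l\<in>F - wcube c B. psi p k * cmod (ft (h k) (l - k)) * cmod (f l) * cmod (g k))"
        by (rule sum_norm_le) (simp add: X_def norm_mult)
      also have "\<dots> \<le> Y k"
        unfolding Y_def using F k far_wcube by (intro sum_mono2) auto
      finally show "cmod (\<Sum>l\<in>F - wcube c B. X k l) \<le> Y k" .
    qed
    finally show ?thesis using near[of c] by linarith
  qed
  \<comment> \<open>Each row is counted once for every cube that contains it; the factor B^n is
    cancelled at the end.\<close>
  have "real (B ^ ?n) * cmod (\<Sum>k\<in>F. \<Sum>l\<in>F. X k l) = cmod (\<Sum>c\<in>centers F B. \<Sum>k\<in>F \<inter> qcube c B. \<Sum>l\<in>F. X k l)"
    by (subst sum_over_cubes[OF F]) simp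
  also have "\<dots> \<le> (\<Sum>c\<in>centers F B. 2 ^ ?n * H * (\<Sum>k\<in>F \<inter> wcube c B. Z k) + (\<Sum>k\<in>F \<inter> qcube c B. Y k))"
    by (rule sum_norm_le) (rule cube)
  also have "\<dots> = 2 ^ ?n * H * (\<Sum>c\<in>centers F B. \<Sum>k\<in>F \<inter> wcube c B. Z k) + real (B ^ ?n) * (\<Sum>k\<in>F. Y k)"
    using sum_over_cubes[OF F, of Y B] by (simp add: sum.distrib sum_distrib_left)
  also have "\<dots> \<le> 2 ^ ?n * H * (real ((3 * B) ^ ?n) * (\<Sum>k\<in>F. Z k)) + real (B ^ ?n) * (\<Sum>k\<in>F. Y k)"
    by (intro add_right_mono mult_left_mono sum_over_wcubes F Z0) (use H in auto)
  also have "\<dots> = real (B ^ ?n) * (6 ^ ?n * H * (\<Sum>k\<in>F. Z k) + (\<Sum>k\<in>F. Y k))"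
  proof -
    \<comment> \<open>2^n stems from \<open>maximal\<close>, 3^n from the overlap of the enlarged
      cubes.\<close>
    have "(6 :: real) ^ ?n = 2 ^ ?n * 3 ^ ?n" by (simp flip: power_mult_distrib)
    then show ?thesis by (simp add: power_mult_distrib algebra_simps)
  qed
  finally have "cmod (\<Sum>k\<in>F. \<Sum>l\<in>F. X k l) \<le> 6 ^ ?n * H * (\<Sum>k\<in>F. Z k) + (\<Sum>k\<in>F. Y k)"
    using B by simp
  moreover have "(\<Sum>k\<in>F. Z k) = ssq (F \<inter> shell p) f + ssq (F \<inter> shell p) g"
    unfolding Z_def sum.inter_restrict[OF F] sum.distrib[symmetric] by (intro sum.cong refl) simp
  ultimately show ?thesis by (simp add: X_def Y_def)
qed

text \<open>Cauchy-Schwarz in the form of the arithmetic-geometric mean. It implies that subtracting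
  the smoothing never enlarges an entry, so the remainder inherits the decay far from the
  diagonal.\<close>

lemma window_corr_range:
  assumes R: "R \<ge> 1"
  shows "0 \<le> window_corr R \<xi>" "window_corr R (\<xi> :: int ^ 'n) \<le> 1"
proof -
  let ?Q = "qcube 0 (2 * R) :: (int ^ 'n) set"
  have z: "0 < window_mass TYPE('n) R" by (rule window_mass_pos[OF R])
  show "0 \<le> window_corr R \<xi>"
    unfolding window_corr_def using z by (intro divide_nonneg_pos sum_nonneg) auto
  have "(\<Sum>t\<in>?Q. (window R (t + \<xi>))\<^sup>2) = (\<Sum>t\<in>(\<lambda>t. t + \<xi>) ` ?Q. (window R t)\<^sup>2)"
    by (subst sum.reindex) (auto simp: inj_on_def)
  also have "\<dots> = (\<Sum>t\<in>(\<lambda>t. t + \<xi>) ` ?Q \<inter> ?Q. (window R t)\<^sup>2)"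
    by (intro sum.mono_neutral_right) (auto simp: window_eq_0)
  also have "\<dots> \<le> window_mass TYPE('n) R"
    unfolding window_mass_def by (intro sum_mono2) auto
  finally have w: "(\<Sum>t\<in>?Q. (window R (t + \<xi>))\<^sup>2) \<le> window_mass TYPE('n) R" .
  have "(\<Sum>t\<in>?Q. window R t * window R (t + \<xi>)) \<le> (\<Sum>t\<in>?Q. ((window R t)\<^sup>2 + (window R (t + \<xi>))\<^sup>2) / 2)"
  proof (rule sum_mono)
    fix t
    show "window R t * window R (t + \<xi>) \<le> ((window R t)\<^sup>2 + (window R (t + \<xi>))\<^sup>2) / 2"
      using sum_squares_bound[of "window R t" "window R (t + \<xi>)"] by (simp add: mult_ac)
  qed
  also have "\<dots> = (window_mass TYPE('n) R + (\<Sum>t\<in>?Q. (window R (t + \<xi>))\<^sup>2)) / 2"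
    by (simp only: window_mass_def sum_divide_distrib[symmetric] sum.distrib)
  also have "\<dots> \<le> window_mass TYPE('n) R" using w by simp
  finally show "window_corr R \<xi> \<le> 1"
    unfolding window_corr_def using z by simp
qed

lemma sum_win_centers:
  fixes k :: "int ^ 'n"
  assumes "finite F" "k \<in> F" "R \<ge> 1"
  shows "(\<Sum>c\<in>centers F (2 * R). (window R (k - c))\<^sup>2) = window_mass TYPE('n) R"
  unfolding window_mass_def using assms(1,2)
  by (intro sum_centers[where X = "\<lambda>t. (window R t)\<^sup>2"]) (auto simp: window_eq_0)

text \<open>\<open>sum_centers\<close> for the product of the window at t and at t + (l - k); the
  factor at k already confines c to finitely many values.\<close>

lemma window_corr_centers:
  fixes k :: "int ^ 'n"
  assumes "finite F" "k \<in> F"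
  shows "window_corr R (l - k) = (\<Sum>c\<in>centers F (2 * R). window R (k - c) * window R (l - c)) / window_mass TYPE('n) R"
proof -
  have "(\<Sum>c\<in>centers F (2 * R). window R (k - c) * window R (l - c)) = (\<Sum>t\<in>qcube 0 (2 * R). window R t * window R (t + (l - k)))"
    using sum_centers[OF assms, of "2 * R" "\<lambda>t. window R t * window R (t + (l - k))"] by (simp add: window_eq_0)
  then show ?thesis by (simp add: window_corr_def)
qed

lemma window_lower:
  fixes \<sigma> :: "int ^ 'n \<Rightarrow> real ^ 'n \<Rightarrow> complex"
  assumes F: "finite F" and B: "B > 0" and tcont: "\<And>k. tcont (\<sigma> k)"
    and supp: "\<And>k. k \<notin> qcube c B \<Longrightarrow> g k = 0"
    and shell: "\<And>(k :: int ^ 'n) l. psi p k \<noteq> 0 \<Longrightarrow> (\<And>j. \<bar>k $ j - l $ j\<bar> \<le> 2 * int B) \<Longrightarrow> l \<in> shell p"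
    and osc: "\<And>k. k \<in> qcube c B \<Longrightarrow> qcube c B \<subseteq> shell p \<Longrightarrow> \<bar>psi p k - psi p c\<bar> \<le> \<omega>"
    and lo: "\<And>k x. k \<in> shell p \<Longrightarrow> lo \<le> Re (\<sigma> k x)" "0 \<le> lo" "0 \<le> \<omega>" "0 \<le> Ha" "0 \<le> Hc"
    and bda: "\<And>\<alpha> k x. (\<And>j. \<alpha> $ j \<le> 1) \<Longrightarrow> k \<in> shell p \<Longrightarrow> \<alpha> \<noteq> 0
        \<Longrightarrow> cmod (mdiff_op \<alpha> (\<lambda>l. \<sigma> l x) k) \<le> Ha / B ^ mlen \<alpha>"
    and bdc: "\<And>\<alpha> k x. (\<And>j. \<alpha> $ j \<le> 1) \<Longrightarrow> k \<in> shell p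
        \<Longrightarrow> cmod (mdiff_op \<alpha> (\<lambda>l. \<sigma> l x) k) \<le> Hc / B ^ mlen \<alpha>"
  shows "lo * (\<Sum>k\<in>F. psi p k * (cmod (g k))\<^sup>2) - (\<omega> * lo + 2 ^ CARD('n) * Ha + \<omega> * 2 ^ CARD('n) * Hc) * ssq (F \<inter> shell p) g
    \<le> Re (\<Sum>k\<in>F. \<Sum>l\<in>F. psi p k * ft (\<sigma> k) (l - k) * g l * cnj (g k))"
proof (cases "\<exists>k\<in>F \<inter> qcube c B. psi p k \<noteq> 0")
  case False
  then have z: "psi p k = 0 \<or> g k = 0" if "k \<in> F" for k using supp that by blast
  have "(\<Sum>k\<in>F. psi p k * (cmod (g k))\<^sup>2) = 0"
    using z by (intro sum.neutral ballI) auto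
  moreover have "(\<Sum>k\<in>F. \<Sum>l\<in>F. psi p k * ft (\<sigma> k) (l - k) * g l * cnj (g k)) = 0"
    using z by (intro sum.neutral ballI) auto
  moreover have "0 \<le> (\<omega> * lo + 2 ^ CARD('n) * Ha + \<omega> * 2 ^ CARD('n) * Hc) * ssq (F \<inter> shell p) g"
    using lo by (intro mult_nonneg_nonneg add_nonneg_nonneg sum_nonneg) auto
  ultimately show ?thesis by simp
next
  case True
  then obtain k0 where k0: "k0 \<in> qcube c B" "psi p k0 \<noteq> 0" by auto
  have sub: "qcube c B \<subseteq> shell p"
    using shell[OF k0(2)] near_wcube[OF k0(1)] qcube_subset_wcube by blast
  have c: "c \<in> qcube c B" using B by (simp add: qcube_def)
  let ?Q = "F \<inter> qcube c B" and ?n = "CARD('n)"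
  let ?N = "L2_set (\<lambda>k. cmod (g k)) ?Q"
  have fQ: "finite ?Q" using F by simp
  have om: "\<bar>psi p k - psi p c\<bar> \<le> \<omega>" if "k \<in> ?Q" for k using osc sub that by blast
  have N: "ssq (F \<inter> shell p) g = ?N\<^sup>2"
    unfolding L2_sq using F sub supp by (intro sum.mono_neutral_right) auto
  have T0: "(\<Sum>k\<in>F. \<Sum>l\<in>F. psi p k * ft (\<sigma> k) (l - k) * g l * cnj (g k))
      = (\<Sum>k\<in>?Q. psi p k * toep (\<sigma> k) ?Q g k * cnj (g k))"
  proof -
    have "(\<Sum>l\<in>F. psi p k * ft (\<sigma> k) (l - k) * g l * cnj (g k)) = psi p k * toep (\<sigma> k) ?Q g k * cnj (g k)" for k
    proof -
      have "(\<Sum>l\<in>F. psi p k * ft (\<sigma> k) (l - k) * g l * cnj (g k)) = (\<Sum>l\<in>?Q. psi p k * ft (\<sigma> k) (l - k) * g l * cnj (g k))"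
        using F supp by (intro sum.mono_neutral_right) auto
      then show ?thesis by (simp add: toep_def sum_distrib_left sum_distrib_right mult_ac)
    qed
    then have "(\<Sum>k\<in>F. \<Sum>l\<in>F. psi p k * ft (\<sigma> k) (l - k) * g l * cnj (g k)) = (\<Sum>k\<in>F. psi p k * toep (\<sigma> k) ?Q g k * cnj (g k))"
      by simp
    also have "\<dots> = (\<Sum>k\<in>?Q. psi p k * toep (\<sigma> k) ?Q g k * cnj (g k))"
      using F supp by (intro sum.mono_neutral_right) auto
    finally show ?thesis .
  qed
  define D where "D k x = \<sigma> k x - \<sigma> c x" for k x
  have perD: "tcont (D k)" for k unfolding D_def using tcont by auto
  define S1 where "S1 = (\<Sum>k\<in>?Q. toep (\<sigma> c) ?Q g k * cnj (g k))"
  define S2 where "S2 = (\<Sum>k\<in>?Q. toep (D k) ?Q g k * cnj (g k))"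
  define S3 where "S3 = (\<Sum>k\<in>?Q. toep (\<sigma> k) ?Q g k * cnj ((psi p k - psi p c) * g k))"
  have tk: "toep (\<sigma> k) ?Q g k = toep (\<sigma> c) ?Q g k + toep (D k) ?Q g k" for k
    unfolding toep_def D_def using tcont by (simp add: ft_diff left_diff_distrib sum_subtractf)
  have "psi p k * toep (\<sigma> k) ?Q g k * cnj (g k) = psi p c * (toep (\<sigma> c) ?Q g k * cnj (g k))
      + psi p c * (toep (D k) ?Q g k * cnj (g k)) + toep (\<sigma> k) ?Q g k * cnj ((psi p k - psi p c) * g k)" for k
    unfolding tk by (simp add: algebra_simps)
  then have T1: "(\<Sum>k\<in>?Q. psi p k * toep (\<sigma> k) ?Q g k * cnj (g k)) = psi p c * S1 + psi p c * S2 + S3"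
    unfolding S1_def S2_def S3_def by (simp only: sum_distrib_left sum.distrib)
  have R1: "lo * ?N\<^sup>2 \<le> Re S1"
    unfolding S1_def L2_sq using tcont lo(1) c sub fQ by (intro toep_lower) auto
  have R2: "cmod S2 \<le> 2 ^ ?n * Ha * ?N\<^sup>2"
  proof -
    have "L2_set (\<lambda>k. cmod (toep (D k) ?Q g k)) ?Q \<le> 2 ^ ?n * Ha * ?N"
    proof (rule maximal[OF _ fQ fQ B lo(4) perD])
      fix \<alpha> :: "nat ^ 'n" and c' x
      assume a: "\<And>j. \<alpha> $ j \<le> 1" "c' \<in> qcube c B" "\<alpha> = 0 \<Longrightarrow> c' = c"
      show "cmod (mdiff_op \<alpha> (\<lambda>l. D l x) c') \<le> Ha / real B ^ mlen \<alpha>"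
      proof (cases "\<alpha> = 0")
        case True
        then show ?thesis using a(3) lo(4) by (simp add: D_def)
      next
        case False
        then have "mdiff_op \<alpha> (\<lambda>l. D l x) = mdiff_op \<alpha> (\<lambda>l. \<sigma> l x)"
          unfolding D_def by (rule mdiff_op_diff_const)
        then show ?thesis using bda[OF a(1) _ False] a(2) sub by auto
      qed
    qed auto
    then have "L2_set (\<lambda>k. cmod (toep (D k) ?Q g k)) ?Q * ?N \<le> 2 ^ ?n * Ha * ?N * ?N"
      by (rule mult_right_mono) simp
    moreover have "cmod S2 \<le> L2_set (\<lambda>k. cmod (toep (D k) ?Q g k)) ?Q * ?N"
      unfolding S2_def by (rule sum_mult_le_L2)
    ultimately show ?thesis by (simp add: power2_eq_square mult_ac)
  qed
  have R3: "cmod S3 \<le> \<omega> * 2 ^ ?n * Hc * ?N\<^sup>2"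
  proof -
    have "L2_set (\<lambda>k. cmod (toep (\<sigma> k) ?Q g k)) ?Q \<le> 2 ^ ?n * Hc * ?N"
    proof (rule maximal[OF _ fQ fQ B lo(5) tcont])
      show "cmod (mdiff_op \<alpha> (\<lambda>l. \<sigma> l x) c') \<le> Hc / real B ^ mlen \<alpha>"
        if "\<And>j. \<alpha> $ j \<le> 1" "c' \<in> qcube c B" for \<alpha> c' x
        by (rule bdc[OF that(1)]) (use that(2) sub in blast)
    qed auto
    moreover have "L2_set (\<lambda>k. cmod ((psi p k - psi p c) * g k)) ?Q \<le> \<omega> * ?N"
    proof -
      have "L2_set (\<lambda>k. cmod ((psi p k - psi p c) * g k)) ?Q \<le> L2_set (\<lambda>k. \<omega> * cmod (g k)) ?Q"
        using om by (intro L2_set_mono) (auto simp: norm_mult simp flip: of_real_diff intro!: mult_right_mono)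
      then show ?thesis using lo(3) by (simp add: L2_set_right_distrib)
    qed
    ultimately have "L2_set (\<lambda>k. cmod (toep (\<sigma> k) ?Q g k)) ?Q * L2_set (\<lambda>k. cmod ((psi p k - psi p c) * g k)) ?Q
        \<le> (2 ^ ?n * Hc * ?N) * (\<omega> * ?N)"
      using lo(5) by (intro mult_mono) auto
    moreover have "cmod S3 \<le> L2_set (\<lambda>k. cmod (toep (\<sigma> k) ?Q g k)) ?Q * L2_set (\<lambda>k. cmod ((psi p k - psi p c) * g k)) ?Q"
      unfolding S3_def by (rule sum_mult_le_L2)
    ultimately show ?thesis by (simp add: power2_eq_square mult_ac)
  qed
  \<comment> \<open>Returning from \<open>psi p c\<close> to \<open>psi p k\<close> in the main term
    is the origin of the error \<omega> * lo.\<close>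
  have P: "(\<Sum>k\<in>F. psi p k * (cmod (g k))\<^sup>2) \<le> (psi p c + \<omega>) * ?N\<^sup>2"
  proof -
    have "(\<Sum>k\<in>F. psi p k * (cmod (g k))\<^sup>2) = (\<Sum>k\<in>?Q. psi p k * (cmod (g k))\<^sup>2)"
      using F supp by (intro sum.mono_neutral_right) auto
    also have "\<dots> \<le> (\<Sum>k\<in>?Q. (psi p c + \<omega>) * (cmod (g k))\<^sup>2)"
    proof (intro sum_mono mult_right_mono)
      fix k assume "k \<in> ?Q"
      then show "psi p k \<le> psi p c + \<omega>" using om[of k] by linarith
    qed simp
    finally show ?thesis by (simp add: L2_sq sum_distrib_left)
  qed
  have "lo * (\<Sum>k\<in>F. psi p k * (cmod (g k))\<^sup>2) \<le> lo * ((psi p c + \<omega>) * ?N\<^sup>2)"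
    by (rule mult_left_mono[OF P lo(2)])
  moreover have "psi p c * (lo * ?N\<^sup>2) \<le> psi p c * Re S1"
    by (rule mult_left_mono[OF R1]) simp
  moreover have "- (2 ^ ?n * Ha * ?N\<^sup>2) \<le> psi p c * Re S2"
  proof -
    have "\<bar>psi p c * Re S2\<bar> \<le> 1 * cmod S2"
      unfolding abs_mult by (intro mult_mono abs_Re_le_cmod) auto
    then show ?thesis using R2 by linarith
  qed
  moreover have "- (\<omega> * 2 ^ ?n * Hc * ?N\<^sup>2) \<le> Re S3"
    using R3 abs_Re_le_cmod[of S3] by linarith
  moreover have "Re (\<Sum>k\<in>F. \<Sum>l\<in>F. psi p k * ft (\<sigma> k) (l - k) * g l * cnj (g k))
      = psi p c * Re S1 + psi p c * Re S2 + Re S3"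
    unfolding T0 T1 by simp
  ultimately show ?thesis
    unfolding N by (simp add: algebra_simps)
qed

lemma Re_scale: "of_real z * a = b \<Longrightarrow> z * Re a = Re b"
  by auto

text \<open>Apply \<open>window_lower\<close> to f times each translate of the window. The squared
  windows at a row add up to the mass, and the products at k and l to the mass times
  \<open>window_corr R (l - k)\<close>; division by the mass gives the claim.\<close>

lemma smoothed_lower:
  fixes \<sigma> :: "int ^ 'n \<Rightarrow> real ^ 'n \<Rightarrow> complex"
  assumes F: "finite F" and R: "R \<ge> 1" and Bdef: "B = 2 * R" and tcont: "\<And>k. tcont (\<sigma> k)"
    and shell: "\<And>(k :: int ^ 'n) l. psi p k \<noteq> 0 \<Longrightarrow> (\<And>j. \<bar>k $ j - l $ j\<bar> \<le> 2 * int B) \<Longrightarrow> l \<in> shell p"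
    and osc: "\<And>(k :: int ^ 'n) c. k \<in> qcube c B \<Longrightarrow> qcube c B \<subseteq> shell p \<Longrightarrow> \<bar>psi p k - psi p c\<bar> \<le> \<omega>"
    and lo: "\<And>k x. k \<in> shell p \<Longrightarrow> lo \<le> Re (\<sigma> k x)" "0 \<le> lo" "0 \<le> \<omega>" "0 \<le> Ha" "0 \<le> Hc"
    and bda: "\<And>\<alpha> k x. (\<And>j. \<alpha> $ j \<le> 1) \<Longrightarrow> k \<in> shell p \<Longrightarrow> \<alpha> \<noteq> 0
        \<Longrightarrow> cmod (mdiff_op \<alpha> (\<lambda>l. \<sigma> l x) k) \<le> Ha / B ^ mlen \<alpha>"
    and bdc: "\<And>\<alpha> k x. (\<And>j. \<alpha> $ j \<le> 1) \<Longrightarrow> k \<in> shell p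
        \<Longrightarrow> cmod (mdiff_op \<alpha> (\<lambda>l. \<sigma> l x) k) \<le> Hc / B ^ mlen \<alpha>"
  shows "lo * (\<Sum>k\<in>F. psi p k * (cmod (f k))\<^sup>2) - (\<omega> * lo + 2 ^ CARD('n) * Ha + \<omega> * 2 ^ CARD('n) * Hc) * ssq (F \<inter> shell p) f
    \<le> Re (\<Sum>k\<in>F. \<Sum>l\<in>F. psi p k * (window_corr R (l - k) * ft (\<sigma> k) (l - k)) * f l * cnj (f k))"
proof -
  let ?C = "centers F (2 * R)"
  define z where "z = window_mass TYPE('n) R"
  have z: "z > 0" unfolding z_def by (rule window_mass_pos[OF R])
  define G where "G c k = window R (k - c) * f k" for c k
  define er where "er = \<omega> * lo + 2 ^ CARD('n) * Ha + \<omega> * 2 ^ CARD('n) * Hc"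
  have one: "(\<Sum>c\<in>?C. X k * (cmod (G c k))\<^sup>2) = z * (X k * (cmod (f k))\<^sup>2)" if "k \<in> F" for k and X :: "int ^ 'n \<Rightarrow> real"
  proof -
    have "(\<Sum>c\<in>?C. X k * (cmod (G c k))\<^sup>2) = (\<Sum>c\<in>?C. (window R (k - c))\<^sup>2) * (X k * (cmod (f k))\<^sup>2)"
      by (simp add: G_def norm_mult power_mult_distrib sum_distrib_left sum_distrib_right mult_ac)
    then show ?thesis using sum_win_centers[OF F that R] by (simp add: z_def)
  qed
  have "z * (\<Sum>k\<in>F. \<Sum>l\<in>F. psi p k * (window_corr R (l - k) * ft (\<sigma> k) (l - k)) * f l * cnj (f k))
      = (\<Sum>k\<in>F. \<Sum>l\<in>F. \<Sum>c\<in>?C. psi p k * ft (\<sigma> k) (l - k) * G c l * cnj (G c k))"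
    unfolding sum_distrib_left
  proof (intro sum.cong refl)
    fix k l assume "k \<in> F" "l \<in> F"
    have "z * window_corr R (l - k) = (\<Sum>c\<in>?C. window R (k - c) * window R (l - c))"
      unfolding window_corr_centers[OF F \<open>k \<in> F\<close>] using z by (simp add: z_def)
    then have zL: "complex_of_real z * of_real (window_corr R (l - k)) = of_real (\<Sum>c\<in>?C. window R (k - c) * window R (l - c))"
      by (simp only: of_real_mult[symmetric])
    have "of_real z * (psi p k * (window_corr R (l - k) * ft (\<sigma> k) (l - k)) * f l * cnj (f k))
      = (of_real z * of_real (window_corr R (l - k))) * (psi p k * ft (\<sigma> k) (l - k) * f l * cnj (f k))"
      by (simp add: mult_ac)
    then show "of_real z * (psi p k * (window_corr R (l - k) * ft (\<sigma> k) (l - k)) * f l * cnj (f k))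
      = (\<Sum>c\<in>?C. psi p k * ft (\<sigma> k) (l - k) * G c l * cnj (G c k))"
      unfolding zL by (simp add: G_def sum_distrib_left sum_distrib_right mult_ac)
  qed
  also have "\<dots> = (\<Sum>c\<in>?C. \<Sum>k\<in>F. \<Sum>l\<in>F. psi p k * ft (\<sigma> k) (l - k) * G c l * cnj (G c k))"
  proof -
    have "(\<Sum>k\<in>F. \<Sum>l\<in>F. \<Sum>c\<in>?C. psi p k * ft (\<sigma> k) (l - k) * G c l * cnj (G c k))
      = (\<Sum>k\<in>F. \<Sum>c\<in>?C. \<Sum>l\<in>F. psi p k * ft (\<sigma> k) (l - k) * G c l * cnj (G c k))"
      by (intro sum.cong refl sum.swap)
    also have "\<dots> = (\<Sum>c\<in>?C. \<Sum>k\<in>F. \<Sum>l\<in>F. psi p k * ft (\<sigma> k) (l - k) * G c l * cnj (G c k))"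
      by (rule sum.swap)
    finally show ?thesis .
  qed
  finally have e: "z * Re (\<Sum>k\<in>F. \<Sum>l\<in>F. psi p k * (window_corr R (l - k) * ft (\<sigma> k) (l - k)) * f l * cnj (f k))
      = (\<Sum>c\<in>?C. Re (\<Sum>k\<in>F. \<Sum>l\<in>F. psi p k * ft (\<sigma> k) (l - k) * G c l * cnj (G c k)))"
    unfolding Re_sum[symmetric] by (rule Re_scale)
  have "z * (lo * (\<Sum>k\<in>F. psi p k * (cmod (f k))\<^sup>2) - er * ssq (F \<inter> shell p) f)
      = (\<Sum>c\<in>?C. lo * (\<Sum>k\<in>F. psi p k * (cmod (G c k))\<^sup>2) - er * ssq (F \<inter> shell p) (G c))"
  proof -
    have "(\<Sum>c\<in>?C. \<Sum>k\<in>F. psi p k * (cmod (G c k))\<^sup>2) = z * (\<Sum>k\<in>F. psi p k * (cmod (f k))\<^sup>2)"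
      unfolding sum_distrib_left by (subst sum.swap, intro sum.cong refl one)
    moreover have "(\<Sum>c\<in>?C. ssq (F \<inter> shell p) (G c)) = z * ssq (F \<inter> shell p) f"
      unfolding sum_distrib_left using one[of _ "\<lambda>_. 1"] by (subst sum.swap, intro sum.cong refl) simp
    ultimately show ?thesis
      by (simp add: sum_subtractf sum_distrib_left[symmetric] algebra_simps)
  qed
  also have "\<dots> \<le> (\<Sum>c\<in>?C. Re (\<Sum>k\<in>F. \<Sum>l\<in>F. psi p k * ft (\<sigma> k) (l - k) * G c l * cnj (G c k)))"
  proof (rule sum_mono)
    fix c
    show "lo * (\<Sum>k\<in>F. psi p k * (cmod (G c k))\<^sup>2) - er * ssq (F \<inter> shell p) (G c)
        \<le> Re (\<Sum>k\<in>F. \<Sum>l\<in>F. psi p k * ft (\<sigma> k) (l - k) * G c l * cnj (G c k))"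
      unfolding er_def
    proof (rule window_lower[OF F _ tcont _ shell osc lo bda bdc, where c = c])
      show "0 < B" using R Bdef by simp
      show "G c k = 0" if "k \<notin> qcube c B" for k
        using that by (simp add: G_def mem_qcube_diff[of k] Bdef window_eq_0)
    qed
  qed
  finally have "z * (lo * (\<Sum>k\<in>F. psi p k * (cmod (f k))\<^sup>2) - er * ssq (F \<inter> shell p) f)
      \<le> z * Re (\<Sum>k\<in>F. \<Sum>l\<in>F. psi p k * (window_corr R (l - k) * ft (\<sigma> k) (l - k)) * f l * cnj (f k))"
    unfolding e .
  then show ?thesis using z unfolding er_def by simp
qed

section \<open>Weights and sums over dyadic scales\<close>

text \<open>A product over coordinates rather than a power of the norm, so that its sum over a box
  factorises.\<close>

definition wt :: "int ^ 'n \<Rightarrow> real"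
  where "wt \<xi> = (\<Prod>j\<in>UNIV. 1 / (1 + real_of_int \<bar>\<xi> $ j\<bar>)\<^sup>2)"

lemma wt_nonneg [simp]: "0 \<le> wt \<xi>"
  unfolding wt_def by (intro prod_nonneg) simp

text \<open>Each new pair of terms is at most 2 / (N + 1) - 2 / (N + 2), so the bound
  telescopes.\<close>

lemma sum_inverse_squares: "(\<Sum>i\<in>{- int N..int N}. 1 / (1 + real_of_int \<bar>i\<bar>)\<^sup>2) \<le> 4 - 2 / (real N + 1)"
proof (induction N)
  case (Suc N)
  have "{- int (Suc N)..int (Suc N)} = insert (- int (Suc N)) (insert (int (Suc N)) {- int N..int N})"
    by auto
  then have "(\<Sum>i\<in>{- int (Suc N)..int (Suc N)}. 1 / (1 + real_of_int \<bar>i\<bar>)\<^sup>2)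
      = 2 / (real N + 2)\<^sup>2 + (\<Sum>i\<in>{- int N..int N}. 1 / (1 + real_of_int \<bar>i\<bar>)\<^sup>2)"
    by simp
  also have "2 / (real N + 2)\<^sup>2 \<le> 2 / ((real N + 1) * (real N + 2))"
    unfolding power2_eq_square by (intro divide_left_mono mult_right_mono) auto
  also have "\<dots> = 2 / (real N + 1) - 2 / (real N + 2)"
    by (simp add: divide_simps)
  finally have "(\<Sum>i\<in>{- int (Suc N)..int (Suc N)}. 1 / (1 + real_of_int \<bar>i\<bar>)\<^sup>2)
      \<le> 2 / (real N + 1) - 2 / (real N + 2) + (\<Sum>i\<in>{- int N..int N}. 1 / (1 + real_of_int \<bar>i\<bar>)\<^sup>2)"
    by simp
  moreover have "real (Suc N) + 1 = real N + 2" by simp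
  ultimately show ?case using Suc by (simp only:)
qed simp

lemma sum_wt_le:
  assumes "finite (S :: (int ^ 'n) set)"
  shows "sum wt S \<le> 4 ^ CARD('n)"
proof -
  \<comment> \<open>Size of a box that contains S.\<close>
  obtain N where N: "\<And>k j. k \<in> S \<Longrightarrow> \<bar>k $ j\<bar> \<le> int N"
  proof
    fix k j assume k: "k \<in> S"
    have "nat \<bar>k $ j\<bar> \<le> Max ((\<lambda>(k, j). nat \<bar>k $ j\<bar>) ` (S \<times> UNIV))"
      using assms k by (intro Max_ge) force+
    then show "\<bar>k $ j\<bar> \<le> int (Max ((\<lambda>(k, j). nat \<bar>k $ j\<bar>) ` (S \<times> UNIV)))" by linarith
  qed
  define T where "T = {k :: int ^ 'n. \<forall>j. k $ j \<in> {- int N..int N}}"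
  have "S \<subseteq> T"
  proof
    fix k assume "k \<in> S"
    then have "- int N \<le> k $ j \<and> k $ j \<le> int N" for j using N[of k j] by linarith
    then show "k \<in> T" by (simp add: T_def)
  qed
  moreover have "finite T" unfolding T_def by (rule finite_vec_box) simp
  ultimately have "sum wt S \<le> sum wt T"
    by (intro sum_mono2) auto
  also have "\<dots> = (\<Prod>j\<in>(UNIV :: 'n set). \<Sum>i\<in>{- int N..int N}. 1 / (1 + real_of_int \<bar>i\<bar>)\<^sup>2)"
    unfolding wt_def T_def by (rule sum_vec_box) simp
  also have "\<dots> \<le> (\<Prod>j\<in>(UNIV :: 'n set). 4)"
  proof (rule prod_mono)
    show "0 \<le> (\<Sum>i\<in>{- int N..int N}. 1 / (1 + real_of_int \<bar>i\<bar>)\<^sup>2) \<and> (\<Sum>i\<in>{- int N..int N}. 1 / (1 + real_of_int \<bar>i\<bar>)\<^sup>2) \<le> 4"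
    proof
      have "0 \<le> 2 / (real N + 1)" by simp
      then show "(\<Sum>i\<in>{- int N..int N}. 1 / (1 + real_of_int \<bar>i\<bar>)\<^sup>2) \<le> 4"
        using sum_inverse_squares[of N] by linarith
    qed (intro sum_nonneg, simp)
  qed
  finally show ?thesis by simp
qed

text \<open>Schur test: the row and column sums of the kernel are bounded, and a product of moduli
  is at most the sum of their squares.\<close>

lemma young_wt:
  fixes f g :: "int ^ 'n \<Rightarrow> complex"
  assumes F: "finite F"
  shows "(\<Sum>k\<in>F. \<Sum>l\<in>F. wt (l - k) * cmod (f l) * cmod (g k)) \<le> 4 ^ CARD('n) * (ssq F f + ssq F g)"
proof -
  have 1: "(\<Sum>k\<in>F. wt (l - k)) \<le> 4 ^ CARD('n)" for l :: "int ^ 'n"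
    using sum_wt_le[of "(\<lambda>k. l - k) ` F"] F by (simp add: sum.reindex inj_on_def)
  have 2: "(\<Sum>l\<in>F. wt (l - k)) \<le> 4 ^ CARD('n)" for k :: "int ^ 'n"
    using sum_wt_le[of "(\<lambda>l. l - k) ` F"] F by (simp add: sum.reindex inj_on_def)
  have "(\<Sum>k\<in>F. \<Sum>l\<in>F. wt (l - k) * cmod (f l) * cmod (g k))
      \<le> (\<Sum>k\<in>F. \<Sum>l\<in>F. wt (l - k) * (cmod (f l))\<^sup>2 + wt (l - k) * (cmod (g k))\<^sup>2)"
  proof (intro sum_mono)
    fix k l
    have "cmod (f l) * cmod (g k) \<le> (cmod (f l))\<^sup>2 + (cmod (g k))\<^sup>2"
      using sum_squares_bound[of "cmod (f l)" "cmod (g k)"] sum_power2_ge_zero[of "cmod (f l)" "cmod (g k)"]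
      by linarith
    from mult_left_mono[OF this wt_nonneg, of "l - k"]
    show "wt (l - k) * cmod (f l) * cmod (g k) \<le> wt (l - k) * (cmod (f l))\<^sup>2 + wt (l - k) * (cmod (g k))\<^sup>2"
      by (simp add: algebra_simps)
  qed
  also have "\<dots> = (\<Sum>l\<in>F. (\<Sum>k\<in>F. wt (l - k)) * (cmod (f l))\<^sup>2) + (\<Sum>k\<in>F. (\<Sum>l\<in>F. wt (l - k)) * (cmod (g k))\<^sup>2)"
  proof -
    have "(\<Sum>k\<in>F. \<Sum>l\<in>F. wt (l - k) * (cmod (f l))\<^sup>2) = (\<Sum>l\<in>F. \<Sum>k\<in>F. wt (l - k) * (cmod (f l))\<^sup>2)"
      by (rule sum.swap)
    then show ?thesis by (simp only: sum.distrib sum_distrib_right)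
  qed
  also have "\<dots> \<le> (\<Sum>l\<in>F. 4 ^ CARD('n) * (cmod (f l))\<^sup>2) + (\<Sum>k\<in>F. 4 ^ CARD('n) * (cmod (g k))\<^sup>2)"
    by (intro add_mono sum_mono mult_right_mono 1 2) auto
  finally show ?thesis by (simp only: sum_distrib_left ring_distribs)
qed

section \<open>Uniform constants, powers of two and the partition of unity\<close>

lemma finite_uniform_bound:
  assumes "finite A" "\<And>a. a \<in> A \<Longrightarrow> \<exists>C. Q a C" "\<And>a C C'. Q a C \<Longrightarrow> C \<le> C' \<Longrightarrow> Q a C'"
  shows "\<exists>C\<ge>(0 :: real). \<forall>a\<in>A. Q a C"
  using assms(1,2)
proof (induction A rule: finite_induct)
  case empty
  then show ?case by auto
next
  case (insert a A)
  obtain C where C: "C \<ge> 0" "\<forall>a\<in>A. Q a C" using insert by auto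
  obtain C' where C': "Q a C'" using insert by auto
  show ?case
    by (rule exI[of _ "max C C'"]) (use C C' assms(3) in \<open>auto simp: le_max_iff_disj intro: max.cobounded1 max.cobounded2\<close>)
qed

lemma order_trans_scale: "x \<le> C * b \<Longrightarrow> C \<le> C' \<Longrightarrow> 0 \<le> b \<Longrightarrow> x \<le> C' * (b :: real)"
  by (meson mult_right_mono order_trans)

lemma powr_2_unbounded:
  assumes "c > 0"
  shows "\<exists>p1. \<forall>p\<ge>p1. M \<le> 2 powr (c * real p)"
proof -
  define p1 where "p1 = nat \<lceil>log 2 (max 1 M) / c\<rceil>"
  have "M \<le> 2 powr (c * real p)" if "p \<ge> p1" for p
  proof -
    have "log 2 (max 1 M) / c \<le> real p" using that unfolding p1_def by linarith
    then have "log 2 (max 1 M) \<le> c * real p" using assms by (simp add: field_simps)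
    then have "2 powr log 2 (max 1 M) \<le> 2 powr (c * real p)" by (rule powr_mono) simp
    moreover have "2 powr log 2 (max 1 M) = max 1 M" by (rule powr_log_cancel) auto
    ultimately show ?thesis by linarith
  qed
  then show ?thesis by blast
qed

text \<open>The factor \<open>4 powr K\<close> serves all exponents in [-K, K], whatever their sign,
  so that differences of every order share one constant.\<close>

lemma shell_powr_le:
  assumes k: "k \<in> shell p" and e: "\<bar>e\<bar> \<le> K"
  shows "bracket k powr e \<le> 4 powr K * 2 powr (real p * e)"
proof -
  have b: "2 powr real p / 4 \<le> bracket k" "bracket k \<le> 4 * 2 powr real p"
    using k by (simp_all add: shell_def powr_realpow)
  have "bracket k powr e \<le> 4 powr \<bar>e\<bar> * 2 powr (real p * e)"
  proof (cases "e \<ge> 0")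
    case True
    have "bracket k powr e \<le> (4 * 2 powr real p) powr e"
      using True b bracket_pos[of k] by (intro powr_mono2) auto
    then show ?thesis using True by (simp add: powr_mult powr_powr)
  next
    case False
    have "bracket k powr e \<le> (2 powr real p / 4) powr e"
      using False b by (intro powr_mono2') auto
    also have "\<dots> = 2 powr (real p * e) / 4 powr e"
      by (simp add: powr_divide powr_powr)
    also have "\<dots> = 4 powr \<bar>e\<bar> * 2 powr (real p * e)"
      using False by (simp add: powr_minus_divide)
    finally show ?thesis .
  qed
  also have "\<dots> \<le> 4 powr K * 2 powr (real p * e)"
    using e by (intro mult_right_mono powr_mono) auto
  finally show ?thesis .
qed


lemma log_bracket_nonneg: "0 \<le> log 2 (bracket k)"
  using bracket_ge_1[of k] by simp

text \<open>Only the integer part of the logarithm and its successor contribute, and these two tents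
  add up to 1.\<close>

lemma psi_sum:
  assumes "finite A"
  shows "(\<Sum>p\<in>A. psi p k) \<le> 1"
    and "(\<And>p. \<bar>log 2 (bracket k) - real p\<bar> \<le> 1 \<Longrightarrow> p \<in> A) \<Longrightarrow> (\<Sum>p\<in>A. psi p k) = 1"
proof -
  define t where "t = log 2 (bracket k)"
  define q where "q = nat \<lfloor>t\<rfloor>"
  have t0: "0 \<le> t" unfolding t_def by (rule log_bracket_nonneg)
  have q: "real q \<le> t" "t < real q + 1" using t0 unfolding q_def by linarith+
  have psi0: "psi p k = 0" if "p \<noteq> q" "p \<noteq> Suc q" for p
  proof -
    have "p < q \<or> p > Suc q" using that by linarith
    then have "real p + 1 \<le> real q \<or> real p \<ge> real q + 2" by linarith
    then have "1 \<le> \<bar>t - real p\<bar>" using q by linarith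
    then show ?thesis by (simp add: psi_def t_def[symmetric])
  qed
  have pq: "psi q k = 1 - (t - real q)" "psi (Suc q) k = t - real q"
    using q unfolding psi_def t_def[symmetric] by (simp_all add: max_def abs_if)
  have two: "(\<Sum>p\<in>{q, Suc q}. psi p k) = 1" using pq by simp
  have "(\<Sum>p\<in>A. psi p k) = (\<Sum>p\<in>A \<inter> {q, Suc q}. psi p k)"
    using assms psi0 by (intro sum.mono_neutral_right) auto
  also have "\<dots> \<le> (\<Sum>p\<in>{q, Suc q}. psi p k)" by (intro sum_mono2) auto
  finally show "(\<Sum>p\<in>A. psi p k) \<le> 1" using two by simp
  assume *: "\<And>p. \<bar>log 2 (bracket k) - real p\<bar> \<le> 1 \<Longrightarrow> p \<in> A"
  have "q \<in> A" "Suc q \<in> A" using q by (intro *, simp add: t_def[symmetric])+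
  then have "(\<Sum>p\<in>A. psi p k) = (\<Sum>p\<in>{q, Suc q}. psi p k)"
    using assms psi0 by (intro sum.mono_neutral_right) auto
  then show "(\<Sum>p\<in>A. psi p k) = 1" using two by simp
qed

lemma finite_bracket_le: "finite {k :: int ^ 'n. bracket k \<le> b}"
proof -
  have "{k :: int ^ 'n. bracket k \<le> b} \<subseteq> {k. \<forall>j. k $ j \<in> {- \<lceil>b\<rceil>..\<lceil>b\<rceil>}}"
  proof
    fix k :: "int ^ 'n" assume "k \<in> {k. bracket k \<le> b}"
    then have "norm (lvec k) \<le> b" by (simp add: bracket_def)
    then have "\<bar>real_of_int (k $ j)\<bar> \<le> b" for j
      using component_le_norm_cart[of "lvec k" j] by simp
    then have "\<bar>k $ j\<bar> \<le> \<lceil>b\<rceil>" for j by (metis le_ceiling_iff of_int_abs le_of_int_ceiling of_int_le_iff order_trans)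
    then show "k \<in> {k. \<forall>j. k $ j \<in> {- \<lceil>b\<rceil>..\<lceil>b\<rceil>}}" by (auto simp: abs_le_iff minus_le_iff)
  qed
  then show ?thesis by (rule finite_subset) (rule finite_vec_box, simp)
qed

section \<open>Weighted sequence spaces\<close>

lemma mem_l2: "f \<in> l2 s \<longleftrightarrow> (\<lambda>k. bracket k powr (2 * s) * (cmod (f k))\<^sup>2) summable_on UNIV"
  by (simp add: l2_def)

lemma l2norm_sq: "(l2norm s f)\<^sup>2 = (\<Sum>\<^sub>\<infinity>k. bracket k powr (2 * s) * (cmod (f k))\<^sup>2)"
  unfolding l2norm_def by (intro real_sqrt_pow2 infsum_nonneg) simp

lemma l2norm_nonneg [simp]: "0 \<le> l2norm s f"
  unfolding l2norm_def by (intro real_sqrt_ge_zero infsum_nonneg) simp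

lemma sum_le_l2norm:
  assumes "f \<in> l2 s" "finite F"
  shows "(\<Sum>k\<in>F. bracket k powr (2 * s) * (cmod (f k))\<^sup>2) \<le> (l2norm s f)\<^sup>2"
  unfolding l2norm_sq using assms by (intro finite_sum_le_infsum) (auto simp: mem_l2)

lemma l2I:
  assumes "\<And>F. finite F \<Longrightarrow> (\<Sum>k\<in>F. bracket k powr (2 * s) * (cmod (f k))\<^sup>2) \<le> B"
  shows "f \<in> l2 s" "(l2norm s f)\<^sup>2 \<le> B"
proof -
  show f: "f \<in> l2 s"
    unfolding mem_l2 using assms
    by (intro nonneg_bdd_above_summable_on bdd_aboveI2[where M = B]) auto
  show "(l2norm s f)\<^sup>2 \<le> B"
    unfolding l2norm_sq using f assms by (intro infsum_le_finite_sums) (auto simp: mem_l2)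
qed

lemma l2_add:
  assumes "f \<in> l2 s" "g \<in> l2 s" shows "(\<lambda>k. f k + g k) \<in> l2 s"
proof (rule l2I)
  fix F :: "(int ^ 'a) set" assume F: "finite F"
  have "(\<Sum>k\<in>F. bracket k powr (2 * s) * (cmod (f k + g k))\<^sup>2)
      \<le> (\<Sum>k\<in>F. 2 * (bracket k powr (2 * s) * (cmod (f k))\<^sup>2) + 2 * (bracket k powr (2 * s) * (cmod (g k))\<^sup>2))"
  proof (rule sum_mono)
    fix k
    have "(cmod (f k + g k))\<^sup>2 \<le> (cmod (f k) + cmod (g k))\<^sup>2"
      by (intro power_mono norm_triangle_ineq) auto
    also have "\<dots> \<le> 2 * (cmod (f k))\<^sup>2 + 2 * (cmod (g k))\<^sup>2"
      using sum_squares_bound[of "cmod (f k)" "cmod (g k)"] by (simp add: power2_sum)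
    finally have "bracket k powr (2 * s) * (cmod (f k + g k))\<^sup>2 \<le> bracket k powr (2 * s) * (2 * (cmod (f k))\<^sup>2 + 2 * (cmod (g k))\<^sup>2)"
      by (rule mult_left_mono) simp
    then show "bracket k powr (2 * s) * (cmod (f k + g k))\<^sup>2
        \<le> 2 * (bracket k powr (2 * s) * (cmod (f k))\<^sup>2) + 2 * (bracket k powr (2 * s) * (cmod (g k))\<^sup>2)"
      by (simp add: algebra_simps)
  qed
  also have "\<dots> = 2 * (\<Sum>k\<in>F. bracket k powr (2 * s) * (cmod (f k))\<^sup>2) + 2 * (\<Sum>k\<in>F. bracket k powr (2 * s) * (cmod (g k))\<^sup>2)"
    by (simp add: sum.distrib sum_distrib_left)
  also have "\<dots> \<le> 2 * (l2norm s f)\<^sup>2 + 2 * (l2norm s g)\<^sup>2"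
    using sum_le_l2norm[OF assms(1) F] sum_le_l2norm[OF assms(2) F] by linarith
  finally show "(\<Sum>k\<in>F. bracket k powr (2 * s) * (cmod (f k + g k))\<^sup>2) \<le> \<dots>" .
qed

lemma l2_cmult: "f \<in> l2 s \<Longrightarrow> (\<lambda>k. c * f k) \<in> l2 s"
  using summable_on_cmult_right[of "\<lambda>k. bracket k powr (2 * s) * (cmod (f k))\<^sup>2" UNIV "(cmod c)\<^sup>2"]
  by (simp add: mem_l2 norm_mult power_mult_distrib mult_ac)

text \<open>Evaluation at a point is continuous, so that operators can be compared coordinate by
  coordinate in \<open>Op_ext_eq\<close>.\<close>

lemma l2_pointwise:
  assumes "f \<in> l2 s"
  shows "bracket k powr s * cmod (f k) \<le> l2norm s f"
proof (rule power2_le_imp_le)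
  have "(bracket k powr s * cmod (f k))\<^sup>2 = bracket k powr (2 * s) * (cmod (f k))\<^sup>2"
    by (simp add: power_mult_distrib powr_powr mult.commute flip: powr_realpow)
  then show "(bracket k powr s * cmod (f k))\<^sup>2 \<le> (l2norm s f)\<^sup>2"
    using sum_le_l2norm[OF assms, of "{k}"] by simp
qed simp

section \<open>Cut-offs to finite sets, tails and the duality pairing\<close>

definition cut :: "(int ^ 'n) set \<Rightarrow> (int ^ 'n \<Rightarrow> complex) \<Rightarrow> int ^ 'n \<Rightarrow> complex"
  where "cut F f k = (if k \<in> F then f k else 0)"

lemma rapidly_decreasing_restrict:
  assumes "finite F" shows "rapidly_decreasing (cut F f)"
  unfolding rapidly_decreasing_def
proof (intro allI)
  fix N :: nat
  show "\<exists>C. \<forall>k. cmod (cut F f k) \<le> C * bracket k powr - real N"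
  proof (intro exI allI)
    fix k
    show "cmod (cut F f k) \<le> (\<Sum>l\<in>F. cmod (f l) * bracket l powr real N) * bracket k powr - real N"
    proof (cases "k \<in> F")
      case True
      have "cmod (f k) * bracket k powr real N \<le> (\<Sum>l\<in>F. cmod (f l) * bracket l powr real N)"
        using assms True by (intro member_le_sum) auto
      then have "cmod (f k) * bracket k powr real N * bracket k powr - real N
          \<le> (\<Sum>l\<in>F. cmod (f l) * bracket l powr real N) * bracket k powr - real N"
        by (rule mult_right_mono) simp
      then show ?thesis using True by (simp add: cut_def mult.assoc flip: powr_add)
    qed (simp add: cut_def sum_nonneg)
  qed
qed

lemma l2_restrict_Compl:
  assumes "f \<in> l2 s"
  shows "cut (- F) f \<in> l2 s"
    and "finite F \<Longrightarrow> (l2norm s (cut (- F) f))\<^sup>2 = (l2norm s f)\<^sup>2 - (\<Sum>k\<in>F. bracket k powr (2 * s) * (cmod (f k))\<^sup>2)"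
proof -
  let ?w = "\<lambda>k. bracket k powr (2 * s) * (cmod (f k))\<^sup>2"
  have w: "?w summable_on UNIV" using assms by (simp add: mem_l2)
  have r: "bracket k powr (2 * s) * (cmod (cut (- F) f k))\<^sup>2 = (if k \<in> - F then ?w k else 0)" for k
    by (simp add: cut_def)
  have "?w summable_on (- F)" using w summable_on_subset_banach by blast
  then have "(\<lambda>k. if k \<in> - F then ?w k else 0) summable_on UNIV"
    by (subst summable_on_cong_neutral[where T = "- F" and g = ?w]) auto
  then show "cut (- F) f \<in> l2 s" unfolding mem_l2 r .
  assume F: "finite F"
  have "(\<Sum>\<^sub>\<infinity>k. if k \<in> - F then ?w k else 0) = infsum ?w (- F)"
    by (rule infsum_cong_neutral) auto
  also have "\<dots> = infsum ?w UNIV - infsum ?w F"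
    using infsum_Diff[OF w, of F] F by (simp add: Compl_eq_Diff_UNIV)
  finally show "(l2norm s (cut (- F) f))\<^sup>2 = (l2norm s f)\<^sup>2 - (\<Sum>k\<in>F. ?w k)"
    unfolding l2norm_sq r using F by simp
qed

text \<open>The squared norm of the tail is the full one minus a partial sum. This is the density of
  finitely supported sequences in the form in which both limits below use it.\<close>

lemma l2norm_tail:
  assumes "f \<in> l2 s"
  shows "((\<lambda>F. l2norm s (cut (- F) f)) \<longlongrightarrow> 0) (finite_subsets_at_top UNIV)"
proof -
  let ?w = "\<lambda>k. bracket k powr (2 * s) * (cmod (f k))\<^sup>2"
  have "((\<lambda>F. sum ?w F) \<longlongrightarrow> (l2norm s f)\<^sup>2) (finite_subsets_at_top UNIV)"
    unfolding l2norm_sq using assms by (intro infsum_tendsto) (simp add: mem_l2)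
  then have "((\<lambda>F. sqrt ((l2norm s f)\<^sup>2 - sum ?w F)) \<longlongrightarrow> sqrt ((l2norm s f)\<^sup>2 - (l2norm s f)\<^sup>2)) (finite_subsets_at_top UNIV)"
    by (intro tendsto_intros)
  moreover have "\<forall>\<^sub>F F in finite_subsets_at_top UNIV. sqrt ((l2norm s f)\<^sup>2 - sum ?w F) = l2norm s (cut (- F) f)"
  proof (rule eventually_finite_subsets_at_top_weakI)
    fix F :: "(int ^ 'a) set" assume "finite F"
    then show "sqrt ((l2norm s f)\<^sup>2 - sum ?w F) = l2norm s (cut (- F) f)"
      using l2_restrict_Compl(2)[OF assms, of F] by (metis l2norm_nonneg real_sqrt_unique)
  qed
  ultimately show ?thesis using tendsto_cong by fastforce
qed

text \<open>Cauchy-Schwarz after inserting \<open>bracket k powr (- s)\<close> and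
  \<open>bracket k powr s\<close>.\<close>

lemma sum_pairing_le:
  assumes f: "f \<in> l2 s" and g: "g \<in> l2 (- s)" and F: "finite F"
  shows "(\<Sum>k\<in>F. cmod (g k) * cmod (f k)) \<le> l2norm (- s) g * l2norm s f"
proof -
  have "(\<Sum>k\<in>F. cmod (g k) * cmod (f k)) = (\<Sum>k\<in>F. \<bar>bracket k powr (- s) * cmod (g k)\<bar> * \<bar>bracket k powr s * cmod (f k)\<bar>)"
  proof (rule sum.cong[OF refl])
    fix k :: "int ^ 'a"
    have "bracket k powr (- s) * bracket k powr s = 1" by (simp flip: powr_add)
    then show "cmod (g k) * cmod (f k) = \<bar>bracket k powr (- s) * cmod (g k)\<bar> * \<bar>bracket k powr s * cmod (f k)\<bar>"
      by (simp add: abs_mult mult_ac)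
  qed
  also have "\<dots> \<le> L2_set (\<lambda>k. bracket k powr (- s) * cmod (g k)) F * L2_set (\<lambda>k. bracket k powr s * cmod (f k)) F"
    by (rule L2_set_mult_ineq)
  also have "\<dots> \<le> l2norm (- s) g * l2norm s f"
  proof (intro mult_mono)
    have *: "L2_set (\<lambda>k. bracket k powr t * cmod (h k)) F \<le> l2norm t h" if "h \<in> l2 t" for t h
    proof -
      have "(bracket k powr t * cmod (h k))\<^sup>2 = bracket k powr (2 * t) * (cmod (h k))\<^sup>2" for k
        by (simp add: power_mult_distrib powr_powr mult.commute flip: powr_realpow)
      then have "(\<Sum>k\<in>F. (bracket k powr t * cmod (h k))\<^sup>2) \<le> (l2norm t h)\<^sup>2"
        using sum_le_l2norm[OF that F] by simp
      then show ?thesis unfolding L2_set_def by (intro real_le_lsqrt) (auto simp: sum_nonneg)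
    qed
    show "L2_set (\<lambda>k. bracket k powr (- s) * cmod (g k)) F \<le> l2norm (- s) g" by (rule *[OF g])
    show "L2_set (\<lambda>k. bracket k powr s * cmod (f k)) F \<le> l2norm s f" by (rule *[OF f])
  qed auto
  finally show ?thesis .
qed

lemma pairing_summable:
  assumes f: "f \<in> l2 s" and g: "g \<in> l2 (- s)"
  shows "(\<lambda>k. g k * cnj (f k)) summable_on UNIV"
proof (rule abs_summable_summable, rule nonneg_bdd_above_summable_on)
  show "bdd_above (sum (\<lambda>k. norm (g k * cnj (f k))) ` {F. F \<subseteq> UNIV \<and> finite F})"
    using sum_pairing_le[OF f g] by (intro bdd_aboveI2[where M = "l2norm (- s) g * l2norm s f"]) (auto simp: norm_mult)
qed simp

section \<open>Rapid decay and the matrix of the operator\<close>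

lemma wt_summable: "(wt :: int ^ 'n \<Rightarrow> real) summable_on UNIV"
  using sum_wt_le[where 'n = 'n]
  by (intro nonneg_bdd_above_summable_on bdd_aboveI2[where M = "4 ^ CARD('n)"]) auto

text \<open>Two powers of the bracket are spent on each coordinate, since the bracket dominates 1
  plus the modulus of that coordinate.\<close>

lemma bracket_powr_le_wt: "bracket (k :: int ^ 'n) powr (- (2 * real CARD('n))) \<le> wt k"
proof -
  have "bracket k powr (- (2 * real CARD('n))) = 1 / bracket k ^ (2 * CARD('n))"
    using powr_realpow[OF bracket_pos[of k], of "2 * CARD('n)"] by (simp add: powr_minus_divide)
  also have "\<dots> = (\<Prod>j\<in>(UNIV :: 'n set). 1 / (bracket k)\<^sup>2)"
    by (simp add: power_mult power_divide)
  also have "\<dots> \<le> wt k"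
    unfolding wt_def
  proof (rule prod_mono)
    fix j
    have "1 + real_of_int \<bar>k $ j\<bar> \<le> bracket k"
      using component_le_norm_cart[of "lvec k" j] by (simp add: bracket_def)
    then have "(1 + real_of_int \<bar>k $ j\<bar>)\<^sup>2 \<le> (bracket k)\<^sup>2" by (intro power_mono) auto
    moreover have "0 < (1 + real_of_int \<bar>k $ j\<bar>)\<^sup>2" by (intro zero_less_power) linarith
    ultimately show "0 \<le> 1 / (bracket k)\<^sup>2 \<and> 1 / (bracket k)\<^sup>2 \<le> 1 / (1 + real_of_int \<bar>k $ j\<bar>)\<^sup>2"
      by (intro conjI divide_left_mono mult_pos_pos) auto
  qed
  finally show ?thesis .
qed

lemma rapidly_decreasing_weighted:
  assumes "rapidly_decreasing (f :: int ^ 'n \<Rightarrow> complex)"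
  obtains C where "\<And>k. bracket k powr s * cmod (f k) \<le> C * wt k" "0 \<le> C"
proof -
  obtain N :: nat where N: "s + 2 * real CARD('n) \<le> real N" using real_arch_simple by blast
  obtain C where C: "\<And>k. cmod (f k) \<le> C * bracket k powr (- real N)"
    using assms by (auto simp: rapidly_decreasing_def)
  have C0: "0 \<le> C"
    using order_trans[OF norm_ge_zero C[of 0]] by (simp add: zero_le_mult_iff)
  have "bracket k powr s * cmod (f k) \<le> C * wt k" for k
  proof -
    have "bracket k powr s * cmod (f k) \<le> bracket k powr s * (C * bracket k powr (- real N))"
      by (intro mult_left_mono C) simp
    also have "\<dots> = C * bracket k powr (s - real N)" by (simp add: mult_ac flip: powr_add)
    also have "\<dots> \<le> C * bracket k powr (- (2 * real CARD('n)))"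
      using N C0 bracket_ge_1 by (intro mult_left_mono powr_mono) auto
    also have "\<dots> \<le> C * wt k" by (intro mult_left_mono bracket_powr_le_wt C0)
    finally show ?thesis .
  qed
  then show ?thesis using that C0 by blast
qed

lemma wt_le_1: "wt k \<le> 1"
proof -
  have "(1 :: real) \<le> (1 + real_of_int \<bar>k $ j\<bar>)\<^sup>2" for j by (intro one_le_power) simp
  then show ?thesis unfolding wt_def by (intro prod_le_1) (auto simp: divide_le_eq_1)
qed

lemma rapidly_decreasing_l2:
  assumes "rapidly_decreasing (f :: int ^ 'n \<Rightarrow> complex)"
  shows "f \<in> l2 s"
proof -
  obtain C where C: "\<And>k. bracket k powr s * cmod (f k) \<le> C * wt k" "0 \<le> C"
    using rapidly_decreasing_weighted[OF assms] by blast
  show ?thesis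
  proof (rule l2I(1))
    fix F :: "(int ^ 'n) set" assume F: "finite F"
    have "(\<Sum>k\<in>F. bracket k powr (2 * s) * (cmod (f k))\<^sup>2) \<le> (\<Sum>k\<in>F. C\<^sup>2 * wt k)"
    proof (rule sum_mono)
      fix k
      have "bracket k powr (2 * s) * (cmod (f k))\<^sup>2 = (bracket k powr s * cmod (f k))\<^sup>2"
        by (simp add: power_mult_distrib powr_powr mult.commute flip: powr_realpow)
      also have "\<dots> \<le> (C * wt k)\<^sup>2" by (intro power_mono C) simp
      also have "\<dots> = C\<^sup>2 * (wt k * wt k)" by (simp add: power2_eq_square)
      also have "\<dots> \<le> C\<^sup>2 * wt k" using wt_le_1[of k] by (intro mult_left_mono) (auto simp: mult_left_le)
      finally show "bracket k powr (2 * s) * (cmod (f k))\<^sup>2 \<le> C\<^sup>2 * wt k" .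
    qed
    also have "\<dots> \<le> C\<^sup>2 * 4 ^ CARD('n)"
      unfolding sum_distrib_left[symmetric] by (intro mult_left_mono sum_wt_le F) simp
    finally show "(\<Sum>k\<in>F. bracket k powr (2 * s) * (cmod (f k))\<^sup>2) \<le> C\<^sup>2 * 4 ^ CARD('n)" .
  qed
qed

text \<open>The Fourier series of f converges uniformly by the Weierstrass test, so it may be
  integrated term by term against the character and the symbol.\<close>

lemma Op_has_sum:
  fixes \<sigma> :: "int ^ 'n \<Rightarrow> real ^ 'n \<Rightarrow> complex"
  assumes f: "rapidly_decreasing f" and tcont: "tcont (\<sigma> k)" and bd: "\<And>x. cmod (\<sigma> k x) \<le> H"
  shows "((\<lambda>l. ft (\<sigma> k) (l - k) * f l) has_sum Op \<sigma> f k) UNIV"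
proof -
  obtain C where C: "\<And>k. bracket k powr 0 * cmod (f k) \<le> C * wt k"
    using rapidly_decreasing_weighted[OF f] by blast
  have abs: "(\<lambda>l. cmod (f l)) summable_on UNIV"
  proof (rule summable_on_comparison_test[OF summable_on_cmult_right[OF wt_summable, of C]])
    show "cmod (f l) \<le> C * wt l" for l using C[of l] by simp
  qed auto
  let ?t = "\<lambda>l x. ch k x * \<sigma> k x * (cnj (ch l x) * f l)"
  let ?G = "\<lambda>x. \<Sum>\<^sub>\<infinity>l. ?t l x"
  have H0: "0 \<le> H" using order_trans[OF norm_ge_zero bd] .
  have U: "uniform_limit (cbox 0 1) (\<lambda>F x. \<Sum>l\<in>F. ?t l x) ?G (finite_subsets_at_top UNIV)"
  proof (rule Weierstrass_m_test_general)
    show "cmod (?t l x) \<le> H * cmod (f l)" for l x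
      using bd[of x] by (simp add: norm_mult mult_right_mono)
    show "(\<lambda>l. H * cmod (f l)) summable_on UNIV" by (rule summable_on_cmult_right[OF abs])
  qed
  have pt: "tcont (?t l)" for l using tcont by auto
  have cont: "continuous_on (cbox 0 1) (\<lambda>x. \<Sum>l\<in>F. ?t l x)" for F
    by (intro tcont_cont tcont_sum pt)
  have cG: "continuous_on (cbox 0 1) ?G"
    by (rule uniform_limit_theorem[OF _ U]) (auto simp: cont)
  have eG: "exp (2 * of_real pi * \<i> * of_real (lvec k \<bullet> x)) * \<sigma> k x * fourier f x = ?G x" for x
  proof -
    have "exp (- (2 * of_real pi * \<i> * of_real (lvec l \<bullet> x))) = cnj (ch l x)" for l
      unfolding ch_minus[symmetric] by (simp add: ch_def)
    then have "fourier f x = (\<Sum>\<^sub>\<infinity>l. cnj (ch l x) * f l)" by (simp add: fourier_def)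
    then show ?thesis by (simp add: infsum_cmult_right' ch_def[symmetric])
  qed
  have "Op \<sigma> f k = (LINT x:cbox 0 1|lborel. ?G x)"
    unfolding Op_def eG ..
  also have "\<dots> = integral (cbox 0 1) ?G"
    by (rule set_borel_integral_eq_integral(2))
      (simp add: set_integrable_def borel_integrable_compact[OF compact_cbox cG])
  finally have Op: "Op \<sigma> f k = integral (cbox 0 1) ?G" .
  obtain I J where IJ: "\<And>F. ((\<lambda>x. \<Sum>l\<in>F. ?t l x) has_integral I F) (cbox 0 1)"
    "(?G has_integral J) (cbox 0 1)" "(I \<longlongrightarrow> J) (finite_subsets_at_top UNIV)"
    using uniform_limit_integral_cbox[OF U cont] by auto
  have J: "J = Op \<sigma> f k" using IJ(2) Op by (simp add: integral_unique)
  have "\<forall>\<^sub>F F in finite_subsets_at_top UNIV. I F = (\<Sum>l\<in>F. ft (\<sigma> k) (l - k) * f l)"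
  proof (rule eventually_finite_subsets_at_top_weakI)
    fix F :: "(int ^ 'n) set" assume F: "finite F"
    have "I F = torus_int (\<lambda>x. \<Sum>l\<in>F. ?t l x)" using IJ(1)[of F] by (simp add: integral_unique)
    also have "\<dots> = (\<Sum>l\<in>F. torus_int (?t l))" by (rule torus_int_sum[OF F pt])
    also have "\<dots> = (\<Sum>l\<in>F. ft (\<sigma> k) (l - k) * f l)"
    proof (rule sum.cong[OF refl])
      fix l
      have "?t l = (\<lambda>x. f l * (ch (- (l - k)) x * \<sigma> k x))"
        by (simp add: ch_diff mult_ac)
      then show "torus_int (?t l) = ft (\<sigma> k) (l - k) * f l" by (simp add: ft_def)
    qed
    finally show "I F = (\<Sum>l\<in>F. ft (\<sigma> k) (l - k) * f l)" .
  qed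
  then show ?thesis
    unfolding has_sum_def using IJ(3) J tendsto_cong by fastforce
qed

section \<open>Symbol estimates on a shell\<close>

locale torus_symbol =
  fixes \<sigma> :: "int ^ 'n \<Rightarrow> real ^ 'n \<Rightarrow> complex" and m \<rho> \<delta> :: real
  assumes delta0: "0 \<le> \<delta>" and delta_rho: "\<delta> < \<rho>" and rho1: "\<rho> \<le> 1" and m0: "0 < m"
    and sym: "\<sigma> \<in> symbol_class (2 * m) \<rho> \<delta>"
begin

definition \<tau> where "\<tau> = (\<delta> + \<rho>) / 2"
definition \<kappa> where "\<kappa> = (\<rho> - \<delta>) / 2"

lemma exponents: "0 < \<kappa>" "\<delta> = \<tau> - \<kappa>" "\<rho> = \<tau> + \<kappa>" "0 < \<tau>" "\<tau> < 1" "\<kappa> \<le> 1 - \<tau>"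
  using delta0 delta_rho rho1 by (auto simp: \<tau>_def \<kappa>_def field_simps)

abbreviation "entry k l \<equiv> ft (\<sigma> k) (l - k)"

lemma smooth: "smooth_torus (\<sigma> k)"
  using sym by (simp add: symbol_class_def)

lemma tcont_symbol: "tcont (\<sigma> k)"
  by (rule smooth_torus_per[OF smooth])

lemma symbol_estimate: "\<exists>C. \<forall>k x. cmod (mD_op \<beta> (\<lambda>y. mdiff_op \<alpha> (\<lambda>l. \<sigma> l y) k) x)
    \<le> C * bracket k powr (2 * m - \<rho> * real (mlen \<alpha>) + \<delta> * real (mlen \<beta>))"
  using sym by (simp add: symbol_class_def)

text \<open>Only multi-indices with entries 0 and 1 and first derivatives in x enter near the
  diagonal. They are finitely many, so one constant serves all.\<close>

lemma difference_bounds: "\<exists>C\<ge>0. \<forall>\<alpha>\<in>{\<alpha>. \<forall>j. \<alpha> $ j \<in> {..1}}. \<forall>k x.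
    cmod (mdiff_op \<alpha> (\<lambda>l. \<sigma> l x) k) \<le> C * bracket k powr (2 * m - \<rho> * real (mlen \<alpha>)) \<and>
    (\<forall>j. cmod (pderiv_op j (\<lambda>y. mdiff_op \<alpha> (\<lambda>l. \<sigma> l y) k) x)
      \<le> C * bracket k powr (2 * m - \<rho> * real (mlen \<alpha>) + \<delta>))"
proof (rule finite_uniform_bound)
  show "finite {\<alpha> :: nat ^ 'n. \<forall>j. \<alpha> $ j \<in> {..1}}" by (rule finite_vec_box) simp
next
  fix \<alpha> :: "nat ^ 'n"
  \<comment> \<open>A multi-index of order 0 gives the identity in whatever coordinate it is
    placed.\<close>
  obtain C0 where C0: "\<And>k x. cmod (mdiff_op \<alpha> (\<lambda>l. \<sigma> l x) k) \<le> C0 * bracket k powr (2 * m - \<rho> * real (mlen \<alpha>))"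
    using symbol_estimate[of "single_index undefined 0" \<alpha>] by (auto simp: mD_op_sidx)
  have "\<exists>C\<ge>0. \<forall>j\<in>UNIV. \<forall>k x. cmod (pderiv_op j (\<lambda>y. mdiff_op \<alpha> (\<lambda>l. \<sigma> l y) k) x)
      \<le> C * bracket k powr (2 * m - \<rho> * real (mlen \<alpha>) + \<delta>)"
  proof (rule finite_uniform_bound)
    fix j :: 'n
    obtain C where C: "\<And>k x. cmod (D_op j 1 (\<lambda>y. mdiff_op \<alpha> (\<lambda>l. \<sigma> l y) k) x)
        \<le> C * bracket k powr (2 * m - \<rho> * real (mlen \<alpha>) + \<delta>)"
      using symbol_estimate[of "single_index j 1" \<alpha>] by (auto simp: mD_op_sidx simp del: D_op.simps)
    show "\<exists>C. \<forall>k x. cmod (pderiv_op j (\<lambda>y. mdiff_op \<alpha> (\<lambda>l. \<sigma> l y) k) x)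
        \<le> C * bracket k powr (2 * m - \<rho> * real (mlen \<alpha>) + \<delta>)"
    proof (intro exI allI)
      fix k x
      have "cmod (pderiv_op j (\<lambda>y. mdiff_op \<alpha> (\<lambda>l. \<sigma> l y) k) x)
          = 2 * pi * cmod (D_op j 1 (\<lambda>y. mdiff_op \<alpha> (\<lambda>l. \<sigma> l y) k) x)"
        by (simp add: norm_divide norm_mult)
      also have "\<dots> \<le> 2 * pi * (C * bracket k powr (2 * m - \<rho> * real (mlen \<alpha>) + \<delta>))"
        by (intro mult_left_mono C) simp
      finally show "cmod (pderiv_op j (\<lambda>y. mdiff_op \<alpha> (\<lambda>l. \<sigma> l y) k) x)
          \<le> (2 * pi * C) * bracket k powr (2 * m - \<rho> * real (mlen \<alpha>) + \<delta>)" by (simp add: mult_ac)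
    qed
  qed (simp, blast intro: order_trans_scale[OF _ _ powr_ge_zero])
  then obtain C1 where C1: "\<And>j k x. cmod (pderiv_op j (\<lambda>y. mdiff_op \<alpha> (\<lambda>l. \<sigma> l y) k) x)
      \<le> C1 * bracket k powr (2 * m - \<rho> * real (mlen \<alpha>) + \<delta>)" by auto
  show "\<exists>C. \<forall>k x. cmod (mdiff_op \<alpha> (\<lambda>l. \<sigma> l x) k) \<le> C * bracket k powr (2 * m - \<rho> * real (mlen \<alpha>)) \<and>
    (\<forall>j. cmod (pderiv_op j (\<lambda>y. mdiff_op \<alpha> (\<lambda>l. \<sigma> l y) k) x)
      \<le> C * bracket k powr (2 * m - \<rho> * real (mlen \<alpha>) + \<delta>))"
    by (rule exI[of _ "max C0 C1"])
      (auto intro!: order_trans[OF C0] order_trans[OF C1] mult_right_mono)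
next
  fix \<alpha> :: "nat ^ 'n" and C C' :: real
  assume *: "\<forall>k x. cmod (mdiff_op \<alpha> (\<lambda>l. \<sigma> l x) k) \<le> C * bracket k powr (2 * m - \<rho> * real (mlen \<alpha>)) \<and>
    (\<forall>j. cmod (pderiv_op j (\<lambda>y. mdiff_op \<alpha> (\<lambda>l. \<sigma> l y) k) x)
      \<le> C * bracket k powr (2 * m - \<rho> * real (mlen \<alpha>) + \<delta>))" and "C \<le> C'"
  then have "C * bracket k powr e \<le> C' * bracket k powr e" for k :: "int ^ 'n" and e
    by (intro mult_right_mono) auto
  then show "\<forall>k x. cmod (mdiff_op \<alpha> (\<lambda>l. \<sigma> l x) k) \<le> C' * bracket k powr (2 * m - \<rho> * real (mlen \<alpha>)) \<and>
    (\<forall>j. cmod (pderiv_op j (\<lambda>y. mdiff_op \<alpha> (\<lambda>l. \<sigma> l y) k) x)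
      \<le> C' * bracket k powr (2 * m - \<rho> * real (mlen \<alpha>) + \<delta>))"
    using * by (meson order_trans)
qed

definition symbol_const where "symbol_const = (SOME C. C \<ge> 0 \<and> (\<forall>\<alpha>\<in>{\<alpha>. \<forall>j. \<alpha> $ j \<in> {..1}}. \<forall>k x.
    cmod (mdiff_op \<alpha> (\<lambda>l. \<sigma> l x) k) \<le> C * bracket k powr (2 * m - \<rho> * real (mlen \<alpha>)) \<and>
    (\<forall>j. cmod (pderiv_op j (\<lambda>y. mdiff_op \<alpha> (\<lambda>l. \<sigma> l y) k) x)
      \<le> C * bracket k powr (2 * m - \<rho> * real (mlen \<alpha>) + \<delta>))))"

lemma symbol_const: "0 \<le> symbol_const"
  "(\<And>j. \<alpha> $ j \<le> 1) \<Longrightarrow> cmod (mdiff_op \<alpha> (\<lambda>l. \<sigma> l x) k) \<le> symbol_const * bracket k powr (2 * m - \<rho> * real (mlen \<alpha>))"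
  "(\<And>j. \<alpha> $ j \<le> 1) \<Longrightarrow> cmod (pderiv_op j (\<lambda>y. mdiff_op \<alpha> (\<lambda>l. \<sigma> l y) k) x)
      \<le> symbol_const * bracket k powr (2 * m - \<rho> * real (mlen \<alpha>) + \<delta>)"
  using someI_ex[OF difference_bounds, folded symbol_const_def] by auto

lemma symbol_bound: "cmod (\<sigma> k x) \<le> symbol_const * bracket k powr (2 * m)"
  using symbol_const(2)[of 0 x k] by simp

text \<open>The window of this radius lives on cubes of side \<open>2 * radius p\<close>. The
  integer part is within a factor 2 of the power, which is at least 1.\<close>

definition radius :: "nat \<Rightarrow> nat" where "radius p = nat \<lfloor>2 powr (\<tau> * real p)\<rfloor>"

lemma radius: "1 \<le> radius p" "real (radius p) \<le> 2 powr (\<tau> * real p)" "2 powr (\<tau> * real p) \<le> 2 * real (radius p)"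
proof -
  have "1 \<le> 2 powr (\<tau> * real p)" using exponents by (simp add: ge_one_powr_ge_zero)
  then have "1 \<le> \<lfloor>2 powr (\<tau> * real p)\<rfloor>" by simp
  then have r: "real (radius p) = of_int \<lfloor>2 powr (\<tau> * real p)\<rfloor>" "1 \<le> radius p"
    unfolding radius_def by linarith+
  then show "1 \<le> radius p" by simp
  show "real (radius p) \<le> 2 powr (\<tau> * real p)" unfolding r by simp
  have "2 powr (\<tau> * real p) < real (radius p) + 1" unfolding r by linarith
  then show "2 powr (\<tau> * real p) \<le> 2 * real (radius p)" using r(2) by linarith
qed

text \<open>Over the allowed distance the bracket changes by a multiple of L^\<tau>, with L = 2^p;
  since \<tau> < 1, this is at most L / 4 for large p.\<close>

lemma near_shell: "\<exists>p1. \<forall>p\<ge>p1. \<forall>(k :: int ^ 'n) l. psi p k \<noteq> 0 \<longrightarrow>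
    (\<forall>j. \<bar>k $ j - l $ j\<bar> \<le> 2 * int (2 * radius p)) \<longrightarrow> l \<in> shell p"
proof -
  obtain p1 where p1: "\<And>p. p \<ge> p1 \<Longrightarrow> 16 * real CARD('n) \<le> 2 powr ((1 - \<tau>) * real p)"
    using powr_2_unbounded[of "1 - \<tau>"] exponents by auto
  show ?thesis
  proof (intro exI[of _ p1] allI impI)
    fix p and k l :: "int ^ 'n"
    assume p: "p1 \<le> p" and k: "psi p k \<noteq> 0" and near: "\<forall>j. \<bar>k $ j - l $ j\<bar> \<le> 2 * int (2 * radius p)"
    have "norm (lvec (k - l)) \<le> real CARD('n) * (4 * real (radius p))"
    proof (rule norm_lvec_le)
      fix j
      have "real_of_int \<bar>k $ j - l $ j\<bar> \<le> real_of_int (2 * int (2 * radius p))"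
        using near by (simp only: of_int_le_iff)
      then show "\<bar>real_of_int ((k - l) $ j)\<bar> \<le> 4 * real (radius p)" by simp
    qed
    also have "\<dots> \<le> real CARD('n) * (4 * 2 powr (\<tau> * real p))"
      using radius(2)[of p] by (intro mult_left_mono) auto
    also have "\<dots> \<le> 2 ^ p / 4"
    proof -
      have "16 * real CARD('n) * 2 powr (\<tau> * real p) \<le> 2 powr ((1 - \<tau>) * real p) * 2 powr (\<tau> * real p)"
        by (intro mult_right_mono p1 p) simp
      also have "\<dots> = 2 ^ p" by (simp flip: powr_add add: algebra_simps powr_realpow)
      finally show ?thesis by simp
    qed
    finally have d: "\<bar>bracket k - bracket l\<bar> \<le> 2 ^ p / 4"
      using bracket_diff[of k l] by linarith
    have pp: "(0 :: real) < 2 ^ p" by simp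
    show "l \<in> shell p"
      unfolding shell_def mem_Collect_eq
      using d psi_pos_bracket[OF k] pp by (simp only: abs_le_iff) (intro conjI; linarith)
  qed
qed

lemma mlen_le: "(\<And>j. (\<alpha> :: nat ^ 'n) $ j \<le> 1) \<Longrightarrow> mlen \<alpha> \<le> CARD('n)"
  unfolding mlen_def using sum_mono[of UNIV "\<lambda>j. \<alpha> $ j" "\<lambda>_. 1"] by simp

text \<open>Here \<tau> < \<rho> enters: crossing the cube in one direction costs its side, the
  difference gains L^(-\<rho>), and L^(-\<kappa>) is left for each difference.\<close>

lemma side_powr:
  assumes "\<And>j. (\<alpha> :: nat ^ 'n) $ j \<le> 1"
  shows "real (2 * radius p) ^ mlen \<alpha> * 2 powr (- \<rho> * real p * real (mlen \<alpha>))
    \<le> 2 ^ CARD('n) * 2 powr (- \<kappa> * real p * real (mlen \<alpha>))"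
proof -
  let ?a = "mlen \<alpha>"
  have "real (2 * radius p) ^ ?a \<le> (2 * 2 powr (\<tau> * real p)) ^ ?a"
    using radius(2)[of p] by (intro power_mono) auto
  also have "\<dots> = 2 ^ ?a * 2 powr (\<tau> * real p * real ?a)"
    by (simp add: power_mult_distrib powr_powr flip: powr_realpow)
  also have "\<dots> \<le> 2 ^ CARD('n) * 2 powr (\<tau> * real p * real ?a)"
    using mlen_le[OF assms] by (intro mult_right_mono power_increasing) auto
  finally have "real (2 * radius p) ^ ?a * 2 powr (- \<rho> * real p * real ?a)
      \<le> 2 ^ CARD('n) * 2 powr (\<tau> * real p * real ?a) * 2 powr (- \<rho> * real p * real ?a)"
    by (rule mult_right_mono) simp
  also have "\<dots> = 2 ^ CARD('n) * 2 powr (\<tau> * real p * real ?a + - \<rho> * real p * real ?a)"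
    by (simp only: powr_add mult.assoc)
  also have "\<tau> * real p * real ?a + - \<rho> * real p * real ?a = - \<kappa> * real p * real ?a"
    by (subst exponents(3)) (simp add: algebra_simps)
  finally show ?thesis .
qed

text \<open>K dominates the modulus of every exponent in \<open>exponent_range\<close>. Below,
  \<open>M p\<close> is the size of the symbol on the shell and \<open>gain p\<close> the relative
  size of the errors.\<close>

definition K where "K = 2 * m + real CARD('n) + 1"
definition shell_const where "shell_const = symbol_const * 4 powr K * 2 ^ CARD('n)"
definition M where "M p = 2 powr (2 * m * real p)"
definition gain where "gain p = 2 powr (- \<kappa> * real p)"

lemma shell_const_nonneg: "0 \<le> shell_const" using symbol_const(1) by (simp add: shell_const_def)
lemma M_pos: "0 < M p" by (simp add: M_def)
lemma gain_pos: "0 < gain p" by (simp add: gain_def)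

lemma exponent_range:
  assumes "\<And>j. (\<alpha> :: nat ^ 'n) $ j \<le> 1"
  shows "\<bar>2 * m - \<rho> * real (mlen \<alpha>)\<bar> \<le> K" "\<bar>2 * m - \<rho> * real (mlen \<alpha>) + \<delta>\<bar> \<le> K"
proof -
  have "\<rho> * real (mlen \<alpha>) \<le> 1 * real CARD('n)"
    using mlen_le[OF assms] rho1 delta0 delta_rho by (intro mult_mono) auto
  moreover have "0 \<le> \<rho> * real (mlen \<alpha>)" using delta0 delta_rho by simp
  ultimately show "\<bar>2 * m - \<rho> * real (mlen \<alpha>)\<bar> \<le> K" "\<bar>2 * m - \<rho> * real (mlen \<alpha>) + \<delta>\<bar> \<le> K"
    unfolding K_def using m0 delta0 delta_rho rho1 by linarith+
qed

text \<open>\<theta> is 0 for the symbol itself and \<delta> for a first derivative in x.\<close>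

lemma shell_bound:
  assumes a: "\<And>j. (\<alpha> :: nat ^ 'n) $ j \<le> 1" and k: "k \<in> shell p"
    and e: "\<bar>2 * m - \<rho> * real (mlen \<alpha>) + \<theta>\<bar> \<le> K"
  shows "symbol_const * bracket k powr (2 * m - \<rho> * real (mlen \<alpha>) + \<theta>)
    \<le> shell_const * M p * 2 powr (\<theta> * real p) * 2 powr (- \<kappa> * real p * real (mlen \<alpha>)) / real (2 * radius p) ^ mlen \<alpha>"
proof -
  let ?a = "mlen \<alpha>"
  have B: "0 < real (2 * radius p) ^ ?a" using radius(1)[of p] by simp
  have "symbol_const * bracket k powr (2 * m - \<rho> * real ?a + \<theta>) \<le> symbol_const * (4 powr K * 2 powr (real p * (2 * m - \<rho> * real ?a + \<theta>)))"
    by (intro mult_left_mono shell_powr_le k e symbol_const(1))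
  also have "real p * (2 * m - \<rho> * real ?a + \<theta>) = 2 * m * real p + (\<theta> * real p + - \<rho> * real p * real ?a)"
    by (simp add: algebra_simps)
  also have "2 powr \<dots> = M p * (2 powr (\<theta> * real p) * 2 powr (- \<rho> * real p * real ?a))"
    by (simp only: powr_add M_def)
  also have "2 powr (- \<rho> * real p * real ?a)
      \<le> 2 ^ CARD('n) * 2 powr (- \<kappa> * real p * real ?a) / real (2 * radius p) ^ ?a"
    using side_powr[OF a, of p] B by (simp add: pos_le_divide_eq mult.commute)
  also have "symbol_const * (4 powr K * (M p * (2 powr (\<theta> * real p) *
      (2 ^ CARD('n) * 2 powr (- \<kappa> * real p * real ?a) / real (2 * radius p) ^ ?a))))
      = shell_const * M p * 2 powr (\<theta> * real p) * 2 powr (- \<kappa> * real p * real ?a) / real (2 * radius p) ^ ?a"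
    by (simp add: shell_const_def mult_ac)
  finally show ?thesis using symbol_const(1) by (auto simp: mult_left_mono M_def)
qed


lemma exponents_mult: "\<delta> * x + \<kappa> * x = \<tau> * x"
proof -
  have "\<delta> + \<kappa> = \<tau>" using exponents(2) by linarith
  then show ?thesis by (simp only: distrib_right[symmetric])
qed

text \<open>Decay is measured by X, the largest modulus of a coordinate of l - k. For a far column X
  \<ge> L^\<tau>, so \<open>bracket k\<close> is at most \<open>2 * X powr (1 / \<tau>)\<close> and
  its growth becomes a power of X. With N derivatives at most X^(-2n) remains, n the dimension, and
  this is at most 4^n times \<open>wt\<close>.\<close>

lemma far_decay: "\<exists>Cw\<ge>0. \<exists>p1. \<forall>p\<ge>p1. \<forall>k l. psi p k \<noteq> 0 \<longrightarrow> far (2 * radius p) k l \<longrightarrow>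
    cmod (entry k l) \<le> Cw * wt (l - k)"
proof -
  let ?n = "CARD('n)"
  \<comment> \<open>Each integration by parts gains \<open>L\<close> to the power \<open>\<tau> - \<delta> = \<kappa>\<close>.\<close>
  obtain N :: nat where N: "(2 * m + 2 * real ?n * \<tau>) / \<kappa> \<le> real N"
    using real_arch_simple by blast
  then have N: "2 * m + 2 * real ?n * \<tau> \<le> \<kappa> * real N"
    using exponents(1) by (simp add: divide_le_eq mult.commute)
  define e where "e = 2 * m + \<delta> * real N"
  have e0: "0 \<le> e" using m0 delta0 by (simp add: e_def)
  have "\<exists>C\<ge>0. \<forall>j\<in>UNIV. \<forall>k x. cmod (D_op j N (\<sigma> k) x) \<le> C * bracket k powr e"
  proof (rule finite_uniform_bound)
    fix j :: 'n
    show "\<exists>C. \<forall>k x. cmod (D_op j N (\<sigma> k) x) \<le> C * bracket k powr e"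
      using symbol_estimate[of "single_index j N" 0] by (simp add: mD_op_sidx e_def)
  qed (simp, blast intro: order_trans_scale[OF _ _ powr_ge_zero])
  then obtain C where C: "0 \<le> C" "\<And>j k x. cmod (D_op j N (\<sigma> k) x) \<le> C * bracket k powr e"
    by blast
  obtain p1 where p1: "\<And>p. p1 \<le> p \<Longrightarrow> 2 * real N \<le> 2 powr (\<tau> * real p)"
    using powr_2_unbounded[OF exponents(4)] by blast
  define Cw where "Cw = C * 2 powr e * 2 ^ N * 4 ^ ?n"
  show ?thesis
  proof (intro exI[of _ Cw] exI[of _ p1] conjI allI impI)
    show "0 \<le> Cw" using C by (simp add: Cw_def)
    fix p and k l :: "int ^ 'n"
    assume p: "p1 \<le> p" and psi: "psi p k \<noteq> 0" and far: "far (2 * radius p) k l"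
    define \<xi> where "\<xi> = l - k"
    have "Max (range (\<lambda>i. \<bar>\<xi> $ i\<bar>)) \<in> range (\<lambda>i. \<bar>\<xi> $ i\<bar>)" by (intro Max_in) auto
    then obtain j where j: "Max (range (\<lambda>i. \<bar>\<xi> $ i\<bar>)) = \<bar>\<xi> $ j\<bar>" by blast
    have jmax: "\<bar>\<xi> $ i\<bar> \<le> \<bar>\<xi> $ j\<bar>" for i
      unfolding j[symmetric] by (intro Max_ge) auto
    define X where "X = real_of_int \<bar>\<xi> $ j\<bar>"
    obtain i where "int (2 * radius p) \<le> \<bar>\<xi> $ i\<bar>" using far by (auto simp: far_def \<xi>_def)
    then have "int (2 * radius p) \<le> \<bar>\<xi> $ j\<bar>" using jmax[of i] by linarith
    then have "real_of_int (int (2 * radius p)) \<le> X" unfolding X_def by (simp only: of_int_le_iff)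
    then have X: "2 powr (\<tau> * real p) \<le> X" using radius(3)[of p] by simp
    have "1 \<le> 2 powr (\<tau> * real p)" using exponents by (simp add: ge_one_powr_ge_zero)
    then have X1: "1 \<le> X" using X by linarith
    have "bracket k \<le> 2 * 2 powr real p"
      using psi_pos_bracket(2)[OF psi] by (simp add: powr_realpow)
    also have "2 powr real p = (2 powr (\<tau> * real p)) powr (1 / \<tau>)"
      using exponents(4) by (simp add: powr_powr)
    also have "\<dots> \<le> X powr (1 / \<tau>)"
      using X exponents(4) by (intro powr_mono2) auto
    finally have bk: "bracket k \<le> 2 * X powr (1 / \<tau>)" by simp
    have "2 * real N \<le> X" using p1[OF p] X by linarith
    then have "real_of_int (2 * int N) \<le> real_of_int \<bar>\<xi> $ j\<bar>" by (simp add: X_def)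
    then have N2: "2 * int N \<le> \<bar>\<xi> $ j\<bar>" by (simp only: of_int_le_iff)
    have "cmod (ft (\<sigma> k) \<xi>) * (X / 2) ^ N \<le> C * bracket k powr e"
      unfolding X_def by (rule ft_decay[OF smooth C(2) N2])
    also have "\<dots> \<le> C * (2 * X powr (1 / \<tau>)) powr e"
      using bk e0 C(1) bracket_pos[of k] by (intro mult_left_mono powr_mono2) (auto simp: less_imp_le)
    also have "\<dots> = C * 2 powr e * X powr (e / \<tau>)"
      by (simp add: powr_mult powr_powr)
    finally have "cmod (ft (\<sigma> k) \<xi>) * (X / 2) ^ N * 2 ^ N \<le> C * 2 powr e * X powr (e / \<tau>) * 2 ^ N"
      by (rule mult_right_mono) simp
    then have "cmod (ft (\<sigma> k) \<xi>) * X ^ N \<le> C * 2 powr e * X powr (e / \<tau>) * 2 ^ N"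
      by (simp add: power_divide)
    then have le: "cmod (ft (\<sigma> k) \<xi>) \<le> C * 2 powr e * 2 ^ N * (X powr (e / \<tau>) / X ^ N)"
      using X1 by (simp add: pos_le_divide_eq mult_ac)
    have "X powr (e / \<tau>) / X ^ N = X powr (e / \<tau> - real N)"
      using X1 by (simp add: powr_diff powr_realpow)
    also have "\<dots> \<le> X powr (- (2 * real ?n))"
    proof (rule powr_mono[OF _ X1])
      have "e + 2 * real ?n * \<tau> \<le> \<tau> * real N"
        using N exponents_mult[of "real N"] unfolding e_def by linarith
      then show "e / \<tau> - real N \<le> - (2 * real ?n)"
        using exponents(4) by (simp add: field_simps)
    qed
    also have "\<dots> = 4 ^ ?n * (1 / (2 * X)\<^sup>2) ^ ?n"
    proof -
      have "X powr (- (2 * real ?n)) = 1 / X ^ (2 * ?n)"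
        using X1 powr_realpow[of X "2 * ?n"] by (simp add: powr_minus_divide)
      moreover have "(2 * X)\<^sup>2 = 4 * X\<^sup>2" by (simp add: power_mult_distrib)
      ultimately show ?thesis using X1 by (simp add: power_divide power_mult_distrib power_mult)
    qed
    also have "(1 / (2 * X)\<^sup>2) ^ ?n \<le> wt \<xi>"
    proof -
      have "(1 / (2 * X)\<^sup>2) ^ ?n = (\<Prod>i\<in>(UNIV :: 'n set). 1 / (2 * X)\<^sup>2)" by simp
      also have "\<dots> \<le> wt \<xi>"
        unfolding wt_def
      proof (rule prod_mono)
        fix i
        have "real_of_int \<bar>\<xi> $ i\<bar> \<le> X" using jmax[of i] unfolding X_def by (simp only: of_int_le_iff)
        then have "(1 + real_of_int \<bar>\<xi> $ i\<bar>)\<^sup>2 \<le> (2 * X)\<^sup>2"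
          using X1 by (intro power_mono) auto
        moreover have "0 < (1 + real_of_int \<bar>\<xi> $ i\<bar>)\<^sup>2" by (intro zero_less_power) linarith
        ultimately show "0 \<le> 1 / (2 * X)\<^sup>2 \<and> 1 / (2 * X)\<^sup>2 \<le> 1 / (1 + real_of_int \<bar>\<xi> $ i\<bar>)\<^sup>2"
          by (intro conjI divide_left_mono mult_pos_pos) auto
      qed
      finally show ?thesis .
    qed
    finally have "X powr (e / \<tau>) / X ^ N \<le> 4 ^ ?n * wt \<xi>" by simp
    from mult_left_mono[OF this, of "C * 2 powr e * 2 ^ N"] C(1) le
    show "cmod (entry k l) \<le> Cw * wt (l - k)"
      by (simp add: Cw_def \<xi>_def mult_ac)
  qed
qed

text \<open>Majorant of the far columns. It runs over all columns, so that it can be added up over p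
  by \<open>psi_sum\<close>.\<close>

definition fsum where
  "fsum p F f g = (\<Sum>k\<in>F. \<Sum>l\<in>F. psi p k * wt (l - k) * cmod (f l) * cmod (g k))"

text \<open>Stated for any matrix c dominated by the entries, so that it applies to the symbol and
  to its rough part alike.\<close>

lemma far_sum_le:
  assumes F: "finite F" and Cw: "0 \<le> Cw"
    and far: "\<And>k l. psi p k \<noteq> 0 \<Longrightarrow> far (2 * radius p) k l \<Longrightarrow> cmod (entry k l) \<le> Cw * wt (l - k)"
    and c: "\<And>k l. cmod (c k l) \<le> cmod (entry k l)"
  shows "(\<Sum>k\<in>F. \<Sum>l\<in>{l\<in>F. far (2 * radius p) k l}. psi p k * cmod (c k l) * cmod (f l) * cmod (g k))
    \<le> Cw * fsum p F f g"
proof -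
  have "(\<Sum>l\<in>{l\<in>F. far (2 * radius p) k l}. psi p k * cmod (c k l) * cmod (f l) * cmod (g k))
      \<le> (\<Sum>l\<in>F. Cw * (psi p k * wt (l - k) * cmod (f l) * cmod (g k)))" for k
  proof -
    have "(\<Sum>l\<in>{l\<in>F. far (2 * radius p) k l}. psi p k * cmod (c k l) * cmod (f l) * cmod (g k))
        \<le> (\<Sum>l\<in>{l\<in>F. far (2 * radius p) k l}. psi p k * (Cw * wt (l - k)) * cmod (f l) * cmod (g k))"
    proof (intro sum_mono mult_right_mono)
      fix l assume "l \<in> {l\<in>F. far (2 * radius p) k l}"
      then show "psi p k * cmod (c k l) \<le> psi p k * (Cw * wt (l - k))"
        using far[of k l] c[of k l] by (cases "psi p k = 0") (auto intro!: mult_left_mono elim: order_trans)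
    qed auto
    also have "\<dots> \<le> (\<Sum>l\<in>F. psi p k * (Cw * wt (l - k)) * cmod (f l) * cmod (g k))"
      using F Cw by (intro sum_mono2) auto
    finally show ?thesis by (simp add: mult_ac)
  qed
  then have "(\<Sum>k\<in>F. \<Sum>l\<in>{l\<in>F. far (2 * radius p) k l}. psi p k * cmod (c k l) * cmod (f l) * cmod (g k))
      \<le> (\<Sum>k\<in>F. \<Sum>l\<in>F. Cw * (psi p k * wt (l - k) * cmod (f l) * cmod (g k)))"
    by (rule sum_mono)
  then show ?thesis by (simp only: fsum_def sum_distrib_left)
qed

lemma powr_mlen_le_1: "2 powr (- \<kappa> * real p * real a) \<le> 1"
proof -
  have "- \<kappa> * real p * real a \<le> 0"
    using exponents(1) by (simp add: mult_nonneg_nonneg)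
  then have "2 powr (- \<kappa> * real p * real a) \<le> 2 powr 0" by (intro powr_mono) auto
  then show ?thesis by simp
qed

text \<open>For \<alpha> \<noteq> 0 at least one difference contributes its factor
  \<open>gain p\<close>; this is what makes freezing cheap.\<close>

lemma symbol_shell:
  assumes "\<And>j. (\<alpha> :: nat ^ 'n) $ j \<le> 1" "k \<in> shell p"
  shows "cmod (mdiff_op \<alpha> (\<lambda>l. \<sigma> l x) k) \<le> shell_const * M p / real (2 * radius p) ^ mlen \<alpha>"
    and "\<alpha> \<noteq> 0 \<Longrightarrow> cmod (mdiff_op \<alpha> (\<lambda>l. \<sigma> l x) k) \<le> shell_const * M p * gain p / real (2 * radius p) ^ mlen \<alpha>"
proof -
  have "cmod (mdiff_op \<alpha> (\<lambda>l. \<sigma> l x) k) \<le> symbol_const * bracket k powr (2 * m - \<rho> * real (mlen \<alpha>) + 0)"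
    using symbol_const(2)[OF assms(1)] by simp
  also have "\<dots> \<le> shell_const * M p * 2 powr (0 * real p) * 2 powr (- \<kappa> * real p * real (mlen \<alpha>)) / real (2 * radius p) ^ mlen \<alpha>"
    using exponent_range(1)[OF assms(1)] by (intro shell_bound assms) simp
  finally have b: "cmod (mdiff_op \<alpha> (\<lambda>l. \<sigma> l x) k)
      \<le> shell_const * M p * 2 powr (- \<kappa> * real p * real (mlen \<alpha>)) / real (2 * radius p) ^ mlen \<alpha>" by simp
  also have "\<dots> \<le> shell_const * M p * 1 / real (2 * radius p) ^ mlen \<alpha>"
    using shell_const_nonneg M_pos[of p] powr_mlen_le_1 by (intro divide_right_mono mult_left_mono) (auto simp: less_imp_le)
  finally show "cmod (mdiff_op \<alpha> (\<lambda>l. \<sigma> l x) k) \<le> shell_const * M p / real (2 * radius p) ^ mlen \<alpha>" by simp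
  assume "\<alpha> \<noteq> 0"
  then obtain j where "\<alpha> $ j \<noteq> 0" by (auto simp: vec_eq_iff)
  then have "1 \<le> mlen \<alpha>" unfolding mlen_def
    by (metis One_nat_def Suc_leI finite iso_tuple_UNIV_I not_gr_zero sum_eq_0_iff)
  then have "\<kappa> * real p * 1 \<le> \<kappa> * real p * real (mlen \<alpha>)"
    using exponents(1) by (intro mult_left_mono) auto
  then have "2 powr (- \<kappa> * real p * real (mlen \<alpha>)) \<le> gain p"
    unfolding gain_def by (intro powr_mono) auto
  then have "shell_const * M p * 2 powr (- \<kappa> * real p * real (mlen \<alpha>)) / real (2 * radius p) ^ mlen \<alpha>
      \<le> shell_const * M p * gain p / real (2 * radius p) ^ mlen \<alpha>"
    using shell_const_nonneg M_pos[of p] by (intro divide_right_mono mult_left_mono) (auto simp: less_imp_le)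
  then show "cmod (mdiff_op \<alpha> (\<lambda>l. \<sigma> l x) k) \<le> shell_const * M p * gain p / real (2 * radius p) ^ mlen \<alpha>"
    using b by linarith
qed


section \<open>The rough part: the symbol minus its smoothing\<close>

definition rough_const where "rough_const p = 2 * (real CARD('n) * (window_const TYPE('n) + 1)) * shell_const * M p * gain p"

lemma window_const_nonneg: "0 \<le> window_const TYPE('n)" by (simp add: window_const_def)

lemma rough_const_nonneg: "0 \<le> rough_const p"
  using shell_const_nonneg M_pos[of p] gain_pos[of p] window_const_nonneg by (simp add: rough_const_def)

text \<open>Smoothing in x commutes with differences in k, so \<open>smoothing_error\<close> applies
  to the differenced symbol. Its derivative in x costs L^\<delta>, the window gains L^(-\<tau>), and
  the product of the two is \<open>gain p\<close>.\<close>

lemma rough_shell: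
  assumes a: "\<And>j. (\<alpha> :: nat ^ 'n) $ j \<le> 1" and k: "k \<in> shell p"
  shows "cmod (mdiff_op \<alpha> (\<lambda>l. \<sigma> l x - smoothing (radius p) (\<sigma> l) x) k) \<le> rough_const p / real (2 * radius p) ^ mlen \<alpha>"
proof -
  let ?G = "\<lambda>y. mdiff_op \<alpha> (\<lambda>l. \<sigma> l y) k" and ?w = "real CARD('n) * (window_const TYPE('n) + 1)"
  define D where "D = shell_const * M p * 2 powr (\<delta> * real p) / real (2 * radius p) ^ mlen \<alpha>"
  have w0: "0 \<le> ?w" using window_const_nonneg by simp
  have D0: "0 \<le> D" using shell_const_nonneg M_pos[of p] by (simp add: D_def)
  have pd: "cmod (pderiv_op j ?G y) \<le> D" for j y
  proof -
    have "cmod (pderiv_op j ?G y) \<le> symbol_const * bracket k powr (2 * m - \<rho> * real (mlen \<alpha>) + \<delta>)"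
      by (rule symbol_const(3)[OF a])
    also have "\<dots> \<le> shell_const * M p * 2 powr (\<delta> * real p) * 2 powr (- \<kappa> * real p * real (mlen \<alpha>)) / real (2 * radius p) ^ mlen \<alpha>"
      by (intro shell_bound assms exponent_range(2))
    also have "\<dots> \<le> shell_const * M p * 2 powr (\<delta> * real p) * 1 / real (2 * radius p) ^ mlen \<alpha>"
      using shell_const_nonneg M_pos[of p] powr_mlen_le_1 by (intro divide_right_mono mult_left_mono) (auto simp: less_imp_le)
    finally show ?thesis by (simp add: D_def)
  qed
  have "cmod (mdiff_op \<alpha> (\<lambda>l. \<sigma> l x - smoothing (radius p) (\<sigma> l) x) k) = cmod (?G x - smoothing (radius p) ?G x)"
    by (simp add: mdiff_sm[OF tcont_symbol])
  also have "\<dots> \<le> ?w * D / real (radius p)"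
    by (rule smoothing_error[OF radius(1) smooth_torus_mdiff[OF smooth] pd])
  also have "\<dots> \<le> ?w * D * (2 * 2 powr (- \<tau> * real p))"
  proof -
    have "1 / real (radius p) \<le> 2 * 2 powr (- \<tau> * real p)"
      using radius(1)[of p] radius(3)[of p] by (simp add: powr_minus_divide field_simps)
    from mult_left_mono[OF this, of "?w * D"] show ?thesis using w0 D0 by simp
  qed
  also have "\<dots> = rough_const p / real (2 * radius p) ^ mlen \<alpha>"
  proof -
    have "2 powr (\<delta> * real p) * 2 powr (- \<tau> * real p) = gain p"
    proof -
      have "\<delta> * real p + - \<tau> * real p = - \<kappa> * real p"
        using exponents_mult[of "real p"] by simp
      then show ?thesis unfolding gain_def powr_add[symmetric] by (simp only:)
    qed
    then show ?thesis unfolding D_def rough_const_def by (simp add: mult_ac)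
  qed
  finally show ?thesis .
qed

lemma ft_rough: "ft (\<lambda>x. \<sigma> k x - smoothing (radius p) (\<sigma> k) x) \<xi> = (1 - window_corr (radius p) \<xi>) * ft (\<sigma> k) \<xi>"
  using tcont_symbol by (subst ft_diff) (auto simp: ft_sm[unfolded smoothing_def] ft_sm algebra_simps)

text \<open>For the upper bound on one dyadic block of rows, \<open>near_far\<close> takes the
  symbol itself. Summed over p it yields the boundedness of the operator.\<close>

lemma step_bounded: "\<exists>Cw\<ge>0. \<exists>p1. \<forall>p\<ge>p1. \<forall>F f g. finite F \<longrightarrow>
    cmod (\<Sum>k\<in>F. \<Sum>l\<in>F. psi p k * entry k l * f l * cnj (g k))
      \<le> 6 ^ CARD('n) * shell_const * M p * (ssq (F \<inter> shell p) f + ssq (F \<inter> shell p) g) + Cw * fsum p F f g"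
proof -
  obtain Cw p2 where Cw: "0 \<le> Cw" and p2: "\<And>p k l. p2 \<le> p \<Longrightarrow> psi p k \<noteq> 0 \<Longrightarrow> far (2 * radius p) k l \<Longrightarrow>
    cmod (entry k l) \<le> Cw * wt (l - k)" using far_decay by blast
  obtain p3 where p3: "\<And>p k l. p3 \<le> p \<Longrightarrow> psi p k \<noteq> 0 \<Longrightarrow>
    (\<And>j. \<bar>k $ j - (l :: int ^ 'n) $ j\<bar> \<le> 2 * int (2 * radius p)) \<Longrightarrow> l \<in> shell p" using near_shell by blast
  show ?thesis
  proof (intro exI[of _ Cw] exI[of _ "max p2 p3"] conjI allI impI Cw)
    fix p F f g assume p: "max p2 p3 \<le> p" and F: "finite (F :: (int ^ 'n) set)"
    have "cmod (\<Sum>k\<in>F. \<Sum>l\<in>F. psi p k * entry k l * f l * cnj (g k))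
      \<le> 6 ^ CARD('n) * (shell_const * M p) * (ssq (F \<inter> shell p) f + ssq (F \<inter> shell p) g)
      + (\<Sum>k\<in>F. \<Sum>l\<in>{l\<in>F. far (2 * radius p) k l}. psi p k * cmod (entry k l) * cmod (f l) * cmod (g k))"
    proof (rule near_far[OF F _ _ tcont_symbol])
      show "0 < 2 * radius p" using radius(1)[of p] by simp
      show "0 \<le> shell_const * M p" using shell_const_nonneg M_pos[of p] by simp
      show "l \<in> shell p" if "psi p k \<noteq> 0" "\<And>j. \<bar>k $ j - l $ j\<bar> \<le> 2 * int (2 * radius p)" for k l :: "int ^ 'n"
        using p3[of p k l] p that by simp
    qed (rule symbol_shell(1))
    also have "(\<Sum>k\<in>F. \<Sum>l\<in>{l\<in>F. far (2 * radius p) k l}. psi p k * cmod (entry k l) * cmod (f l) * cmod (g k))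
        \<le> Cw * fsum p F f g"
      using p by (intro far_sum_le F Cw p2) auto
    finally show "cmod (\<Sum>k\<in>F. \<Sum>l\<in>F. psi p k * entry k l * f l * cnj (g k))
      \<le> 6 ^ CARD('n) * shell_const * M p * (ssq (F \<inter> shell p) f + ssq (F \<inter> shell p) g) + Cw * fsum p F f g"
      by (simp add: mult_ac)
  qed
qed

text \<open>The symbol is split into its smoothing, bounded below by \<open>smoothed_lower\<close>,
  and its rough part, which is small near the diagonal by \<open>rough_shell\<close> and decays like
  the entries away from it.\<close>

lemma step_lower:
  assumes c0: "0 < c0" and pos: "\<And>k x. b0 \<le> bracket k \<Longrightarrow> c0 * bracket k powr (2 * m) \<le> Re (\<sigma> k x)"
  shows "\<exists>C2\<ge>0. \<exists>Cw\<ge>0. \<exists>p1. \<forall>p\<ge>p1. \<forall>F f. finite F \<longrightarrow>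
    c0 * 4 powr (- 2 * m) * M p * (\<Sum>k\<in>F. psi p k * (cmod (f k))\<^sup>2)
      - C2 * M p * gain p * ssq (F \<inter> shell p) f - Cw * fsum p F f f
    \<le> Re (\<Sum>k\<in>F. \<Sum>l\<in>F. psi p k * entry k l * f l * cnj (f k))"
proof -
  let ?n = "CARD('n)"
  obtain Cw p2 where Cw: "0 \<le> Cw" and p2: "\<And>p k l. p2 \<le> p \<Longrightarrow> psi p k \<noteq> 0 \<Longrightarrow> far (2 * radius p) k l \<Longrightarrow>
    cmod (entry k l) \<le> Cw * wt (l - k)" using far_decay by blast
  obtain p3 where p3: "\<And>p k l. p3 \<le> p \<Longrightarrow> psi p k \<noteq> 0 \<Longrightarrow>
    (\<And>j. \<bar>k $ j - (l :: int ^ 'n) $ j\<bar> \<le> 2 * int (2 * radius p)) \<Longrightarrow> l \<in> shell p" using near_shell by blast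
  obtain p4 where p4: "\<And>p. p4 \<le> p \<Longrightarrow> 4 * b0 \<le> 2 powr (1 * real p)"
    using powr_2_unbounded[of 1] by auto
  \<comment> \<open>On the shell the bracket is at least 2^p / 4, which costs the factor
    \<open>4 powr (- 2 * m)\<close>.\<close>
  define L where "L = c0 * 4 powr (- 2 * m)"
  have L0: "0 \<le> L" using c0 by (simp add: L_def)
  \<comment> \<open>In this order: the oscillation of \<open>psi p\<close> in the main term, the
    freezing of the symbol, the oscillation of \<open>psi p\<close> against the full symbol, and the
    rough part with f in both slots.\<close>
  define C2 where "C2 = 16 * real ?n * L + 2 ^ ?n * shell_const + 16 * real ?n * 2 ^ ?n * shell_const
      + 6 ^ ?n * 2 * (2 * (real ?n * (window_const TYPE('n) + 1)) * shell_const)"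
  have C2: "0 \<le> C2" unfolding C2_def using L0 shell_const_nonneg window_const_nonneg by (intro add_nonneg_nonneg mult_nonneg_nonneg) auto
  show ?thesis
  proof (rule exI[of _ C2], rule conjI[OF C2], rule exI[of _ Cw], rule conjI[OF Cw],
      rule exI[of _ "max p2 (max p3 p4)"], intro allI impI)
    fix p F and f :: "int ^ 'n \<Rightarrow> complex" assume p: "max p2 (max p3 p4) \<le> p" and F: "finite (F :: (int ^ 'n) set)"
    have near: "l \<in> shell p" if "psi p k \<noteq> 0" "\<And>j. \<bar>k $ j - l $ j\<bar> \<le> 2 * int (2 * radius p)" for k l :: "int ^ 'n"
      using p3[of p k l] p that by simp
    \<comment> \<open>\<open>psi_lipschitz\<close> on a cube of side at most 2 * 2^(\<tau> p) gives
      16 n 2^((\<tau> - 1) p), and \<tau> - 1 \<le> - \<kappa>.\<close>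
    define \<omega> where "\<omega> = 16 * real ?n * gain p"
    have B: "0 < 2 * radius p" using radius(1)[of p] by simp
    have lo: "L * M p \<le> Re (\<sigma> k x)" if k: "k \<in> shell p" for k x
    proof -
      have b: "2 powr real p / 4 \<le> bracket k" using k by (simp add: shell_def powr_realpow)
      then have "b0 \<le> bracket k" using p4[of p] p by simp
      then have "c0 * bracket k powr (2 * m) \<le> Re (\<sigma> k x)" by (rule pos)
      moreover have "(2 powr real p / 4) powr (2 * m) \<le> bracket k powr (2 * m)"
        using b m0 by (intro powr_mono2) auto
      moreover have "(2 powr real p / 4) powr (2 * m) = 4 powr (- 2 * m) * M p"
        by (simp add: powr_divide powr_powr M_def powr_minus_divide mult_ac)
      ultimately show ?thesis unfolding L_def
        using c0 by (smt (verit) mult.assoc mult_left_mono)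
    qed
    have osc: "\<bar>psi p k - psi p c\<bar> \<le> \<omega>" if k: "k \<in> qcube c (2 * radius p)" and sub: "qcube c (2 * radius p) \<subseteq> shell p" for k c :: "int ^ 'n"
    proof -
      have c: "c \<in> qcube c (2 * radius p)" using B by (simp add: qcube_def)
      have "norm (lvec (k - c)) \<le> real ?n * (2 * real (radius p))"
      proof (rule norm_lvec_le)
        fix j
        have "\<bar>k $ j - c $ j\<bar> \<le> int (2 * radius p)" using k unfolding qcube_def mem_Collect_eq
          by (metis abs_of_nonneg less_imp_le)
        then have "real_of_int \<bar>k $ j - c $ j\<bar> \<le> real_of_int (int (2 * radius p))" by (simp only: of_int_le_iff)
        then show "\<bar>real_of_int ((k - c) $ j)\<bar> \<le> 2 * real (radius p)" by simp
      qed
      also have "\<dots> \<le> real ?n * (2 * 2 powr (\<tau> * real p))"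
        using radius(2)[of p] by (intro mult_left_mono) auto
      finally have "8 * norm (lvec (k - c)) / 2 ^ p \<le> 8 * (real ?n * (2 * 2 powr (\<tau> * real p))) / 2 ^ p"
        by (intro divide_right_mono mult_left_mono) auto
      also have "\<dots> = 16 * real ?n * 2 powr (\<tau> * real p - real p)"
        by (simp add: powr_diff powr_realpow)
      also have "\<dots> \<le> \<omega>"
      proof -
        have "(\<kappa> + \<tau> - 1) * real p \<le> 0" using exponents(6) by (intro mult_nonpos_nonneg) auto
        then show ?thesis unfolding \<omega>_def gain_def by (intro mult_left_mono powr_mono) (auto simp: algebra_simps)
      qed
      finally show ?thesis using psi_lipschitz[of k p c] k c sub by (meson order_trans subsetD)
    qed
    have \<omega>0: "0 \<le> \<omega>" using gain_pos[of p] by (simp add: \<omega>_def)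
    let ?S = "ssq (F \<inter> shell p) f"
    have s1: "L * M p * (\<Sum>k\<in>F. psi p k * (cmod (f k))\<^sup>2)
        - (\<omega> * (L * M p) + 2 ^ ?n * (shell_const * M p * gain p) + \<omega> * 2 ^ ?n * (shell_const * M p)) * ?S
      \<le> Re (\<Sum>k\<in>F. \<Sum>l\<in>F. psi p k * (window_corr (radius p) (l - k) * entry k l) * f l * cnj (f k))"
    proof (rule smoothed_lower[OF F radius(1) refl tcont_symbol near osc lo _ \<omega>0 _ _ symbol_shell(2) symbol_shell(1)])
      show "0 \<le> L * M p" "0 \<le> shell_const * M p * gain p" "0 \<le> shell_const * M p"
        using L0 shell_const_nonneg M_pos[of p] gain_pos[of p] by simp_all
    qed
    have s2: "cmod (\<Sum>k\<in>F. \<Sum>l\<in>F. psi p k * ft (\<lambda>x. \<sigma> k x - smoothing (radius p) (\<sigma> k) x) (l - k) * f l * cnj (f k))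
      \<le> 6 ^ ?n * rough_const p * (?S + ?S)
      + (\<Sum>k\<in>F. \<Sum>l\<in>{l\<in>F. far (2 * radius p) k l}. psi p k * cmod (ft (\<lambda>x. \<sigma> k x - smoothing (radius p) (\<sigma> k) x) (l - k)) * cmod (f l) * cmod (f k))"
      by (rule near_far[OF F B rough_const_nonneg _ near rough_shell]) (use tcont_symbol in auto)
    have s3: "(\<Sum>k\<in>F. \<Sum>l\<in>{l\<in>F. far (2 * radius p) k l}. psi p k * cmod (ft (\<lambda>x. \<sigma> k x - smoothing (radius p) (\<sigma> k) x) (l - k)) * cmod (f l) * cmod (f k))
      \<le> Cw * fsum p F f f"
    proof (rule far_sum_le[OF F Cw])
      show "cmod (entry k l) \<le> Cw * wt (l - k)" if "psi p k \<noteq> 0" "far (2 * radius p) k l" for k l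
        using p2[of p k l] p that by simp
      fix k l :: "int ^ 'n"
      have "\<bar>1 - window_corr (radius p) (l - k)\<bar> \<le> 1"
        using window_corr_range[OF radius(1), of p "l - k"] by linarith
      then have "cmod (1 - complex_of_real (window_corr (radius p) (l - k))) \<le> 1"
        by (metis norm_of_real of_real_1 of_real_diff)
      then show "cmod (ft (\<lambda>x. \<sigma> k x - smoothing (radius p) (\<sigma> k) x) (l - k)) \<le> cmod (entry k l)"
        unfolding ft_rough norm_mult by (simp add: mult_left_le_one_le)
    qed
    have split: "(\<Sum>k\<in>F. \<Sum>l\<in>F. psi p k * entry k l * f l * cnj (f k))
      = (\<Sum>k\<in>F. \<Sum>l\<in>F. psi p k * (window_corr (radius p) (l - k) * entry k l) * f l * cnj (f k))
        + (\<Sum>k\<in>F. \<Sum>l\<in>F. psi p k * ft (\<lambda>x. \<sigma> k x - smoothing (radius p) (\<sigma> k) x) (l - k) * f l * cnj (f k))"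
      unfolding ft_rough sum.distrib[symmetric] by (intro sum.cong refl) (simp add: algebra_simps)
    have "(\<omega> * (L * M p) + 2 ^ ?n * (shell_const * M p * gain p) + \<omega> * 2 ^ ?n * (shell_const * M p)) * ?S + 6 ^ ?n * rough_const p * (?S + ?S)
      = C2 * M p * gain p * ?S"
      unfolding \<omega>_def C2_def rough_const_def by (simp add: algebra_simps)
    then show "c0 * 4 powr (- 2 * m) * M p * (\<Sum>k\<in>F. psi p k * (cmod (f k))\<^sup>2)
        - C2 * M p * gain p * ssq (F \<inter> shell p) f - Cw * fsum p F f f
      \<le> Re (\<Sum>k\<in>F. \<Sum>l\<in>F. psi p k * entry k l * f l * cnj (f k))"
      using s1 s2 s3 abs_Re_le_cmod[of "\<Sum>k\<in>F. \<Sum>l\<in>F. psi p k * ft (\<lambda>x. \<sigma> k x - smoothing (radius p) (\<sigma> k) x) (l - k) * f l * cnj (f k)"]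
      unfolding split L_def[symmetric] plus_complex.sel by linarith
  qed
qed

section \<open>The quadratic form of finitely supported sequences\<close>

definition wsq :: "(int ^ 'n) set \<Rightarrow> (int ^ 'n \<Rightarrow> complex) \<Rightarrow> real"
  where "wsq F f = (\<Sum>k\<in>F. bracket k powr (2 * m) * (cmod (f k))\<^sup>2)"

definition form :: "(int ^ 'n) set \<Rightarrow> (int ^ 'n \<Rightarrow> complex) \<Rightarrow> (int ^ 'n \<Rightarrow> complex) \<Rightarrow> complex"
  where "form F f g = (\<Sum>k\<in>F. \<Sum>l\<in>F. entry k l * f l * cnj (g k))"

definition pform :: "nat \<Rightarrow> (int ^ 'n) set \<Rightarrow> (int ^ 'n \<Rightarrow> complex) \<Rightarrow> (int ^ 'n \<Rightarrow> complex) \<Rightarrow> complex"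
  where "pform p F f g = (\<Sum>k\<in>F. \<Sum>l\<in>F. psi p k * entry k l * f l * cnj (g k))"

lemma ssq_le_wsq: "ssq F f \<le> wsq F f"
  unfolding wsq_def
proof (rule sum_mono)
  fix k :: "int ^ 'n"
  have "1 \<le> bracket k powr (2 * m)" using bracket_ge_1 m0 by (intro ge_one_powr_ge_zero) auto
  from mult_right_mono[OF this, of "(cmod (f k))\<^sup>2"]
  show "(cmod (f k))\<^sup>2 \<le> bracket k powr (2 * m) * (cmod (f k))\<^sup>2" by simp
qed

lemma wsq_nonneg: "0 \<le> wsq F f"
  unfolding wsq_def by (intro sum_nonneg) auto

text \<open>A point lies in at most six shells, and on each of them \<open>M p\<close> is at most
  \<open>4 powr (2 * m)\<close> times the weight.\<close>

definition overlap where "overlap = 6 * 4 powr (2 * m)"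

lemma shell_sum:
  assumes "finite A"
  shows "(\<Sum>p\<in>A. if k \<in> shell p then M p else 0) \<le> overlap * bracket k powr (2 * m)"
proof -
  define t where "t = log 2 (bracket k)"
  define q where "q = nat \<lfloor>t\<rfloor>"
  have t0: "0 \<le> t" unfolding t_def by (rule log_bracket_nonneg)
  have q: "real q \<le> t" "t < real q + 1" using t0 unfolding q_def by linarith+
  \<comment> \<open>For small q the truncated subtraction only shortens the range.\<close>
  have sub: "{p \<in> A. k \<in> shell p} \<subseteq> {q - 2..q + 3}"
  proof
    fix p assume "p \<in> {p \<in> A. k \<in> shell p}"
    then have "2 powr real p / 4 \<le> bracket k" "bracket k \<le> 4 * 2 powr real p"
      by (simp_all add: shell_def powr_realpow)
    then have "2 powr (real p - 2) \<le> bracket k" "bracket k \<le> 2 powr (real p + 2)"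
      by (simp_all add: powr_diff powr_add mult.commute)
    then have "real p - 2 \<le> t" "t \<le> real p + 2"
      unfolding t_def by (simp_all add: le_log_iff log_le_iff)
    then have "real p < real q + 3" "real q \<le> real p + 2" using q by linarith+
    then show "p \<in> {q - 2..q + 3}" by auto
  qed
  have "(\<Sum>p\<in>A. if k \<in> shell p then M p else 0) = (\<Sum>p\<in>{p \<in> A. k \<in> shell p}. M p)"
    by (rule sum.inter_filter[symmetric, OF assms])
  also have "\<dots> \<le> (\<Sum>p\<in>{p \<in> A. k \<in> shell p}. 4 powr (2 * m) * bracket k powr (2 * m))"
  proof (rule sum_mono)
    fix p assume "p \<in> {p \<in> A. k \<in> shell p}"
    then have "2 powr real p \<le> 4 * bracket k" by (simp add: shell_def powr_realpow)
    then have "(2 powr real p) powr (2 * m) \<le> (4 * bracket k) powr (2 * m)"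
      using m0 by (intro powr_mono2) auto
    then show "M p \<le> 4 powr (2 * m) * bracket k powr (2 * m)"
      by (simp add: M_def powr_powr powr_mult mult_ac less_imp_le)
  qed
  also have "\<dots> = real (card {p \<in> A. k \<in> shell p}) * (4 powr (2 * m) * bracket k powr (2 * m))" by simp
  also have "\<dots> \<le> 6 * (4 powr (2 * m) * bracket k powr (2 * m))"
  proof (rule mult_right_mono)
    have "card {p \<in> A. k \<in> shell p} \<le> card {q - 2..q + 3}" by (rule card_mono[OF _ sub]) simp
    also have "\<dots> \<le> 6" by simp
    finally show "real (card {p \<in> A. k \<in> shell p}) \<le> 6" by simp
  qed simp
  finally show ?thesis by (simp add: overlap_def mult_ac)
qed

lemma shell_sum_ssq:
  assumes "finite A" "finite F"
  shows "(\<Sum>p\<in>A. M p * ssq (F \<inter> shell p) f) \<le> overlap * wsq F f"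
proof -
  have "(\<Sum>p\<in>A. M p * ssq (F \<inter> shell p) f) = (\<Sum>p\<in>A. \<Sum>k\<in>F. (if k \<in> shell p then M p else 0) * (cmod (f k))\<^sup>2)"
    unfolding sum.inter_restrict[OF assms(2)] sum_distrib_left by (intro sum.cong refl) simp
  also have "\<dots> = (\<Sum>k\<in>F. (\<Sum>p\<in>A. if k \<in> shell p then M p else 0) * (cmod (f k))\<^sup>2)"
    unfolding sum_distrib_right by (rule sum.swap)
  also have "\<dots> \<le> (\<Sum>k\<in>F. overlap * bracket k powr (2 * m) * (cmod (f k))\<^sup>2)"
    by (intro sum_mono mult_right_mono shell_sum assms) simp
  finally show ?thesis by (simp add: wsq_def sum_distrib_left mult_ac)
qed

text \<open>The far columns of all scales together cost only unweighted norms, because in each row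
  the partition sums to at most 1.\<close>

lemma fsum_sum:
  fixes f g :: "int ^ 'n \<Rightarrow> complex"
  assumes "finite A" "finite F"
  shows "(\<Sum>p\<in>A. fsum p F f g) \<le> 4 ^ CARD('n) * (ssq F f + ssq F g)"
proof -
  have "(\<Sum>p\<in>A. fsum p F f g) = (\<Sum>k\<in>F. \<Sum>l\<in>F. (\<Sum>p\<in>A. psi p k) * (wt (l - k) * cmod (f l) * cmod (g k)))"
  proof -
    have "(\<Sum>p\<in>A. fsum p F f g) = (\<Sum>k\<in>F. \<Sum>p\<in>A. \<Sum>l\<in>F. psi p k * wt (l - k) * cmod (f l) * cmod (g k))"
      unfolding fsum_def by (rule sum.swap)
    also have "\<dots> = (\<Sum>k\<in>F. \<Sum>l\<in>F. \<Sum>p\<in>A. psi p k * wt (l - k) * cmod (f l) * cmod (g k))"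
      by (intro sum.cong refl sum.swap)
    finally show ?thesis by (simp only: sum_distrib_right mult.assoc)
  qed
  also have "\<dots> \<le> (\<Sum>k\<in>F. \<Sum>l\<in>F. 1 * (wt (l - k) * cmod (f l) * cmod (g k)))"
    by (intro sum_mono mult_right_mono psi_sum(1) assms) auto
  also have "\<dots> \<le> 4 ^ CARD('n) * (ssq F f + ssq F g)"
    using young_wt[OF assms(2)] by simp
  finally show ?thesis .
qed

text \<open>\<open>toep_L2\<close> for the symbol frozen at this row, read off at the single row
  k.\<close>

lemma row_bound:
  assumes "finite F"
  shows "cmod (\<Sum>l\<in>F. entry k l * f l) \<le> symbol_const * bracket k powr (2 * m) * sqrt (ssq F f)"
proof -
  have "L2_set (\<lambda>k. cmod (toep (\<sigma> k0) F f k)) {k} \<le> symbol_const * bracket k0 powr (2 * m) * L2_set (\<lambda>l. cmod (f l)) F" for k0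
    by (rule toep_L2) (use tcont_symbol symbol_bound assms in auto)
  from this[of k] show ?thesis by (simp add: toep_def L2_set_def)
qed

text \<open>Finitely many rows carry weight, and \<open>row_bound\<close> controls each of them by
  unweighted norms.\<close>

lemma low_rows:
  assumes F: "finite F" and w: "\<And>k. 0 \<le> w k" "\<And>k. w k \<le> 1" "\<And>k. w k \<noteq> 0 \<Longrightarrow> bracket k \<le> b"
  shows "cmod (\<Sum>k\<in>F. \<Sum>l\<in>F. of_real (w k) * entry k l * f l * cnj (g k))
    \<le> real (card {k :: int ^ 'n. bracket k \<le> b}) * (symbol_const * b powr (2 * m)) * (ssq F f + ssq F g)"
proof -
  let ?L = "{k :: int ^ 'n. bracket k \<le> b}"
  have "cmod (\<Sum>l\<in>F. of_real (w k) * entry k l * f l * cnj (g k))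
      \<le> (if k \<in> ?L then (symbol_const * b powr (2 * m)) * (ssq F f + ssq F g) else 0)" if k: "k \<in> F" for k
  proof (cases "w k = 0")
    case True
    have "0 \<le> ssq F f + ssq F g" by (intro add_nonneg_nonneg sum_nonneg) auto
    then show ?thesis using True symbol_const(1) by auto
  next
    case False
    then have kb: "bracket k \<le> b" by (rule w(3))
    have "(\<Sum>l\<in>F. of_real (w k) * entry k l * f l * cnj (g k)) = of_real (w k) * (\<Sum>l\<in>F. entry k l * f l) * cnj (g k)"
      by (simp add: sum_distrib_left sum_distrib_right mult_ac)
    then have "cmod (\<Sum>l\<in>F. of_real (w k) * entry k l * f l * cnj (g k)) = w k * (cmod (\<Sum>l\<in>F. entry k l * f l) * cmod (g k))"
      using w(1) by (simp add: norm_mult)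
    also have "\<dots> \<le> 1 * (cmod (\<Sum>l\<in>F. entry k l * f l) * cmod (g k))"
      by (intro mult_right_mono w) auto
    also have "\<dots> \<le> (symbol_const * b powr (2 * m) * sqrt (ssq F f)) * sqrt (ssq F g)"
    proof -
      have "cmod (\<Sum>l\<in>F. entry k l * f l) \<le> symbol_const * bracket k powr (2 * m) * sqrt (ssq F f)"
        by (rule row_bound[OF F])
      also have "\<dots> \<le> symbol_const * b powr (2 * m) * sqrt (ssq F f)"
        using kb m0 symbol_const(1) by (intro mult_right_mono mult_left_mono powr_mono2) (auto simp: sum_nonneg less_imp_le)
      finally have 1: "cmod (\<Sum>l\<in>F. entry k l * f l) \<le> symbol_const * b powr (2 * m) * sqrt (ssq F f)" .
      have 2: "cmod (g k) \<le> sqrt (ssq F g)"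
        using member_le_sum[OF k, of "\<lambda>k. (cmod (g k))\<^sup>2"] F by (intro real_le_rsqrt) auto
      show ?thesis using 1 2 symbol_const(1) by (simp add: mult_mono sum_nonneg)
    qed
    also have "\<dots> = symbol_const * b powr (2 * m) * (sqrt (ssq F f) * sqrt (ssq F g))" by (simp add: mult_ac)
    also have "\<dots> \<le> symbol_const * b powr (2 * m) * (ssq F f + ssq F g)"
    proof (intro mult_left_mono)
      have "sqrt a * sqrt c \<le> a + c" if "0 \<le> a" "0 \<le> c" for a c :: real
        using arith_geo_mean_sqrt[OF that] that by (simp add: real_sqrt_mult)
      then show "sqrt (ssq F f) * sqrt (ssq F g) \<le> ssq F f + ssq F g" by (simp add: sum_nonneg)
    qed (use symbol_const(1) in auto)
    finally show ?thesis using kb by simp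
  qed
  then have "cmod (\<Sum>k\<in>F. \<Sum>l\<in>F. of_real (w k) * entry k l * f l * cnj (g k))
      \<le> (\<Sum>k\<in>F. if k \<in> ?L then (symbol_const * b powr (2 * m)) * (ssq F f + ssq F g) else 0)"
    by (rule sum_norm_le)
  also have "\<dots> = (\<Sum>k\<in>F \<inter> ?L. (symbol_const * b powr (2 * m)) * (ssq F f + ssq F g))"
    by (rule sum.inter_restrict[symmetric, OF F])
  also have "\<dots> \<le> (\<Sum>k\<in>?L. (symbol_const * b powr (2 * m)) * (ssq F f + ssq F g))"
    using finite_bracket_le[of b] symbol_const(1) by (intro sum_mono2) (auto intro!: mult_nonneg_nonneg add_nonneg_nonneg sum_nonneg)
  finally show ?thesis by simp
qed

text \<open>The rows of low frequency, where the partition of unity does not sum to one, only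
  contribute a multiple of the unweighted norm.\<close>

definition low_const :: "nat \<Rightarrow> real"
  where "low_const p0 = real (card {k :: int ^ 'n. bracket k \<le> 2 ^ p0 * 2}) * (symbol_const * (2 ^ p0 * 2) powr (2 * m))"

lemma low_const_nonneg: "0 \<le> low_const p0"
  using symbol_const(1) by (simp add: low_const_def)

text \<open>P depends on F, but the constant does not; this uniformity is what survives the limit
  over F.\<close>

lemma form_decomposition:
  assumes F: "finite F"
  obtains P where "\<And>f g. cmod (form F f g - (\<Sum>p\<in>{p0..P}. pform p F f g)) \<le> low_const p0 * (ssq F f + ssq F g)"
    and "\<And>k. k \<in> F \<Longrightarrow> 2 ^ p0 * 2 \<le> bracket k \<Longrightarrow> (\<Sum>p\<in>{p0..P}. psi p k) = 1"
proof -
  obtain P where P: "\<And>k. k \<in> F \<Longrightarrow> log 2 (bracket k) + 1 \<le> real P"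
  proof -
    obtain P where "Max (insert 0 ((\<lambda>k. log 2 (bracket k) + 1) ` F)) \<le> real P"
      using real_arch_simple by blast
    then have "log 2 (bracket k) + 1 \<le> real P" if "k \<in> F" for k
      using F that by (subst (asm) Max_le_iff) auto
    then show ?thesis using that by blast
  qed
  have one: "(\<Sum>p\<in>{p0..P}. psi p k) = 1" if k: "k \<in> F" "2 ^ p0 * 2 \<le> bracket k" for k
  proof (rule psi_sum(2))
    fix p assume p: "\<bar>log 2 (bracket k) - real p\<bar> \<le> 1"
    have "2 powr (real p0 + 1) \<le> bracket k" using k(2) by (simp add: powr_add powr_realpow)
    then have "real p0 + 1 \<le> log 2 (bracket k)" by (simp add: le_log_iff)
    then show "p \<in> {p0..P}" using p P[OF k(1)] by auto
  qed simp
  have "cmod (form F f g - (\<Sum>p\<in>{p0..P}. pform p F f g)) \<le> low_const p0 * (ssq F f + ssq F g)" for f g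
  proof -
    \<comment> \<open>What the partition leaves over in each row, set to 0 off F, where the choice
      of P guarantees nothing.\<close>
    define w where "w k = (if k \<in> F then 1 - (\<Sum>p\<in>{p0..P}. psi p k) else 0)" for k
    have sw: "(\<Sum>p\<in>{p0..P}. pform p F f g) = (\<Sum>k\<in>F. \<Sum>l\<in>F. of_real (\<Sum>p\<in>{p0..P}. psi p k) * entry k l * f l * cnj (g k))"
    proof -
      have "(\<Sum>p\<in>{p0..P}. pform p F f g) = (\<Sum>k\<in>F. \<Sum>p\<in>{p0..P}. \<Sum>l\<in>F. psi p k * entry k l * f l * cnj (g k))"
        unfolding pform_def by (rule sum.swap)
      also have "\<dots> = (\<Sum>k\<in>F. \<Sum>l\<in>F. \<Sum>p\<in>{p0..P}. psi p k * entry k l * f l * cnj (g k))"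
        by (intro sum.cong refl sum.swap)
      finally show ?thesis by (simp add: sum_distrib_right)
    qed
    have "form F f g - (\<Sum>p\<in>{p0..P}. pform p F f g) = (\<Sum>k\<in>F. \<Sum>l\<in>F. of_real (w k) * entry k l * f l * cnj (g k))"
      unfolding sw form_def sum_subtractf[symmetric]
      by (intro sum.cong refl) (simp add: w_def left_diff_distrib)
    also have "cmod \<dots> \<le> low_const p0 * (ssq F f + ssq F g)"
      unfolding low_const_def
    proof (rule low_rows[OF F])
      show "0 \<le> w k" "w k \<le> 1" for k
        using psi_sum(1)[of "{p0..P}" k] by (auto simp: w_def intro!: sum_nonneg)
      show "bracket k \<le> 2 ^ p0 * 2" if "w k \<noteq> 0" for k
        using that one[of k] by (cases "k \<in> F") (auto simp: w_def intro: ccontr)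
    qed
    finally show ?thesis .
  qed
  then show ?thesis using that one by blast
qed

text \<open>Sum \<open>step_bounded\<close> over the scales. The bound is additive in f and g;
  \<open>matrix_op_bounded\<close> turns it into an operator bound by a suitable choice of
  g.\<close>

lemma form_bounded: "\<exists>C\<ge>0. \<forall>F f g. finite F \<longrightarrow> cmod (form F f g) \<le> C * (wsq F f + wsq F g)"
proof -
  obtain Cw p0 where Cw: "0 \<le> Cw" and step: "\<And>p F f g. p0 \<le> p \<Longrightarrow> finite F \<Longrightarrow>
    cmod (pform p F f g) \<le> 6 ^ CARD('n) * shell_const * M p * (ssq (F \<inter> shell p) f + ssq (F \<inter> shell p) g) + Cw * fsum p F f g"
    unfolding pform_def using step_bounded by blast
  define C where "C = 6 ^ CARD('n) * shell_const * overlap + Cw * 4 ^ CARD('n) + low_const p0"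
  have c6: "0 \<le> 6 ^ CARD('n) * shell_const" using shell_const_nonneg by simp
  have C0: "0 \<le> C" using c6 Cw low_const_nonneg by (simp add: C_def overlap_def)
  have "cmod (form F f g) \<le> C * (wsq F f + wsq F g)" if F: "finite F" for F f g
  proof -
    obtain P where P: "cmod (form F f g - (\<Sum>p\<in>{p0..P}. pform p F f g)) \<le> low_const p0 * (ssq F f + ssq F g)"
      using form_decomposition[OF F, of p0] by metis
    let ?W = "wsq F f + wsq F g"
    have W: "ssq F f + ssq F g \<le> ?W" by (intro add_mono ssq_le_wsq)
    have "cmod (\<Sum>p\<in>{p0..P}. pform p F f g)
        \<le> (\<Sum>p\<in>{p0..P}. 6 ^ CARD('n) * shell_const * M p * (ssq (F \<inter> shell p) f + ssq (F \<inter> shell p) g) + Cw * fsum p F f g)"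
      by (intro sum_norm_le step F) auto
    also have "\<dots> = 6 ^ CARD('n) * shell_const * ((\<Sum>p\<in>{p0..P}. M p * ssq (F \<inter> shell p) f) + (\<Sum>p\<in>{p0..P}. M p * ssq (F \<inter> shell p) g))
        + Cw * (\<Sum>p\<in>{p0..P}. fsum p F f g)"
      by (simp add: sum.distrib sum_distrib_left algebra_simps)
    also have "\<dots> \<le> 6 ^ CARD('n) * shell_const * (overlap * wsq F f + overlap * wsq F g) + Cw * (4 ^ CARD('n) * (ssq F f + ssq F g))"
      by (intro add_mono mult_left_mono shell_sum_ssq fsum_sum F c6 Cw) auto
    also have "\<dots> \<le> 6 ^ CARD('n) * shell_const * (overlap * wsq F f + overlap * wsq F g) + Cw * (4 ^ CARD('n) * ?W)"
      by (intro add_left_mono mult_left_mono W Cw) simp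
    finally have 1: "cmod (\<Sum>p\<in>{p0..P}. pform p F f g)
      \<le> 6 ^ CARD('n) * shell_const * (overlap * wsq F f + overlap * wsq F g) + Cw * (4 ^ CARD('n) * ?W)" .
    have "low_const p0 * (ssq F f + ssq F g) \<le> low_const p0 * ?W" by (rule mult_left_mono[OF W low_const_nonneg])
    then have "cmod (form F f g) \<le> 6 ^ CARD('n) * shell_const * (overlap * wsq F f + overlap * wsq F g) + Cw * (4 ^ CARD('n) * ?W) + low_const p0 * ?W"
      using 1 P norm_triangle_sub[of "form F f g" "\<Sum>p\<in>{p0..P}. pform p F f g"] by linarith
    then show ?thesis by (simp add: C_def algebra_simps)
  qed
  then show ?thesis using C0 by blast
qed

text \<open>The partition starts at a scale from which \<open>C2 * gain p\<close> is so small that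
  the errors of all shells together use up at most half of the main term.\<close>

lemma form_garding:
  assumes c0: "0 < c0" and pos: "\<And>k x. b0 \<le> bracket k \<Longrightarrow> c0 * bracket k powr (2 * m) \<le> Re (\<sigma> k x)"
  shows "\<exists>C0>0. \<exists>C1>0. \<forall>F f. finite F \<longrightarrow> C0 * wsq F f - C1 * ssq F f \<le> Re (form F f f)"
proof -
  define c1 where "c1 = c0 * 4 powr (- 2 * m)"
  have c1: "0 < c1" using c0 by (simp add: c1_def)
  have "\<exists>C2\<ge>0. \<exists>Cw\<ge>0. \<exists>p1. \<forall>p\<ge>p1. \<forall>F f. finite F \<longrightarrow>
    c1 * M p * (\<Sum>k\<in>F. psi p k * (cmod (f k))\<^sup>2) - C2 * M p * gain p * ssq (F \<inter> shell p) f - Cw * fsum p F f f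
      \<le> Re (pform p F f f)"
    unfolding c1_def pform_def by (rule step_lower[OF c0]) (rule pos)
  then obtain C2 Cw p1 where C2: "0 \<le> C2" and Cw: "0 \<le> Cw" and st: "\<forall>p\<ge>p1. \<forall>F f. finite F \<longrightarrow>
    c1 * M p * (\<Sum>k\<in>F. psi p k * (cmod (f k))\<^sup>2) - C2 * M p * gain p * ssq (F \<inter> shell p) f - Cw * fsum p F f f
      \<le> Re (pform p F f f)"
    by (elim exE conjE, intro that) assumption+
  have step: "c1 * M p * (\<Sum>k\<in>F. psi p k * (cmod (f k))\<^sup>2) - C2 * M p * gain p * ssq (F \<inter> shell p) f - Cw * fsum p F f f
      \<le> Re (pform p F f f)" if "p1 \<le> p" "finite F" for p F f
    using st that by blast
  \<comment> \<open>On the support of \<open>psi p\<close> the bracket is at most 2 * 2^p, so there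
    \<open>M p\<close> is at least \<open>2 powr (- 2 * m)\<close> times the weight.\<close>
  define c2 where "c2 = c1 * 2 powr (- 2 * m)"
  have c2: "0 < c2" using c1 by (simp add: c2_def)
  have overlap: "0 < overlap" by (simp add: overlap_def)
  \<comment> \<open>Summing over the shells multiplies an error by \<open>overlap\<close>; this
    choice leaves half of \<open>c2\<close>.\<close>
  define \<epsilon> where "\<epsilon> = c2 / (2 * overlap)"
  have \<epsilon>: "0 < \<epsilon>" using c2 overlap by (simp add: \<epsilon>_def)
  obtain p2 where p2: "\<And>p. p2 \<le> p \<Longrightarrow> C2 / \<epsilon> \<le> 2 powr (\<kappa> * real p)"
    using powr_2_unbounded[OF exponents(1)] by blast
  have gain: "C2 * gain p \<le> \<epsilon>" if "p2 \<le> p" for p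
  proof -
    have "C2 \<le> \<epsilon> * 2 powr (\<kappa> * real p)" using p2[OF that] \<epsilon> by (simp add: divide_le_eq mult.commute)
    then have "C2 * gain p \<le> \<epsilon> * 2 powr (\<kappa> * real p) * gain p"
      by (rule mult_right_mono) (simp add: gain_def)
    also have "2 powr (\<kappa> * real p) * gain p = 1" by (simp add: gain_def flip: powr_add)
    then have "\<epsilon> * 2 powr (\<kappa> * real p) * gain p = \<epsilon>" by (simp add: mult.assoc)
    finally show ?thesis .
  qed
  define p0 where "p0 = max p1 p2"
  define b where "b = (2 :: real) ^ p0 * 2"
  \<comment> \<open>Collects the main term at low frequency, the far columns and the low rows; the
    factors 2 appear because f occupies both slots of the form.\<close>
  define C1 where "C1 = c2 * b powr (2 * m) + Cw * (4 ^ CARD('n) * 2) + low_const p0 * 2 + 1"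
  have C1: "0 < C1" using c2 Cw low_const_nonneg[of p0] unfolding C1_def by (intro add_nonneg_pos add_nonneg_nonneg) auto
  have "c2 / 2 * wsq F f - C1 * ssq F f \<le> Re (form F f f)" if F: "finite F" for F f
  proof -
    let ?S = "ssq F f"
    have S0: "0 \<le> ?S" by (intro sum_nonneg) auto
    obtain P where P: "cmod (form F f f - (\<Sum>p\<in>{p0..P}. pform p F f f)) \<le> low_const p0 * (?S + ?S)"
      and one: "\<And>k. k \<in> F \<Longrightarrow> b \<le> bracket k \<Longrightarrow> (\<Sum>p\<in>{p0..P}. psi p k) = 1"
      using form_decomposition[OF F, of p0] unfolding b_def by metis
    let ?A = "{p0..P}"
    have main: "c2 * wsq F f - c2 * b powr (2 * m) * ?S \<le> (\<Sum>p\<in>?A. c1 * M p * (\<Sum>k\<in>F. psi p k * (cmod (f k))\<^sup>2))"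
    proof -
      have "(\<Sum>p\<in>?A. c1 * M p * (\<Sum>k\<in>F. psi p k * (cmod (f k))\<^sup>2)) = (\<Sum>k\<in>F. (\<Sum>p\<in>?A. c1 * M p * psi p k) * (cmod (f k))\<^sup>2)"
        unfolding sum_distrib_left sum_distrib_right by (subst sum.swap) (simp add: mult_ac)
      also have "\<dots> \<ge> (\<Sum>k\<in>F. (c2 * bracket k powr (2 * m) - c2 * b powr (2 * m)) * (cmod (f k))\<^sup>2)"
      proof (intro sum_mono mult_right_mono)
        fix k assume k: "k \<in> F"
        show "c2 * bracket k powr (2 * m) - c2 * b powr (2 * m) \<le> (\<Sum>p\<in>?A. c1 * M p * psi p k)"
        proof (cases "b \<le> bracket k")
          case True
          have "c2 * bracket k powr (2 * m) = (\<Sum>p\<in>?A. c2 * bracket k powr (2 * m) * psi p k)"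
            using one[OF k True] by (simp flip: sum_distrib_left)
          also have "\<dots> \<le> (\<Sum>p\<in>?A. c1 * M p * psi p k)"
          proof (rule sum_mono)
            fix p
            show "c2 * bracket k powr (2 * m) * psi p k \<le> c1 * M p * psi p k"
            proof (cases "psi p k = 0")
              case False
              have "bracket k powr (2 * m) \<le> (2 * 2 powr real p) powr (2 * m)"
                using psi_pos_bracket(2)[OF False] m0 by (intro powr_mono2) (auto simp: powr_realpow less_imp_le)
              also have "\<dots> = 2 powr (2 * m) * M p" by (simp add: powr_mult powr_powr M_def mult_ac)
              finally have "2 powr (- 2 * m) * bracket k powr (2 * m) \<le> 2 powr (- 2 * m) * (2 powr (2 * m) * M p)"
                by (rule mult_left_mono) simp
              also have "\<dots> = M p" by (simp add: powr_minus field_simps)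
              finally have "c2 * bracket k powr (2 * m) \<le> c1 * M p"
                unfolding c2_def using c1 by (simp add: mult_left_mono mult.assoc)
              then show ?thesis by (rule mult_right_mono) simp
            qed simp
          qed
          finally show ?thesis using c2 by (smt (verit) mult_nonneg_nonneg powr_ge_zero)
        next
          \<comment> \<open>At low frequency the left-hand side is at most 0; the subtracted term is
            paid by \<open>C1\<close>.\<close>
          case False
          then have "c2 * bracket k powr (2 * m) \<le> c2 * b powr (2 * m)"
            using c2 m0 by (intro mult_left_mono powr_mono2) (auto simp: less_imp_le)
          moreover have "0 \<le> (\<Sum>p\<in>?A. c1 * M p * psi p k)"
            using c1 by (intro sum_nonneg) (simp add: M_def)
          ultimately show ?thesis by linarith
        qed
      qed simp
      also have "(\<Sum>k\<in>F. (c2 * bracket k powr (2 * m) - c2 * b powr (2 * m)) * (cmod (f k))\<^sup>2)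
        = c2 * wsq F f - c2 * b powr (2 * m) * ?S"
        by (simp only: wsq_def sum_distrib_left left_diff_distrib sum_subtractf mult.assoc)
      finally show ?thesis .
    qed
    have err: "(\<Sum>p\<in>?A. C2 * M p * gain p * ssq (F \<inter> shell p) f) \<le> c2 / 2 * wsq F f"
    proof -
      have "(\<Sum>p\<in>?A. C2 * M p * gain p * ssq (F \<inter> shell p) f) \<le> (\<Sum>p\<in>?A. \<epsilon> * (M p * ssq (F \<inter> shell p) f))"
      proof (rule sum_mono)
        fix p assume "p \<in> ?A"
        then have "C2 * gain p * (M p * ssq (F \<inter> shell p) f) \<le> \<epsilon> * (M p * ssq (F \<inter> shell p) f)"
          by (intro mult_right_mono gain) (auto simp: p0_def M_def sum_nonneg)
        then show "C2 * M p * gain p * ssq (F \<inter> shell p) f \<le> \<epsilon> * (M p * ssq (F \<inter> shell p) f)"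
          by (simp add: mult_ac)
      qed
      also have "\<dots> = \<epsilon> * (\<Sum>p\<in>?A. M p * ssq (F \<inter> shell p) f)" by (simp add: sum_distrib_left)
      also have "\<dots> \<le> \<epsilon> * (overlap * wsq F f)"
        using \<epsilon> by (intro mult_left_mono shell_sum_ssq F) auto
      also have "\<dots> = c2 / 2 * wsq F f" using overlap by (simp add: \<epsilon>_def)
      finally show ?thesis .
    qed
    have fs: "Cw * (\<Sum>p\<in>?A. fsum p F f f) \<le> Cw * (4 ^ CARD('n) * (?S + ?S))"
      by (intro mult_left_mono fsum_sum F Cw) auto
    have "(\<Sum>p\<in>?A. c1 * M p * (\<Sum>k\<in>F. psi p k * (cmod (f k))\<^sup>2) - C2 * M p * gain p * ssq (F \<inter> shell p) f - Cw * fsum p F f f)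
        \<le> (\<Sum>p\<in>?A. Re (pform p F f f))"
      by (intro sum_mono step F) (simp add: p0_def)
    then have "c2 * wsq F f - c2 * b powr (2 * m) * ?S - c2 / 2 * wsq F f - Cw * (4 ^ CARD('n) * (?S + ?S))
        \<le> Re (\<Sum>p\<in>?A. pform p F f f)"
      using main err fs unfolding sum_subtractf sum_distrib_left[symmetric] Re_sum by linarith
    moreover have "Re (\<Sum>p\<in>?A. pform p F f f) - low_const p0 * (?S + ?S) \<le> Re (form F f f)"
      using P abs_Re_le_cmod[of "form F f f - (\<Sum>p\<in>?A. pform p F f f)"] by simp
    ultimately show ?thesis
      using S0 unfolding C1_def by (simp add: algebra_simps)
  qed
  then show ?thesis using c2 C1 by (intro exI[of _ "c2 / 2"] exI[of _ C1] conjI) auto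
qed

section \<open>The extended operator\<close>

text \<open>The value 0 outside \<open>l2 m\<close> copies the convention in \<open>Op_ext\<close>,
  so that the two agree as functions.\<close>

definition matrix_op :: "(int ^ 'n \<Rightarrow> complex) \<Rightarrow> int ^ 'n \<Rightarrow> complex"
  where "matrix_op f k = (if f \<in> l2 m then \<Sum>\<^sub>\<infinity>l. entry k l * f l else 0)"

lemma wsq_le_l2norm: "f \<in> l2 m \<Longrightarrow> finite F \<Longrightarrow> wsq F f \<le> (l2norm m f)\<^sup>2"
  unfolding wsq_def by (rule sum_le_l2norm)

text \<open>Rotating the phases of f makes all its products with the entries of the row nonnegative,
  so \<open>row_bound\<close> controls the sum of moduli.\<close>

lemma row_summable:
  assumes f: "f \<in> l2 m"
  shows "(\<lambda>l. entry k l * f l) summable_on UNIV"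
proof (rule abs_summable_summable, rule nonneg_bdd_above_summable_on)
  show "bdd_above (sum (\<lambda>l. norm (entry k l * f l)) ` {F. F \<subseteq> UNIV \<and> finite F})"
  proof (rule bdd_aboveI2)
    fix F assume "F \<in> {F. F \<subseteq> UNIV \<and> finite (F :: (int ^ 'n) set)}"
    then have F: "finite F" by simp
    define g where "g l = of_real (cmod (f l)) * cnj (sgn (entry k l))" for l
    have e: "entry k l * g l = of_real (cmod (entry k l * f l))" for l
    proof -
      have "entry k l * cnj (sgn (entry k l)) = of_real (cmod (entry k l))"
        by (cases "entry k l = 0")
          (simp_all add: sgn_div_norm scaleR_conv_of_real complex_norm_square[symmetric] power2_eq_square field_simps)
      then show ?thesis by (simp add: g_def norm_mult mult_ac)
    qed
    have "(\<Sum>l\<in>F. norm (entry k l * f l)) = cmod (\<Sum>l\<in>F. entry k l * g l)"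
      unfolding e by (simp add: sum_nonneg flip: of_real_sum)
    also have "\<dots> \<le> symbol_const * bracket k powr (2 * m) * sqrt (ssq F g)"
      by (rule row_bound[OF F])
    also have "\<dots> \<le> symbol_const * bracket k powr (2 * m) * l2norm m f"
    proof (intro mult_left_mono)
      have "ssq F g \<le> ssq F f"
        by (intro sum_mono power_mono) (auto simp: g_def norm_mult norm_sgn)
      also have "\<dots> \<le> (l2norm m f)\<^sup>2"
        using ssq_le_wsq wsq_le_l2norm[OF f F] by (rule order_trans)
      finally show "sqrt (ssq F g) \<le> l2norm m f" by (intro real_le_lsqrt) (auto simp: sum_nonneg)
    qed (use symbol_const(1) in auto)
    finally show "(\<Sum>l\<in>F. norm (entry k l * f l)) \<le> symbol_const * bracket k powr (2 * m) * l2norm m f" .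
  qed
qed simp

lemma matrix_op_tendsto:
  assumes "f \<in> l2 m"
  shows "((\<lambda>F. \<Sum>l\<in>F. entry k l * f l) \<longlongrightarrow> matrix_op f k) (finite_subsets_at_top UNIV)"
  using infsum_tendsto[OF row_summable[OF assms, of k]] assms by (simp add: matrix_op_def)

text \<open>Duality: the form is tested against a multiple of the weighted image itself. The column
  set F grows while the finite row set J is fixed; J is released last, by
  \<open>l2I\<close>.\<close>

lemma matrix_op_bounded:
  obtains C where "0 < C" and "\<And>f. f \<in> l2 m \<Longrightarrow> matrix_op f \<in> l2 (- m)"
    and "\<And>f. f \<in> l2 m \<Longrightarrow> l2norm (- m) (matrix_op f) \<le> C * l2norm m f"
proof -
  obtain C0 where C0: "0 \<le> C0" and fb: "\<And>F f g. finite F \<Longrightarrow> cmod (form F f g) \<le> C0 * (wsq F f + wsq F g)"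
    using form_bounded by blast
  define C where "C = C0 + 1"
  have C: "0 < C" using C0 by (simp add: C_def)
  have fb: "cmod (form F f g) \<le> C * (wsq F f + wsq F g)" if "finite F" for F f g
  proof -
    have "C0 * (wsq F f + wsq F g) \<le> C * (wsq F f + wsq F g)"
      unfolding C_def by (intro mult_right_mono add_nonneg_nonneg wsq_nonneg) auto
    then show ?thesis using fb[OF that, of f g] by linarith
  qed
  have part: "(\<Sum>k\<in>J. bracket k powr (2 * - m) * (cmod (\<Sum>l\<in>F. entry k l * f l))\<^sup>2) \<le> 4 * C\<^sup>2 * (l2norm m f)\<^sup>2"
    if f: "f \<in> l2 m" and F: "finite F" and J: "J \<subseteq> F" for f F J
  proof -
    define a where "a k = (\<Sum>l\<in>F. entry k l * f l)" for k
    define S where "S = (\<Sum>k\<in>J. bracket k powr (- 2 * m) * (cmod (a k))\<^sup>2)"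
    \<comment> \<open>Small enough that the term of \<open>g\<close> in the bound of the form is absorbed by the left-hand side.\<close>
    define c where "c = 1 / (2 * C)"
    have c: "0 < c" using C by (simp add: c_def)
    \<comment> \<open>With this weight the form equals c times S, the quantity to be
      bounded.\<close>
    define g where "g k = (if k \<in> J then of_real (c * bracket k powr (- 2 * m)) * a k else 0)" for k
    have S0: "0 \<le> S" unfolding S_def by (intro sum_nonneg) auto
    have "form F f g = (\<Sum>k\<in>F. a k * cnj (g k))"
      by (simp add: form_def a_def sum_distrib_right)
    also have "\<dots> = (\<Sum>k\<in>J. a k * cnj (g k))"
      using F J by (intro sum.mono_neutral_right) (auto simp: g_def)
    also have "\<dots> = (\<Sum>k\<in>J. of_real (c * (bracket k powr (- 2 * m) * (cmod (a k))\<^sup>2)))"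
    proof (rule sum.cong[OF refl])
      fix k assume "k \<in> J"
      then have "a k * cnj (g k) = of_real (c * bracket k powr (- 2 * m)) * (a k * cnj (a k))"
        by (simp add: g_def mult_ac)
      then show "a k * cnj (g k) = of_real (c * (bracket k powr (- 2 * m) * (cmod (a k))\<^sup>2))"
        by (simp only: complex_norm_square[symmetric] of_real_mult mult.assoc)
    qed
    also have "\<dots> = of_real (c * S)" by (simp add: S_def sum_distrib_left)
    finally have "cmod (form F f g) = c * S" using c S0 by (simp add: norm_mult)
    moreover have "wsq F g = c\<^sup>2 * S"
    proof -
      have "wsq F g = (\<Sum>k\<in>J. bracket k powr (2 * m) * (cmod (g k))\<^sup>2)"
        unfolding wsq_def using F J by (intro sum.mono_neutral_right) (auto simp: g_def)
      also have "\<dots> = (\<Sum>k\<in>J. c\<^sup>2 * (bracket k powr (- 2 * m) * (cmod (a k))\<^sup>2))"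
      proof (rule sum.cong[OF refl])
        fix k assume "k \<in> J"
        then have "cmod (g k) = c * bracket k powr (- 2 * m) * cmod (a k)"
          using c by (simp add: g_def norm_mult)
        then have "bracket k powr (2 * m) * (cmod (g k))\<^sup>2
            = c\<^sup>2 * ((bracket k powr (2 * m) * bracket k powr (- 2 * m)) * (bracket k powr (- 2 * m) * (cmod (a k))\<^sup>2))"
          by (simp add: power2_eq_square mult_ac)
        also have "bracket k powr (2 * m) * bracket k powr (- 2 * m) = 1" by (simp flip: powr_add)
        finally show "bracket k powr (2 * m) * (cmod (g k))\<^sup>2 = c\<^sup>2 * (bracket k powr (- 2 * m) * (cmod (a k))\<^sup>2)"
          by simp
      qed
      finally show ?thesis by (simp add: S_def sum_distrib_left)
    qed
    ultimately have "c * S \<le> C * (wsq F f + c\<^sup>2 * S)" using fb[OF F, of f g] by simp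
    also have "C * (wsq F f + c\<^sup>2 * S) = C * wsq F f + c * S / 2"
      using C by (simp add: c_def power2_eq_square field_simps)
    finally have "c * S \<le> 2 * C * wsq F f" by simp
    then have "S \<le> 4 * C\<^sup>2 * wsq F f"
      using C by (simp add: c_def power2_eq_square field_simps)
    also have "\<dots> \<le> 4 * C\<^sup>2 * (l2norm m f)\<^sup>2"
      by (intro mult_left_mono wsq_le_l2norm f F) simp
    finally show ?thesis by (simp add: S_def a_def)
  qed
  have lim: "(\<Sum>k\<in>J. bracket k powr (2 * - m) * (cmod (matrix_op f k))\<^sup>2) \<le> 4 * C\<^sup>2 * (l2norm m f)\<^sup>2"
    if f: "f \<in> l2 m" and J: "finite J" for f J
  proof (rule tendsto_upperbound)
    show "((\<lambda>F. \<Sum>k\<in>J. bracket k powr (2 * - m) * (cmod (\<Sum>l\<in>F. entry k l * f l))\<^sup>2) \<longlongrightarrow>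
        (\<Sum>k\<in>J. bracket k powr (2 * - m) * (cmod (matrix_op f k))\<^sup>2)) (finite_subsets_at_top UNIV)"
      by (intro tendsto_intros matrix_op_tendsto f)
    show "\<forall>\<^sub>F F in finite_subsets_at_top UNIV.
        (\<Sum>k\<in>J. bracket k powr (2 * - m) * (cmod (\<Sum>l\<in>F. entry k l * f l))\<^sup>2) \<le> 4 * C\<^sup>2 * (l2norm m f)\<^sup>2"
      unfolding eventually_finite_subsets_at_top
      by (rule exI[of _ J]) (use J part[OF f] in auto)
  qed simp
  show ?thesis
  proof (rule that[of "2 * C"])
    fix f :: "int ^ 'n \<Rightarrow> complex" assume f: "f \<in> l2 m"
    show "matrix_op f \<in> l2 (- m)" by (rule l2I(1)[OF lim[OF f]])
    have "(l2norm (- m) (matrix_op f))\<^sup>2 \<le> 4 * C\<^sup>2 * (l2norm m f)\<^sup>2"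
      by (rule l2I(2)[OF lim[OF f]])
    also have "\<dots> = (2 * C * l2norm m f)\<^sup>2" by (simp add: power_mult_distrib)
    finally show "l2norm (- m) (matrix_op f) \<le> 2 * C * l2norm m f"
      by (rule power2_le_imp_le) (use C in simp)
  qed (use C in simp)
qed

lemma matrix_op_add:
  assumes "f \<in> l2 m" "g \<in> l2 m"
  shows "matrix_op (\<lambda>k. f k + g k) = (\<lambda>k. matrix_op f k + matrix_op g k)"
  using assms l2_add[OF assms]
  by (auto simp: matrix_op_def distrib_left infsum_add row_summable)

lemma matrix_op_cmult:
  assumes "f \<in> l2 m"
  shows "matrix_op (\<lambda>k. c * f k) = (\<lambda>k. c * matrix_op f k)"
  using assms l2_cmult[OF assms, of c]
  by (auto simp: matrix_op_def mult.left_commute[of _ c] infsum_cmult_right')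

lemma matrix_op_Op:
  assumes "rapidly_decreasing f"
  shows "matrix_op f = Op \<sigma> f"
proof
  fix k
  show "matrix_op f k = Op \<sigma> f k"
    using Op_has_sum[of f \<sigma> k, OF assms tcont_symbol symbol_bound] rapidly_decreasing_l2[OF assms]
    by (simp add: matrix_op_def infsumI)
qed

lemma bounded_linear_matrix_op: "bounded_linear_l2 m (- m) matrix_op"
proof -
  obtain C where "0 < C" "\<And>f. f \<in> l2 m \<Longrightarrow> matrix_op f \<in> l2 (- m)"
    "\<And>f. f \<in> l2 m \<Longrightarrow> l2norm (- m) (matrix_op f) \<le> C * l2norm m f"
    using matrix_op_bounded by blast
  then show ?thesis
    unfolding bounded_linear_l2_def using matrix_op_add matrix_op_cmult by blast
qed

lemma cut_split: "f = (\<lambda>k. cut F f k + cut (- F) f k)"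
  by (auto simp: cut_def)

text \<open>Uniqueness: a competitor agrees with \<open>matrix_op\<close> on cut-offs to finite
  sets, which decrease rapidly. On the tails both operators are bounded, and the norms of the tails
  tend to 0.\<close>

lemma Op_ext_eq: "Op_ext m \<sigma> = matrix_op"
  unfolding Op_ext_def
proof (rule the_equality)
  show "bounded_linear_l2 m (- m) matrix_op \<and> (\<forall>f. rapidly_decreasing f \<longrightarrow> matrix_op f = Op \<sigma> f) \<and>
      (\<forall>f. f \<notin> l2 m \<longrightarrow> matrix_op f = (\<lambda>_. 0))"
    using bounded_linear_matrix_op matrix_op_Op by (auto simp: matrix_op_def)
next
  fix A
  assume A: "bounded_linear_l2 m (- m) A \<and> (\<forall>f. rapidly_decreasing f \<longrightarrow> A f = Op \<sigma> f) \<and>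
      (\<forall>f. f \<notin> l2 m \<longrightarrow> A f = (\<lambda>_. 0))"
  obtain C where C: "\<And>f. f \<in> l2 m \<Longrightarrow> matrix_op f \<in> l2 (- m)"
    "\<And>f. f \<in> l2 m \<Longrightarrow> l2norm (- m) (matrix_op f) \<le> C * l2norm m f"
    using matrix_op_bounded by blast
  obtain C' where C': "\<And>f. f \<in> l2 m \<Longrightarrow> A f \<in> l2 (- m)"
    "\<And>f. f \<in> l2 m \<Longrightarrow> l2norm (- m) (A f) \<le> C' * l2norm m f"
    "\<And>f g. f \<in> l2 m \<Longrightarrow> g \<in> l2 m \<Longrightarrow> A (\<lambda>k. f k + g k) = (\<lambda>k. A f k + A g k)"
    using A unfolding bounded_linear_l2_def by blast
  show "A = matrix_op"
  proof (intro ext)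
    fix f k
    show "A f k = matrix_op f k"
    proof (cases "f \<in> l2 m")
      case True
      have bnd: "bracket k powr (- m) * cmod (A f k - matrix_op f k) \<le> (C' + C) * l2norm m (cut (- F) f)"
        if F: "finite F" for F
      proof -
        let ?r = "cut (- F) f" and ?s = "cut F f"
        have r: "?r \<in> l2 m" by (rule l2_restrict_Compl(1)[OF True])
        have rd: "rapidly_decreasing ?s" by (rule rapidly_decreasing_restrict[OF F])
        then have s: "?s \<in> l2 m" by (rule rapidly_decreasing_l2)
        have "A f = (\<lambda>k. A ?s k + A ?r k)" by (subst cut_split[of f F]) (rule C'(3)[OF s r])
        moreover have "matrix_op f = (\<lambda>k. matrix_op ?s k + matrix_op ?r k)"
          by (subst cut_split[of f F]) (rule matrix_op_add[OF s r])
        moreover have "A ?s = matrix_op ?s" using A rd matrix_op_Op by metis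
        ultimately have "A f k - matrix_op f k = A ?r k - matrix_op ?r k" by simp
        then have "bracket k powr (- m) * cmod (A f k - matrix_op f k)
            \<le> bracket k powr (- m) * (cmod (A ?r k) + cmod (matrix_op ?r k))"
          by (intro mult_left_mono) (auto intro: norm_triangle_ineq4)
        also have "\<dots> \<le> l2norm (- m) (A ?r) + l2norm (- m) (matrix_op ?r)"
          using l2_pointwise[OF C'(1)[OF r], of k] l2_pointwise[OF C(1)[OF r], of k] by (simp add: distrib_left)
        also have "\<dots> \<le> (C' + C) * l2norm m ?r"
          using C'(2)[OF r] C(2)[OF r] by (simp add: distrib_right)
        finally show ?thesis .
      qed
      have "bracket k powr (- m) * cmod (A f k - matrix_op f k) \<le> (C' + C) * 0"
      proof (rule tendsto_lowerbound)
        show "((\<lambda>F. (C' + C) * l2norm m (cut (- F) f)) \<longlongrightarrow> (C' + C) * 0) (finite_subsets_at_top UNIV)"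
          by (intro tendsto_mult tendsto_const l2norm_tail True)
        show "\<forall>\<^sub>F F in finite_subsets_at_top UNIV.
            bracket k powr (- m) * cmod (A f k - matrix_op f k) \<le> (C' + C) * l2norm m (cut (- F) f)"
          by (rule eventually_finite_subsets_at_top_weakI) (rule bnd)
      qed simp
      then have "cmod (A f k - matrix_op f k) \<le> 0" by (simp add: mult_le_0_iff)
      then show ?thesis by simp
    next
      case False
      then show ?thesis using A by (simp add: matrix_op_def)
    qed
  qed
qed

text \<open>\<open>form F\<close> truncates rows and columns at once. It differs from the pairing
  truncated in rows only by the image of the tail paired with f, which is bounded by the norm of the
  tail.\<close>

lemma form_tendsto:
  assumes f: "f \<in> l2 m"
  shows "((\<lambda>F. form F f f) \<longlongrightarrow> l2inner (matrix_op f) f) (finite_subsets_at_top UNIV)"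
proof -
  obtain C where C: "\<And>f. f \<in> l2 m \<Longrightarrow> matrix_op f \<in> l2 (- m)"
    "\<And>f. f \<in> l2 m \<Longrightarrow> l2norm (- m) (matrix_op f) \<le> C * l2norm m f"
    using matrix_op_bounded by blast
  have 1: "((\<lambda>F. \<Sum>k\<in>F. matrix_op f k * cnj (f k)) \<longlongrightarrow> l2inner (matrix_op f) f) (finite_subsets_at_top UNIV)"
    unfolding l2inner_def by (rule infsum_tendsto[OF pairing_summable[OF f C(1)[OF f]]])
  have 2: "((\<lambda>F. form F f f - (\<Sum>k\<in>F. matrix_op f k * cnj (f k))) \<longlongrightarrow> 0) (finite_subsets_at_top UNIV)"
  proof (rule Lim_null_comparison)
    show "((\<lambda>F. C * l2norm m (cut (- F) f) * l2norm m f) \<longlongrightarrow> 0) (finite_subsets_at_top UNIV)"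
      using tendsto_mult[OF tendsto_mult[OF tendsto_const[of C] l2norm_tail[OF f]] tendsto_const[of "l2norm m f"]]
      by simp
    show "\<forall>\<^sub>F F in finite_subsets_at_top UNIV.
        norm (form F f f - (\<Sum>k\<in>F. matrix_op f k * cnj (f k))) \<le> C * l2norm m (cut (- F) f) * l2norm m f"
    proof (rule eventually_finite_subsets_at_top_weakI)
      fix F :: "(int ^ 'n) set" assume F: "finite F"
      let ?r = "cut (- F) f" and ?s = "cut F f"
      have r: "?r \<in> l2 m" by (rule l2_restrict_Compl(1)[OF f])
      have s: "?s \<in> l2 m" by (rule rapidly_decreasing_l2[OF rapidly_decreasing_restrict[OF F]])
      have ms: "matrix_op ?s k = (\<Sum>l\<in>F. entry k l * f l)" for k
      proof -
        have "(\<Sum>\<^sub>\<infinity>l. entry k l * ?s l) = (\<Sum>\<^sub>\<infinity>l\<in>F. entry k l * f l)"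
          by (rule infsum_cong_neutral) (auto simp: cut_def)
        then show ?thesis using s F by (simp add: matrix_op_def)
      qed
      have "matrix_op f = (\<lambda>k. matrix_op ?s k + matrix_op ?r k)"
        by (subst cut_split[of f F]) (rule matrix_op_add[OF s r])
      then have "form F f f - (\<Sum>k\<in>F. matrix_op f k * cnj (f k)) = - (\<Sum>k\<in>F. matrix_op ?r k * cnj (f k))"
        by (simp add: form_def ms sum_distrib_right distrib_right sum.distrib)
      then have "cmod (form F f f - (\<Sum>k\<in>F. matrix_op f k * cnj (f k))) \<le> (\<Sum>k\<in>F. cmod (matrix_op ?r k) * cmod (f k))"
        by (simp only: norm_minus_cancel) (rule sum_norm_le, simp add: norm_mult)
      also have "\<dots> \<le> l2norm (- m) (matrix_op ?r) * l2norm m f"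
        by (rule sum_pairing_le[OF f C(1)[OF r] F])
      also have "\<dots> \<le> C * l2norm m ?r * l2norm m f"
        by (intro mult_right_mono C r) simp
      finally show "cmod (form F f f - (\<Sum>k\<in>F. matrix_op f k * cnj (f k))) \<le> C * l2norm m ?r * l2norm m f" .
    qed
  qed
  show ?thesis using tendsto_add[OF 2 1] by simp
qed

text \<open>The constants for finite sets do not depend on F, so both sides of the inequality pass
  to the limit.\<close>

lemma garding:
  assumes "0 < c0" and "\<And>k x. b0 \<le> bracket k \<Longrightarrow> c0 * bracket k powr (2 * m) \<le> Re (\<sigma> k x)"
  shows "\<exists>C\<^sub>0>0. \<exists>C\<^sub>1>0. \<forall>f\<in>l2 m.
    Re (l2inner (Op_ext m \<sigma> f) f) \<ge> C\<^sub>0 * (l2norm m f)\<^sup>2 - C\<^sub>1 * (l2norm 0 f)\<^sup>2"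
proof -
  obtain C0 C1 where C: "0 < C0" "0 < C1"
    and fin: "\<And>F f. finite F \<Longrightarrow> C0 * wsq F f - C1 * ssq F f \<le> Re (form F f f)"
    using form_garding[OF assms] by blast
  have "C0 * (l2norm m f)\<^sup>2 - C1 * (l2norm 0 f)\<^sup>2 \<le> Re (l2inner (Op_ext m \<sigma> f) f)" if f: "f \<in> l2 m" for f
    unfolding Op_ext_eq
  proof (rule tendsto_le)
    show "((\<lambda>F. Re (form F f f)) \<longlongrightarrow> Re (l2inner (matrix_op f) f)) (finite_subsets_at_top UNIV)"
      by (intro tendsto_intros form_tendsto f)
    have f0: "f \<in> l2 0"
    proof (rule l2I(1))
      fix F :: "(int ^ 'n) set" assume "finite F"
      then show "(\<Sum>k\<in>F. bracket k powr (2 * 0) * (cmod (f k))\<^sup>2) \<le> (l2norm m f)\<^sup>2"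
        using order_trans[OF ssq_le_wsq wsq_le_l2norm[OF f]] by simp
    qed
    have "((\<lambda>F. wsq F f) \<longlongrightarrow> (l2norm m f)\<^sup>2) (finite_subsets_at_top UNIV)"
      unfolding wsq_def l2norm_sq using f by (intro infsum_tendsto) (simp add: mem_l2)
    moreover have "((\<lambda>F. ssq F f) \<longlongrightarrow> (l2norm 0 f)\<^sup>2) (finite_subsets_at_top UNIV)"
      using infsum_tendsto[of "\<lambda>k. bracket k powr (2 * 0) * (cmod (f k))\<^sup>2" UNIV] f0
      unfolding l2norm_sq mem_l2 by simp
    ultimately show "((\<lambda>F. C0 * wsq F f - C1 * ssq F f) \<longlongrightarrow> C0 * (l2norm m f)\<^sup>2 - C1 * (l2norm 0 f)\<^sup>2) (finite_subsets_at_top UNIV)"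
      by (intro tendsto_intros)
    show "\<forall>\<^sub>F F in finite_subsets_at_top UNIV. C0 * wsq F f - C1 * ssq F f \<le> Re (form F f f)"
      by (rule eventually_finite_subsets_at_top_weakI) (rule fin)
  qed simp
  then show ?thesis using C by blast
qed

end

theorem theorem5p8:
  fixes \<rho> \<delta> m :: real
    and \<sigma> :: "int ^ 'n \<Rightarrow> real ^ 'n \<Rightarrow> complex"
  assumes "0 \<le> \<delta>" and "\<delta> < \<rho>" and "\<rho> \<le> 1" and "m > 0"
    and "\<sigma> \<in> symbol_class (2 * m) \<rho> \<delta>"
    and "elliptic (2 * m) \<sigma>"
    and "finite {k. \<not> (\<forall>x. \<sigma> k x \<in> \<real>\<^sub>\<ge>\<^sub>0)}"
  shows "\<exists>C\<^sub>0>0. \<exists>C\<^sub>1>0. \<forall>f\<in>l2 m.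
    Re (l2inner (Op_ext m \<sigma> f) f) \<ge> C\<^sub>0 * (l2norm m f)\<^sup>2 - C\<^sub>1 * (l2norm 0 f)\<^sup>2"
proof -
  interpret torus_symbol \<sigma> m \<rho> \<delta>
    using assms(1-5) by unfold_locales
  obtain c r where c: "0 < c"
    and ell: "\<And>(k :: int ^ 'n) x. r \<le> norm (lvec k) \<Longrightarrow> c * bracket k powr (2 * m) \<le> cmod (\<sigma> k x)"
    using assms(6) unfolding elliptic_def by blast
  let ?E = "{k. \<not> (\<forall>x. \<sigma> k x \<in> \<real>\<^sub>\<ge>\<^sub>0)}"
  \<comment> \<open>From b on, ellipticity applies and the exceptional points are left behind; the
    inserted 0 covers an empty exceptional set.\<close>
  define b where "b = max (1 + r) (Max (insert 0 (bracket ` ?E)) + 1)"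
  show ?thesis
  proof (rule garding[OF c])
    fix k :: "int ^ 'n" and x assume k: "b \<le> bracket k"
    then have "r \<le> norm (lvec k)" by (simp add: b_def bracket_def)
    then have "c * bracket k powr (2 * m) \<le> cmod (\<sigma> k x)" by (rule ell)
    moreover have "k \<notin> ?E"
    proof
      assume "k \<in> ?E"
      then have "bracket k \<le> Max (insert 0 (bracket ` ?E))"
        using assms(7) by (intro Max_ge) auto
      then show False using k by (simp add: b_def)
    qed
    then have "\<sigma> k x \<in> \<real>\<^sub>\<ge>\<^sub>0" by blast
    then have "cmod (\<sigma> k x) = Re (\<sigma> k x)"
      by (metis complex_nonneg_Reals_iff cmod_eq_Re abs_of_nonneg)
    ultimately show "c * bracket k powr (2 * m) \<le> Re (\<sigma> k x)" by simp
  qed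
qed

end
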